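(* Let $\mathcal P$ be a directly regular $n$-polytope whose facets are isomorphic to $\mathcal K$, whose vertex-figures are isomorphic to $\mathcal L$, and whose medial sections are isomorphic to $\mathcal M$. Let $\mathcal Q$ be a directly regular $n$-polytope whose facets are isomorphic to $\mathcal K'$, whose vertex-figures are isomorphic to $\mathcal L'$, and whose medial sections are isomorphic to $\mathcal M'$. Suppose that $\mathcal K\diamond\mathcal K'$ and $\mathcal L\diamond\mathcal L'$ are polytopal. If $\Gamma^+(\mathcal M\diamond\mathcal M')=\Gamma^+(\mathcal M)\times\Gamma^+(\mathcal M')$, then $\mathcal P\diamond\mathcal Q$ is polytopal.
   Context: Polytopes. An (abstract) $n$-polytope is a ranked poset with ranks $-1,\dots,n$ such that: there are a unique least face $F_{-1}$ (rank $-1$) and a unique greatest face $F_n$ (rank $n$); every flag (maximal chain) has $n+2$ faces; it is strongly flag-connected (any two flags $\Phi,\Psi$ are joined by a sequence of flags, consecutive ones differing in exactly one face, all containing $\Phi\cap\Psi$); and whenever $F<G$ have ranks $j-1$ and $j+1$ there are exactly two $j$-faces strictly between them. Facets are the $(n-1)$-faces $F$ (identified with the sections $F/F_{-1}$), the vertex-figure at a vertex $F_0$ is the section $F_n/F_0$, and a medial section is a section $F_{n-1}/F_0$ of a facet over a vertex (it is an $(n-2)$-polytope). Regularity. $\mathcal P$ is regular if its automorphism group $\Gamma(\mathcal P)$ is transitive on flags. Fixing a base flag $\Phi$, $\Gamma(\mathcal P)=\langle\rho_0,\dots,\rho_{n-1}\rangle$, where $\rho_i$ maps $\Phi$ to the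 flag differing from it exactly in the $i$-face. Put $\sigma_i=\rho_{i-1}\rho_i$ for $1\le i\le n-1$; the rotation subgroup is $\Gamma^+(\mathcal P)=\langle\sigma_1,\dots,\sigma_{n-1}\rangle$ (with these specified generators; trivial if $n\le 1$), and $\mathcal P$ is directly regular if it has index $2$ in $\Gamma(\mathcal P)$. All sections of a directly regular polytope are directly regular; with respect to the base flag the facets, vertex-figures and medial sections have rotation groups $\langle\sigma_1,\dots,\sigma_{n-2}\rangle$, $\langle\sigma_2,\dots,\sigma_{n-1}\rangle$ and $\langle\sigma_2,\dots,\sigma_{n-2}\rangle$ respectively. Mix. For directly regular $n$-polytopes with $\Gamma^+(\mathcal P)=\langle\sigma_1,\dots,\sigma_{n-1}\rangle$, $\Gamma^+(\mathcal Q)=\langle\sigma_1',\dots,\sigma_{n-1}'\rangle$, let $\beta_i=(\sigma_i,\sigma_i')$ and $\Gamma^+(\mathcal P)\diamond\Gamma^+(\mathcal Q)=\langle\beta_1,\dots,\beta_{n-1}\rangle\le\Gamma^+(\mathcal P)\times\Gamma^+(\mathcal Q)$. For a group $\Gamma^+$ with specified generators $\beta_1,\dots,\beta_{n-1}$ and $I\subseteq\{0,\dots,n-1\}$, put $\Gamma^+_I=\langle\beta_i\beta_{i+1}\cdots\beta_j \mid 1\le i\le j\le n-1,\ i-1\in I,\ j\in I\rangle$. The mix $\mathcal P\diamond\mathcal Q$ is the poset built from $\Gamma^+=\Gamma^+(\mathcal P)\diamond\Gamma^+(\mathcal Q)$: its $j$-faces ($0\le j\le n-1$) are the right cosets of $\Gamma^+_{\{0,\dots,n-1\}\setminus\{j\}}$,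 together with a least face of rank $-1$ and a greatest face of rank $n$, where a $j$-face is below a $k$-face ($j<k$) if and only if the two cosets intersect (this is for $n\ge3$; in rank 2 the mix of a $p$-gon and a $q$-gon is the $\mathrm{lcm}(p,q)$-gon, and in ranks 0 and 1 there is a unique polytope and the mix is that polytope). One writes $\Gamma^+(\mathcal P\diamond\mathcal Q)=\Gamma^+(\mathcal P)\diamond\Gamma^+(\mathcal Q)$; an equation $\Gamma^+(\mathcal P\diamond\mathcal Q)=\Gamma^+(\mathcal P)\times\Gamma^+(\mathcal Q)$ means that this subgroup is the whole direct product. The mix is called polytopal if it is a polytope; equivalently, $\Gamma^+$ satisfies the intersection property $\Gamma^+_I\cap\Gamma^+_J=\Gamma^+_{I\cap J}$ for all $I,J\subseteq\{0,\dots,n-1\}$. The facets and vertex-figures of $\mathcal P\diamond\mathcal Q$ are the mixes of the facets and of the vertex-figures of $\mathcal P$ and $\mathcal Q$. *)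

theory Defs
  imports "HOL-Algebra.Bij" "HOL-Algebra.Coset" "HOL-Algebra.Generated_Groups"
begin

text \<open>A poset is a reflexive, antisymmetric and transitive relation \<open>P\<close>; its faces are the elements
  of \<open>Field P\<close>. All ranks and indices are integers, so that no subtraction is truncated.\<close>

subsection \<open>Ranked posets, sections, flags\<close>

definition flags :: "'a rel \<Rightarrow> 'a set set" where
  "flags P = {\<Phi> \<in> Chains P. \<forall>C \<in> Chains P. \<Phi> \<subseteq> C \<longrightarrow> C = \<Phi>}"

text \<open>The rank is the height, normalised to be \<open>-1\<close> for a least face. When all flags are finite of
  the same size, this is the only possible rank function.\<close>

definition face_rank :: "'a rel \<Rightarrow> 'a \<Rightarrow> int" where
  "face_rank P F = int (Max (card ` {C \<in> Chains P. \<forall>G \<in> C. (G, F) \<in> P})) - 2"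

definition faces :: "'a rel \<Rightarrow> int \<Rightarrow> 'a set" where
  "faces P j = {F \<in> Field P. face_rank P F = j}"

definition ranked :: "int \<Rightarrow> 'a rel \<Rightarrow> bool" where
  "ranked n P \<longleftrightarrow>
     (\<forall>F \<in> Field P. face_rank P F \<in> {-1..n}) \<and>
     (\<forall>F G. (F, G) \<in> P \<and> F \<noteq> G \<longrightarrow> face_rank P F < face_rank P G)"

definition is_least_face :: "'a rel \<Rightarrow> 'a \<Rightarrow> bool" where
  "is_least_face P F \<longleftrightarrow> F \<in> Field P \<and> (\<forall>G \<in> Field P. (F, G) \<in> P)"

definition is_greatest_face :: "'a rel \<Rightarrow> 'a \<Rightarrow> bool" where
  "is_greatest_face P F \<longleftrightarrow> F \<in> Field P \<and> (\<forall>G \<in> Field P. (G, F) \<in> P)"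

definition least_face :: "'a rel \<Rightarrow> 'a" where
  "least_face P = (THE F. is_least_face P F)"

definition greatest_face :: "'a rel \<Rightarrow> 'a" where
  "greatest_face P = (THE F. is_greatest_face P F)"

text \<open>\<open>face_section P F G\<close> is the section usually written $G/F$.\<close>

definition face_section :: "'a rel \<Rightarrow> 'a \<Rightarrow> 'a \<Rightarrow> 'a rel" where
  "face_section P F G = Restr P {H. (F, H) \<in> P \<and> (H, G) \<in> P}"

definition adjacent :: "'a set \<Rightarrow> 'a set \<Rightarrow> bool" where
  "adjacent \<Phi> \<Psi> \<longleftrightarrow> (\<exists>F G. \<Phi> - \<Psi> = {F} \<and> \<Psi> - \<Phi> = {G})"

definition adjacent_at :: "'a rel \<Rightarrow> int \<Rightarrow> 'a set \<Rightarrow> 'a set \<Rightarrow> bool" where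
  "adjacent_at P i \<Phi> \<Psi> \<longleftrightarrow>
     (\<exists>F \<in> faces P i. \<exists>G \<in> faces P i. \<Phi> - \<Psi> = {F} \<and> \<Psi> - \<Phi> = {G})"

definition strongly_flag_connected :: "'a rel \<Rightarrow> bool" where
  "strongly_flag_connected P \<longleftrightarrow>
     (\<forall>\<Phi> \<in> flags P. \<forall>\<Psi> \<in> flags P.
        (\<Phi>, \<Psi>) \<in> {(X, Y). X \<in> flags P \<and> Y \<in> flags P \<and> adjacent X Y \<and>
                         \<Phi> \<inter> \<Psi> \<subseteq> X \<and> \<Phi> \<inter> \<Psi> \<subseteq> Y}\<^sup>*)"

definition polytope :: "int \<Rightarrow> 'a rel \<Rightarrow> bool" where
  "polytope n P \<longleftrightarrow>
     Partial_order P \<and> ranked n P \<and>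
     (\<exists>!F. is_least_face P F) \<and> (\<exists>!F. is_greatest_face P F) \<and>
     (\<forall>\<Phi> \<in> flags P. finite \<Phi> \<and> int (card \<Phi>) = n + 2) \<and>
     strongly_flag_connected P \<and>
     (\<forall>j. \<forall>F \<in> faces P (j - 1). \<forall>G \<in> faces P (j + 1). (F, G) \<in> P \<longrightarrow>
        card {H \<in> faces P j. (F, H) \<in> P \<and> (H, G) \<in> P} = 2)"

subsection \<open>Isomorphisms, automorphism groups, regularity\<close>

definition is_isomorphism :: "'a rel \<Rightarrow> 'b rel \<Rightarrow> ('a \<Rightarrow> 'b) \<Rightarrow> bool" where
  "is_isomorphism P Q f \<longleftrightarrow>
     bij_betw f (Field P) (Field Q) \<and>
     (\<forall>F \<in> Field P. \<forall>G \<in> Field P. (F, G) \<in> P \<longleftrightarrow> (f F, f G) \<in> Q)"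

definition isomorphic :: "'a rel \<Rightarrow> 'b rel \<Rightarrow> bool" where
  "isomorphic P Q \<longleftrightarrow> (\<exists>f. is_isomorphism P Q f)"

definition aut_group :: "'a rel \<Rightarrow> ('a \<Rightarrow> 'a) monoid" where
  "aut_group P =
     (BijGroup (Field P))\<lparr>carrier := {f \<in> Bij (Field P). is_isomorphism P P f}\<rparr>"

definition regular :: "'a rel \<Rightarrow> bool" where
  "regular P \<longleftrightarrow> (\<forall>\<Phi> \<in> flags P. \<forall>\<Psi> \<in> flags P. \<exists>f \<in> carrier (aut_group P). f ` \<Phi> = \<Psi>)"

text \<open>Multiplication in \<open>aut_group P\<close> is composition of maps, which act on the left. Acting
  on the right instead gives the opposite group, and inversion is an isomorphism onto it that fixes
  each \<open>rho P \<Phi> i\<close>; so nothing below depends on this choice.\<close>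

definition rho :: "'a rel \<Rightarrow> 'a set \<Rightarrow> int \<Rightarrow> ('a \<Rightarrow> 'a)" where
  "rho P \<Phi> i = (THE f. f \<in> carrier (aut_group P) \<and> adjacent_at P i \<Phi> (f ` \<Phi>))"

definition sigma :: "'a rel \<Rightarrow> 'a set \<Rightarrow> int \<Rightarrow> ('a \<Rightarrow> 'a)" where
  "sigma P \<Phi> i = rho P \<Phi> (i - 1) \<otimes>\<^bsub>aut_group P\<^esub> rho P \<Phi> i"

definition rotation_group :: "int \<Rightarrow> 'a rel \<Rightarrow> 'a set \<Rightarrow> ('a \<Rightarrow> 'a) monoid" where
  "rotation_group n P \<Phi> =
     (aut_group P)\<lparr>carrier := generate (aut_group P) (sigma P \<Phi> ` {1..n - 1})\<rparr>"

definition directly_regular :: "int \<Rightarrow> 'a rel \<Rightarrow> bool" where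
  "directly_regular n P \<longleftrightarrow>
     polytope n P \<and> regular P \<and>
     (\<forall>\<Phi> \<in> flags P. card (rcosets\<^bsub>aut_group P\<^esub> (carrier (rotation_group n P \<Phi>))) = 2)"

subsection \<open>The mix\<close>

definition beta ::
    "'a rel \<Rightarrow> 'a set \<Rightarrow> 'b rel \<Rightarrow> 'b set \<Rightarrow> int \<Rightarrow> ('a \<Rightarrow> 'a) \<times> ('b \<Rightarrow> 'b)" where
  "beta P \<Phi> Q \<Psi> i = (sigma P \<Phi> i, sigma Q \<Psi> i)"

definition mix_group ::
    "int \<Rightarrow> 'a rel \<Rightarrow> 'a set \<Rightarrow> 'b rel \<Rightarrow> 'b set \<Rightarrow> (('a \<Rightarrow> 'a) \<times> ('b \<Rightarrow> 'b)) monoid" where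
  "mix_group n P \<Phi> Q \<Psi> =
     (let D = rotation_group n P \<Phi> \<times>\<times> rotation_group n Q \<Psi>
      in D\<lparr>carrier := generate D (beta P \<Phi> Q \<Psi> ` {1..n - 1})\<rparr>)"

definition range_prod :: "('g, 'r) monoid_scheme \<Rightarrow> (int \<Rightarrow> 'g) \<Rightarrow> int \<Rightarrow> int \<Rightarrow> 'g" where
  "range_prod G b i j = foldr (\<lambda>k x. b k \<otimes>\<^bsub>G\<^esub> x) [i..j] \<one>\<^bsub>G\<^esub>"

text \<open>The subgroup $\Gamma^+_I$ of a group with specified generators $\beta_1, \dots, \beta_{n-1}$.\<close>

definition gen_subgroup ::
    "int \<Rightarrow> ('g, 'r) monoid_scheme \<Rightarrow> (int \<Rightarrow> 'g) \<Rightarrow> int set \<Rightarrow> 'g set" where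
  "gen_subgroup n G b I =
     generate G {range_prod G b i j | i j. 1 \<le> i \<and> i \<le> j \<and> j \<le> n - 1 \<and> i - 1 \<in> I \<and> j \<in> I}"

text \<open>Faces of a mix: proper faces are cosets tagged with their rank (rank at least 3), or the
  vertices and edges of a polygon or segment (ranks 2 and 1).\<close>

datatype 'g mix_face = Bottom | Coset int "'g set" | Vertex int | Edge int | Top

text \<open>\<open>R\<close> is the strict incidence relation between the proper faces \<open>X\<close>.\<close>

definition bounded_poset :: "'g mix_face set \<Rightarrow> 'g mix_face rel \<Rightarrow> 'g mix_face rel" where
  "bounded_poset X R =
     (let Y = insert Bottom (insert Top X) in Id_on Y \<union> {Bottom} \<times> Y \<union> Y \<times> {Top} \<union> R)"

definition coset_poset :: "int \<Rightarrow> ('g, 'r) monoid_scheme \<Rightarrow> (int \<Rightarrow> 'g) \<Rightarrow> 'g mix_face rel" where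
  "coset_poset n G b =
     (let X = {Coset j A | j A. j \<in> {0..n - 1} \<and> A \<in> rcosets\<^bsub>G\<^esub> (gen_subgroup n G b ({0..n - 1} - {j}))}
      in bounded_poset X
           {(x, y). x \<in> X \<and> y \<in> X \<and>
              (\<exists>j k A B. x = Coset j A \<and> y = Coset k B \<and> j < k \<and> A \<inter> B \<noteq> {})})"

text \<open>The \<open>p\<close>-gon, where \<open>p = 0\<close> encodes the infinite polygon (apeirogon), since \<open>k mod 0 = k\<close>.
  The edge \<open>k\<close> joins the vertices \<open>k\<close> and \<open>k + 1\<close>, modulo \<open>p\<close>.\<close>

definition polygon :: "nat \<Rightarrow> 'g mix_face rel" where
  "polygon p =
     bounded_poset
       (range (\<lambda>k. Vertex (k mod int p)) \<union> range (\<lambda>k. Edge (k mod int p)))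
       (range (\<lambda>k. (Vertex (k mod int p), Edge (k mod int p))) \<union>
        range (\<lambda>k. (Vertex ((k + 1) mod int p), Edge (k mod int p))))"

text \<open>The mix with respect to base flags \<open>\<Phi>\<close> and \<open>\<Psi>\<close>. In rank 2, \<open>card\<close> of an infinite vertex set
  is \<open>0\<close>, which agrees with the encoding of apeirogons, and \<open>lcm 0 q = 0\<close> is
  the usual convention that the lcm with infinity is infinity.
  The last two cases are the unique polytopes of ranks 1 and 0.\<close>

definition mix ::
    "int \<Rightarrow> 'a rel \<Rightarrow> 'a set \<Rightarrow> 'b rel \<Rightarrow> 'b set \<Rightarrow> (('a \<Rightarrow> 'a) \<times> ('b \<Rightarrow> 'b)) mix_face rel" where
  "mix n P \<Phi> Q \<Psi> =
     (if n \<ge> 3 then coset_poset n (mix_group n P \<Phi> Q \<Psi>) (beta P \<Phi> Q \<Psi>)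
      else if n = 2 then polygon (lcm (card (faces P 0)) (card (faces Q 0)))
      else if n = 1 then bounded_poset {Vertex 0, Vertex 1} {}
      else bounded_poset {} {})"

end

theory Submission
  imports Defs
begin

text \<open>Let \<open>\<rho>\<^sub>i\<close> and \<open>\<rho>'\<^sub>i\<close> be the distinguished generators of the automorphism groups of \<open>P\<close> and \<open>Q\<close>, put
  \<open>r\<^sub>i = (\<rho>\<^sub>i, \<rho>'\<^sub>i)\<close>, and write \<open>\<Gamma>\<^sub>I\<close> for the group generated by the \<open>r\<^sub>i\<close> with \<open>i \<in> I\<close>. The group of the mix
  consists of the words of even length in the \<open>r\<^sub>i\<close>, and its distinguished subgroup for \<open>I\<close> consists of
  the even words in the \<open>r\<^sub>i\<close> with \<open>i \<in> I\<close>. The proof works with all words instead of the even ones: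
  cosets of the even subgroups correspond to cosets of the \<open>\<Gamma>\<^sub>I\<close>, the elements \<open>x\<close> of the whole group
  correspond to the flags of the mix, and \<open>r\<^sub>i x\<close> is the flag \<open>i\<close>-adjacent to \<open>x\<close>.

  The first ingredient, \<open>polytope_coset_poset_iff\<close>, is that the coset poset is a polytope if and only
  if \<open>\<Gamma>\<^sub>I \<inter> \<Gamma>\<^sub>J = \<Gamma>\<^bsub>I \<inter> J\<^esub>\<close> for all \<open>I\<close> and \<open>J\<close>. The order, the ranks and the shape of the flags only use that
  generators with distant indices commute; the intersection property gives strong
  flag-connectedness and the diamond condition. Conversely, in a polytope a chain of adjacent flags
  that all contain the faces common to its ends spells a word that avoids the ranks of these faces.
  This recovers the intersection property because an element that lies in all the maximal \<open>\<Gamma>\<^sub>I\<close> fixes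
  both base flags, hence is trivial.

  The second ingredient, \<open>section_words\<close>, compares a section of the base flag of \<open>P\<close> with an arbitrary
  poset isomorphic to it, equipped with an arbitrary base flag: words in its generators
  satisfy exactly the relations of the corresponding words in the \<open>\<rho>\<^sub>i\<close>. So polytopality of the mixes
  of the facets and of the vertex-figures says that \<open>r\<^sub>0, ..., r\<^bsub>n-2\<^esub>\<close> and \<open>r\<^sub>1, ..., r\<^bsub>n-1\<^esub>\<close> have the
  intersection property.

  The third ingredient, \<open>intersection_property_from_ends\<close>, says that the intersection property of all
  of \<open>r\<^sub>0, ..., r\<^bsub>n-1\<^esub>\<close> follows, provided that every element generated both by \<open>r\<^sub>0, ..., r\<^bsub>n-2\<^esub>\<close> and by
  \<open>r\<^sub>1, ..., r\<^bsub>n-1\<^esub>\<close> is generated by \<open>r\<^sub>1, ..., r\<^bsub>n-2\<^esub>\<close>. The components of such an element fix the base vertex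
  and the base facet, so each component is a word in the generators with indices
  \<open>1, ..., n - 2\<close>, and by direct regularity both words have the same parity. If they are even, then the
  element is a pair of rotations of the medial sections, and the hypothesis on the medial sections says
  that it lies in the group of their mix; if they are odd, multiply by \<open>r\<^sub>1\<close> first.

  This argument needs \<open>n \<ge> 3\<close>. The case \<open>n \<le> 0\<close> cannot occur since the rotation subgroup has index 2,
  and for \<open>n = 1\<close> and \<open>n = 2\<close> the mix is a segment or a polygon. For \<open>n = 3\<close> the mixes of the facets and of the
  vertex-figures are polygons instead of coset posets; the intersection property of the two generators
  that belong to each of them is automatic.\<close>

section \<open>Posets assembled from flags\<close>

abbreviation flag_adjacency :: "'a rel \<Rightarrow> 'a set rel" where
  "flag_adjacency P \<equiv> {(X, Y). X \<in> flags P \<and> Y \<in> flags P \<and> (\<exists>i. adjacent_at P i X Y)}"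

abbreviation flag_adjacency_above :: "'a rel \<Rightarrow> 'a set \<Rightarrow> 'a set rel" where
  "flag_adjacency_above P D \<equiv>
     {(X, Y). X \<in> flags P \<and> Y \<in> flags P \<and> adjacent X Y \<and> D \<subseteq> X \<and> D \<subseteq> Y}"

text \<open>The rank is defined by the largest chain below a face, so it is determined by one chain of the right
  size, once some strictly increasing function bounds the size of all the others.\<close>
lemma face_rank_eqI:
  assumes mono: "\<And>F G. (F, G) \<in> P \<Longrightarrow> F \<noteq> G \<Longrightarrow> rk F < (rk G :: int)"
    and ge: "\<And>F. F \<in> Field P \<Longrightarrow> -1 \<le> rk F"
    and C: "C \<in> Chains P" "\<forall>G \<in> C. (G, F) \<in> P" and card: "int (card C) = rk F + 2"
  shows "face_rank P F = rk F"
proof -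
  let ?S = "{C \<in> Chains P. \<forall>G \<in> C. (G, F) \<in> P}"
  have bound: "card D \<le> nat (rk F + 2)" if D: "D \<in> ?S" for D
  proof -
    have inj: "inj_on rk D"
    proof (rule inj_onI, rule ccontr)
      fix x y assume xy: "x \<in> D" "y \<in> D" "rk x = rk y" "x \<noteq> y"
      then have "(x, y) \<in> P \<or> (y, x) \<in> P" using D by (auto simp: Chains_def)
      then show False using mono[of x y] mono[of y x] xy by auto
    qed
    have "rk ` D \<subseteq> {-1..rk F}"
    proof
      fix k assume "k \<in> rk ` D"
      then obtain x where x: "x \<in> D" "k = rk x" by auto
      then have "(x, F) \<in> P" using D by auto
      then show "k \<in> {-1..rk F}" using ge[of x] mono[of x F] x(2)
        by (cases "x = F") (auto simp: Field_def)
    qed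
    then have "card (rk ` D) \<le> card {-1..rk F}" by (intro card_mono) auto
    then show ?thesis using inj by (simp add: card_image)
  qed
  have "Max (card ` ?S) = card C"
  proof (rule Max_eqI)
    show "finite (card ` ?S)"
      by (rule finite_subset[of _ "{..nat (rk F + 2)}"]) (use bound in auto)
    show "card C \<in> card ` ?S" using C by auto
    fix y assume "y \<in> card ` ?S"
    then show "y \<le> card C" using bound card by force
  qed
  then show ?thesis unfolding face_rank_def using card by simp
qed

text \<open>A graded poset can be presented by a set \<open>X\<close> of indices of its flags together with the \<open>i\<close>-face \<open>fc i x\<close>
  of each flag \<open>x\<close>; two faces are incident when some flag contains both. The assumption that two flags
  with a common face can be spliced there makes incidence transitive and makes every chain part of
  an indexed flag. Segments, polygons and coset posets are all of this kind.\<close>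
locale flag_system =
  fixes X :: "'x set" and fc :: "int \<Rightarrow> 'x \<Rightarrow> 'f" and n :: int
  assumes rank_ge: "-1 \<le> n" and nonempty: "X \<noteq> {}"
    and graded: "\<And>i j x y. \<lbrakk>i \<in> {-1..n}; j \<in> {-1..n}; x \<in> X; y \<in> X; fc i x = fc j y\<rbrakk> \<Longrightarrow> i = j"
    and bot: "\<And>x y. x \<in> X \<Longrightarrow> y \<in> X \<Longrightarrow> fc (-1) x = fc (-1) y"
    and top: "\<And>x y. x \<in> X \<Longrightarrow> y \<in> X \<Longrightarrow> fc n x = fc n y"
    and splice: "\<And>m x y. \<lbrakk>m \<in> {0..n-1}; x \<in> X; y \<in> X; fc m x = fc m y\<rbrakk> \<Longrightarrow>
      \<exists>z \<in> X. (\<forall>j \<in> {-1..m}. fc j z = fc j x) \<and> (\<forall>j \<in> {m..n}. fc j z = fc j y)"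
begin

definition face_poset :: "'f rel" where
  "face_poset = {(fc i x, fc j x) | i j x. x \<in> X \<and> -1 \<le> i \<and> i \<le> j \<and> j \<le> n}"

definition flag_of :: "'x \<Rightarrow> 'f set" where
  "flag_of x = (\<lambda>i. fc i x) ` {-1..n}"

lemma splice_any_rank:
  assumes "m \<in> {-1..n}" "x \<in> X" "y \<in> X" "fc m x = fc m y"
  shows "\<exists>z \<in> X. (\<forall>j \<in> {-1..m}. fc j z = fc j x) \<and> (\<forall>j \<in> {m..n}. fc j z = fc j y)"
proof -
  consider "m = -1" | "m = n" | "m \<in> {0..n-1}" using assms(1) by fastforce
  then show ?thesis
  proof cases
    case 1
    then have "\<forall>j \<in> {-1..m}. fc j y = fc j x" using bot[of y x] assms by auto
    then show ?thesis using assms(3) by blast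
  next
    case 2
    then have "\<forall>j \<in> {m..n}. fc j x = fc j y" using top[of x y] assms by auto
    then show ?thesis using assms(2) by blast
  qed (use splice assms in blast)
qed

lemma face_poset_iff:
  assumes "x \<in> X" "y \<in> X" "i \<in> {-1..n}" "j \<in> {-1..n}"
  shows "(fc i x, fc j y) \<in> face_poset \<longleftrightarrow> i \<le> j \<and> (\<exists>z \<in> X. fc i z = fc i x \<and> fc j z = fc j y)"
proof
  assume "(fc i x, fc j y) \<in> face_poset"
  then obtain i' j' z where z: "z \<in> X" "-1 \<le> i'" "i' \<le> j'" "j' \<le> n"
    "fc i x = fc i' z" "fc j y = fc j' z" unfolding face_poset_def by auto
  then have "i = i'" "j = j'" using graded[of i i' x z] graded[of j j' y z] assms by auto
  then show "i \<le> j \<and> (\<exists>z \<in> X. fc i z = fc i x \<and> fc j z = fc j y)" using z by force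
next
  assume "i \<le> j \<and> (\<exists>z \<in> X. fc i z = fc i x \<and> fc j z = fc j y)"
  then show "(fc i x, fc j y) \<in> face_poset" unfolding face_poset_def using assms
    by simp (metis (no_types, lifting))
qed

lemma face_posetI: "x \<in> X \<Longrightarrow> -1 \<le> i \<Longrightarrow> i \<le> j \<Longrightarrow> j \<le> n \<Longrightarrow> (fc i x, fc j x) \<in> face_poset"
  unfolding face_poset_def by auto

lemma Field_face_poset: "Field face_poset = {fc i x | i x. i \<in> {-1..n} \<and> x \<in> X}"
proof -
  have "fc i x \<in> Field face_poset" if "i \<in> {-1..n}" "x \<in> X" for i x
    using face_posetI[of x i i] that by (auto simp: Field_def)
  then show ?thesis by (fastforce simp: Field_def face_poset_def)
qed

lemma Field_face_posetE:
  assumes "F \<in> Field face_poset"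
  obtains i x where "F = fc i x" "i \<in> {-1..n}" "x \<in> X"
  using assms Field_face_poset by auto

lemma partial_order_face_poset: "Partial_order face_poset"
proof -
  have "refl_on (Field face_poset) face_poset"
    by (auto simp: refl_on_def elim!: Field_face_posetE intro: face_posetI)
  moreover have "antisym face_poset"
  proof (rule antisymI)
    fix F G assume FG: "(F, G) \<in> face_poset" "(G, F) \<in> face_poset"
    then obtain i j x where x: "x \<in> X" "-1 \<le> i" "i \<le> j" "j \<le> n" "F = fc i x" "G = fc j x"
      unfolding face_poset_def by auto
    then show "F = G" using face_poset_iff[of x x j i] FG by auto
  qed
  moreover have "trans face_poset"
  proof (rule transI)
    fix F G H assume FG: "(F, G) \<in> face_poset" and GH: "(G, H) \<in> face_poset"
    obtain i j x where x: "x \<in> X" "-1 \<le> i" "i \<le> j" "j \<le> n" "F = fc i x" "G = fc j x"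
      using FG unfolding face_poset_def by auto
    obtain j' k y where y: "y \<in> X" "-1 \<le> j'" "j' \<le> k" "k \<le> n" "G = fc j' y" "H = fc k y"
      using GH unfolding face_poset_def by auto
    have j': "j' = j" using graded[of j' j y x] x y by auto
    then obtain z where "z \<in> X" "\<forall>i \<in> {-1..j}. fc i z = fc i x" "\<forall>i \<in> {j..n}. fc i z = fc i y"
      using splice_any_rank[of j x y] x y by auto
    then show "(F, H) \<in> face_poset" using face_posetI[of z i k] x y j' by auto
  qed
  moreover have "face_poset \<subseteq> Field face_poset \<times> Field face_poset"
    by (auto simp: Field_def)
  ultimately show ?thesis by (simp add: order_on_defs)
qed

lemma strict_graded:
  assumes "(fc i x, fc j y) \<in> face_poset" "i \<in> {-1..n}" "j \<in> {-1..n}" "x \<in> X" "y \<in> X"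
    "fc i x \<noteq> fc j y"
  shows "i < j"
  using assms face_poset_iff[of x y i j] by (cases "i = j") auto

text \<open>Splice from the bottom upwards: the next face is incident with the highest face so far, so some flag \<open>z\<close>
  contains both, and the flag through the lower faces is continued by the upper part of \<open>z\<close>.\<close>
lemma compatible_faces_in_flag:
  assumes "finite T" "T \<subseteq> {-1..n}" "\<forall>i \<in> T. y i \<in> X"
    and "\<forall>i \<in> T. \<forall>j \<in> T. i < j \<longrightarrow> (fc i (y i), fc j (y j)) \<in> face_poset"
  shows "\<exists>x \<in> X. \<forall>i \<in> T. fc i x = fc i (y i)"
  using assms
proof (induction T rule: finite_linorder_max_induct)
  case empty
  then show ?case using nonempty by auto
next
  case (insert b A)
  show ?case
  proof (cases "A = {}")
    case True
    then show ?thesis using insert.prems by auto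
  next
    case False
    obtain x where x: "x \<in> X" "\<And>i. i \<in> A \<Longrightarrow> fc i x = fc i (y i)"
      using insert.IH insert.prems by auto
    define m where "m = Max A"
    have m: "m \<in> A" "\<And>i. i \<in> A \<Longrightarrow> i \<le> m" unfolding m_def using insert.hyps(1) False by auto
    have mb: "m < b" "m \<in> {-1..n}" "b \<in> {-1..n}" "y b \<in> X"
      using m insert.hyps(2) insert.prems by auto
    have "(fc m (y m), fc b (y b)) \<in> face_poset" using insert.prems(3) m(1) mb(1) by auto
    then obtain z where z: "z \<in> X" "fc m z = fc m x" "fc b z = fc b (y b)"
      using face_poset_iff[OF x(1) mb(4,2,3)] x(2)[OF m(1)] by auto
    obtain u where u: "u \<in> X" "\<forall>j \<in> {-1..m}. fc j u = fc j x" "\<forall>j \<in> {m..n}. fc j u = fc j z"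
      using splice_any_rank[OF mb(2) x(1) z(1)] z(2) by auto
    have "fc i u = fc i (y i)" if "i \<in> A" for i
      using u(2) x(2)[OF that] m(2)[OF that] insert.prems(1) that by auto
    moreover have "fc b u = fc b (y b)" using u(3) z(3) mb by auto
    ultimately show ?thesis using u(1) by auto
  qed
qed

lemma chain_in_flag:
  assumes C: "C \<in> Chains face_poset"
  shows "\<exists>x \<in> X. C \<subseteq> flag_of x"
proof -
  have CF: "C \<subseteq> Field face_poset" using C by (auto simp: Chains_def Field_def)
  define T where "T = {i \<in> {-1..n}. \<exists>x \<in> X. fc i x \<in> C}"
  define y where "y i = (SOME x. x \<in> X \<and> fc i x \<in> C)" for i
  have y: "y i \<in> X" "fc i (y i) \<in> C" if "i \<in> T" for i
    using that someI_ex[of "\<lambda>x. x \<in> X \<and> fc i x \<in> C"] unfolding y_def T_def by blast+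
  have comparable: "(F, G) \<in> face_poset \<or> (G, F) \<in> face_poset" if "F \<in> C" "G \<in> C" for F G
    using C that by (auto simp: Chains_def)
  have range: "i \<in> {-1..n}" if "i \<in> T" for i using that by (simp add: T_def)
  have "(fc i (y i), fc j (y j)) \<in> face_poset" if ij: "i \<in> T" "j \<in> T" "i < j" for i j
    using comparable[OF y(2)[OF ij(1)] y(2)[OF ij(2)]]
      face_poset_iff[OF y(1)[OF ij(2)] y(1)[OF ij(1)] range[OF ij(2)] range[OF ij(1)]] ij(3) by auto
  then obtain x where x: "x \<in> X" "\<And>i. i \<in> T \<Longrightarrow> fc i x = fc i (y i)"
    using compatible_faces_in_flag[of T y] y(1) range finite_subset[of T "{-1..n}"] by blast
  have "C \<subseteq> flag_of x"
  proof
    fix F assume F: "F \<in> C"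
    then obtain j u where j: "F = fc j u" "j \<in> {-1..n}" "u \<in> X"
      using CF Field_face_posetE by (metis subsetD)
    then have jT: "j \<in> T" using F by (auto simp: T_def)
    have "fc j u = fc j (y j)"
      using comparable[OF F y(2)[OF jT]] strict_graded[of j u j "y j"] strict_graded[of j "y j" j u]
        j y(1)[OF jT] by fastforce
    then have "F = fc j x" using j(1) x(2)[OF jT] by simp
    then show "F \<in> flag_of x" unfolding flag_of_def using j(2) by blast
  qed
  then show ?thesis using x(1) by auto
qed

lemma flag_of_chain: "x \<in> X \<Longrightarrow> flag_of x \<in> Chains face_poset"
  unfolding Chains_def flag_of_def using face_posetI by auto (meson linear)

lemma flag_of_subset: "\<lbrakk>x \<in> X; y \<in> X; flag_of x \<subseteq> flag_of y; i \<in> {-1..n}\<rbrakk> \<Longrightarrow> fc i x = fc i y"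
  unfolding flag_of_def using graded[of i _ x y] by (metis (no_types, lifting) image_iff subsetD)

lemma flag_of_eqI: "(\<And>i. i \<in> {-1..n} \<Longrightarrow> fc i x = fc i y) \<Longrightarrow> flag_of x = flag_of y"
  unfolding flag_of_def by auto

lemma in_flag_of_iff:
  "\<lbrakk>x \<in> X; y \<in> X; i \<in> {-1..n}\<rbrakk> \<Longrightarrow> fc i y \<in> flag_of x \<longleftrightarrow> fc i y = fc i x"
  unfolding flag_of_def using graded[of i _ y x] by (metis (no_types, lifting) image_iff)

lemma flags_face_poset: "flags face_poset = flag_of ` X"
proof -
  have "flag_of x \<in> flags face_poset" if x: "x \<in> X" for x
    unfolding flags_def
  proof (intro CollectI conjI ballI impI)
    show "flag_of x \<in> Chains face_poset" using flag_of_chain x .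
    fix C assume C: "C \<in> Chains face_poset" "flag_of x \<subseteq> C"
    obtain y where y: "y \<in> X" "C \<subseteq> flag_of y" using chain_in_flag C by meson
    then have "flag_of x = flag_of y" using flag_of_subset[of x y] C x by (intro flag_of_eqI) auto
    then show "C = flag_of x" using C y by auto
  qed
  moreover have "A \<in> flag_of ` X" if A: "A \<in> flags face_poset" for A
  proof -
    obtain x where "x \<in> X" "A \<subseteq> flag_of x" using A chain_in_flag[of A] by (auto simp: flags_def)
    then show ?thesis using A flag_of_chain[of x] by (auto simp: flags_def)
  qed
  ultimately show ?thesis by auto
qed

lemma inj_on_fc: "x \<in> X \<Longrightarrow> inj_on (\<lambda>i. fc i x) {-1..n}"
  using graded by (auto simp: inj_on_def)

lemma face_rank_fc:
  assumes x: "x \<in> X" and i: "i \<in> {-1..n}"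
  shows "face_rank face_poset (fc i x) = i"
proof -
  define rk where "rk F = (THE k. k \<in> {-1..n} \<and> (\<exists>y \<in> X. F = fc k y))" for F
  have rk: "rk (fc k y) = k" if "k \<in> {-1..n}" "y \<in> X" for k y
    unfolding rk_def using that graded by (intro the_equality) blast+
  have "face_rank face_poset (fc i x) = rk (fc i x)"
  proof (rule face_rank_eqI[where C = "(\<lambda>k. fc k x) ` {-1..i}"])
    show "rk F < rk G" if "(F, G) \<in> face_poset" "F \<noteq> G" for F G
      using that strict_graded rk Field_face_posetE[of F] Field_face_posetE[of G]
      by (smt (verit) FieldI1 FieldI2)
    show "-1 \<le> rk F" if "F \<in> Field face_poset" for F
      using Field_face_posetE[OF that] rk by (metis atLeastAtMost_iff)
    show "(\<lambda>k. fc k x) ` {-1..i} \<in> Chains face_poset"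
      using flag_of_chain[OF x] i unfolding flag_of_def Chains_def by auto
    show "\<forall>G \<in> (\<lambda>k. fc k x) ` {-1..i}. (G, fc i x) \<in> face_poset" using face_posetI x i by auto
    have "inj_on (\<lambda>k. fc k x) {-1..i}"
      using inj_on_fc[OF x] by (rule inj_on_subset) (use i in auto)
    then show "int (card ((\<lambda>k. fc k x) ` {-1..i})) = rk (fc i x) + 2"
      using rk[OF i x] i by (simp add: card_image)
  qed
  then show ?thesis using rk x i by simp
qed

lemma faces_face_poset:
  "faces face_poset j = (if j \<in> {-1..n} then (\<lambda>x. fc j x) ` X else {})"
proof -
  have "F \<in> faces face_poset j \<longleftrightarrow> j \<in> {-1..n} \<and> (\<exists>x \<in> X. F = fc j x)" for F
  proof
    assume F: "F \<in> faces face_poset j"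
    then obtain i x where "F = fc i x" "i \<in> {-1..n}" "x \<in> X"
      unfolding faces_def by (auto elim: Field_face_posetE)
    then show "j \<in> {-1..n} \<and> (\<exists>x \<in> X. F = fc j x)" using F face_rank_fc by (auto simp: faces_def)
  next
    assume "j \<in> {-1..n} \<and> (\<exists>x \<in> X. F = fc j x)"
    then show "F \<in> faces face_poset j" using face_rank_fc Field_face_poset by (auto simp: faces_def)
  qed
  then show ?thesis by auto
qed

lemma between_eq:
  assumes x: "x \<in> X" and j: "j \<in> {0..n-1}"
  shows "{H \<in> faces face_poset j. (fc (j-1) x, H) \<in> face_poset \<and> (H, fc (j+1) x) \<in> face_poset} =
    {fc j y | y. y \<in> X \<and> fc (j-1) y = fc (j-1) x \<and> fc (j+1) y = fc (j+1) x}" (is "?L = ?R")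
proof
  show "?R \<subseteq> ?L"
  proof
    fix H assume "H \<in> ?R"
    then obtain y where y: "y \<in> X" "H = fc j y" "fc (j-1) y = fc (j-1) x" "fc (j+1) y = fc (j+1) x"
      by auto
    then show "H \<in> ?L"
      using face_posetI[of y "j-1" j] face_posetI[of y j "j+1"] faces_face_poset[of j] j
      by auto
  qed
  show "?L \<subseteq> ?R"
  proof
    fix H assume H: "H \<in> ?L"
    then obtain y where y: "y \<in> X" "H = fc j y" using faces_face_poset[of j] j by auto
    have "{fc (j-1) x, H, fc (j+1) x} \<in> Chains face_poset"
      using H face_posetI[of x "j-1" "j-1"] face_posetI[of x "j-1" "j+1"] face_posetI[of x "j+1" "j+1"]
        face_posetI[of y j j] x y j by (auto simp: Chains_def)
    then obtain z where z: "z \<in> X" "{fc (j-1) x, H, fc (j+1) x} \<subseteq> flag_of z"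
      using chain_in_flag by blast
    then have "fc (j-1) x = fc (j-1) z" "H = fc j z" "fc (j+1) x = fc (j+1) z"
      using in_flag_of_iff[of z x "j-1"] in_flag_of_iff[of z x "j+1"] in_flag_of_iff[of z y j] x y j
        by auto
    then show "H \<in> ?R" using z(1) by force
  qed
qed

lemma least_face_poset: "\<exists>!F. is_least_face face_poset F"
proof -
  obtain x0 where x0: "x0 \<in> X" using nonempty by auto
  have "is_least_face face_poset (fc (-1) x0)" unfolding is_least_face_def Field_face_poset
  proof (intro conjI ballI)
    show "fc (-1) x0 \<in> {fc i x |i x. i \<in> {-1..n} \<and> x \<in> X}" using x0 rank_ge by auto
    fix G assume "G \<in> {fc i x |i x. i \<in> {-1..n} \<and> x \<in> X}"
    then obtain i x where "G = fc i x" "i \<in> {-1..n}" "x \<in> X" by auto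
    then show "(fc (-1) x0, G) \<in> face_poset" using face_posetI[of x "-1" i] bot[OF x0, of x] by auto
  qed
  then show ?thesis using partial_order_face_poset
    by (auto simp: is_least_face_def order_on_defs dest: antisymD)
qed

lemma greatest_face_poset: "\<exists>!F. is_greatest_face face_poset F"
proof -
  obtain x0 where x0: "x0 \<in> X" using nonempty by auto
  have "is_greatest_face face_poset (fc n x0)" unfolding is_greatest_face_def Field_face_poset
  proof (intro conjI ballI)
    show "fc n x0 \<in> {fc i x |i x. i \<in> {-1..n} \<and> x \<in> X}" using x0 rank_ge by auto
    fix G assume "G \<in> {fc i x |i x. i \<in> {-1..n} \<and> x \<in> X}"
    then obtain i x where "G = fc i x" "i \<in> {-1..n}" "x \<in> X" by auto
    then show "(G, fc n x0) \<in> face_poset" using face_posetI[of x i n] top[OF x0, of x] by auto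
  qed
  then show ?thesis using partial_order_face_poset
    by (auto simp: is_greatest_face_def order_on_defs dest: antisymD)
qed

text \<open>All other conditions on a polytope hold in any flag system.\<close>
theorem polytope_face_poset_iff:
  "polytope n face_poset \<longleftrightarrow> strongly_flag_connected face_poset \<and>
    (\<forall>j \<in> {0..n-1}. \<forall>x \<in> X.
      card {fc j y | y. y \<in> X \<and> fc (j-1) y = fc (j-1) x \<and> fc (j+1) y = fc (j+1) x} = 2)"
proof -
  have ranked: "ranked n face_poset" unfolding ranked_def
  proof (intro conjI ballI allI impI)
    fix F assume "F \<in> Field face_poset"
    then show "face_rank face_poset F \<in> {-1..n}"
      using face_rank_fc by (auto elim: Field_face_posetE)
  next
    fix F G assume FG: "(F, G) \<in> face_poset \<and> F \<noteq> G"
    obtain i x where "F = fc i x" "i \<in> {-1..n}" "x \<in> X"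
      using FG by (meson FieldI1 Field_face_posetE)
    moreover obtain j y where "G = fc j y" "j \<in> {-1..n}" "y \<in> X"
      using FG by (meson FieldI2 Field_face_posetE)
    ultimately show "face_rank face_poset F < face_rank face_poset G"
      using strict_graded[of i x j y] FG face_rank_fc by auto
  qed
  have card: "finite A \<and> int (card A) = n + 2" if "A \<in> flags face_poset" for A
    using that rank_ge unfolding flags_face_poset
    by (auto simp: flag_of_def card_image[OF inj_on_fc])
  have "(\<forall>j. \<forall>F \<in> faces face_poset (j - 1). \<forall>G \<in> faces face_poset (j + 1). (F, G) \<in> face_poset \<longrightarrow>
        card {H \<in> faces face_poset j. (F, H) \<in> face_poset \<and> (H, G) \<in> face_poset} = 2) \<longleftrightarrow>
    (\<forall>j \<in> {0..n-1}. \<forall>x \<in> X.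
      card {fc j y | y. y \<in> X \<and> fc (j-1) y = fc (j-1) x \<and> fc (j+1) y = fc (j+1) x} = 2)"
    (is "?A \<longleftrightarrow> ?B")
  proof
    assume A: ?A
    show ?B
    proof (intro ballI)
      fix j x assume jx: "j \<in> {0..n-1}" "x \<in> X"
      have "fc (j-1) x \<in> faces face_poset (j-1)" "fc (j+1) x \<in> faces face_poset (j+1)"
        using jx faces_face_poset[of "j-1"] faces_face_poset[of "j+1"] by auto
      moreover have "(fc (j-1) x, fc (j+1) x) \<in> face_poset" using face_posetI jx by auto
      ultimately show "card {fc j y | y. y \<in> X \<and> fc (j-1) y = fc (j-1) x \<and> fc (j+1) y = fc (j+1) x} = 2"
        using A between_eq[OF jx(2,1)] by fastforce
    qed
  next
    assume B: ?B
    show ?A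
    proof (intro allI ballI impI)
      fix j F G assume F: "F \<in> faces face_poset (j - 1)" and G: "G \<in> faces face_poset (j + 1)"
        and FG: "(F, G) \<in> face_poset"
      obtain x where x: "x \<in> X" "F = fc (j-1) x" "j - 1 \<in> {-1..n}"
        using F faces_face_poset[of "j-1"] by (auto split: if_splits)
      obtain y where y: "y \<in> X" "G = fc (j+1) y" "j + 1 \<in> {-1..n}"
        using G faces_face_poset[of "j+1"] by (auto split: if_splits)
      obtain z where z: "z \<in> X" "F = fc (j-1) z" "G = fc (j+1) z"
        using face_poset_iff[of x y "j-1" "j+1"] FG x y by auto
      have "j \<in> {0..n-1}" using x(3) y(3) by auto
      then show "card {H \<in> faces face_poset j. (F, H) \<in> face_poset \<and> (H, G) \<in> face_poset} = 2"
        using B between_eq[OF z(1), of j] z by auto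
    qed
  qed
  then show ?thesis unfolding polytope_def
    using partial_order_face_poset ranked card least_face_poset greatest_face_poset by blast
qed

lemma adjacent_flag_of:
  assumes "x \<in> X" "y \<in> X" "i \<in> {0..n-1}" "\<And>j. j \<in> {-1..n} \<Longrightarrow> j \<noteq> i \<Longrightarrow> fc j y = fc j x"
    "fc i y \<noteq> fc i x"
  shows "adjacent (flag_of x) (flag_of y)"
proof -
  have "flag_of x - flag_of y = {fc i x}"
  proof -
    have "fc j x \<in> flag_of y \<longleftrightarrow> j \<noteq> i" if "j \<in> {-1..n}" for j
      using in_flag_of_iff[of y x j] assms that by (cases "j = i") auto
    then show ?thesis using assms(3) unfolding flag_of_def[of x] by auto
  qed
  moreover have "flag_of y - flag_of x = {fc i y}"
  proof -
    have "fc j y \<in> flag_of x \<longleftrightarrow> j \<noteq> i" if "j \<in> {-1..n}" for j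
      using in_flag_of_iff[of x y j] assms that by (cases "j = i") auto
    then show ?thesis using assms(3) unfolding flag_of_def[of y] by auto
  qed
  ultimately show ?thesis unfolding adjacent_def by blast
qed

end

text \<open>The bridge from the presentation of a mix by its proper faces to its presentation by flags.\<close>
lemma bounded_poset_eq_face_poset:
  fixes fc :: "int \<Rightarrow> 'x \<Rightarrow> 'g mix_face"
  assumes "flag_system X fc n" and n: "0 \<le> n"
    and ends: "\<And>x. fc (-1) x = Bottom" "\<And>x. fc n x = Top"
  shows "bounded_poset {fc i x | i x. i \<in> {0..n-1} \<and> x \<in> X}
      {(fc i x, fc j x) | i j x. 0 \<le> i \<and> i < j \<and> j \<le> n - 1 \<and> x \<in> X} = flag_system.face_poset X fc n"
    (is "bounded_poset ?X ?R = _")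
proof -
  interpret flag_system X fc n by fact
  obtain x0 where x0: "x0 \<in> X" using nonempty by auto
  let ?Y = "insert Bottom (insert Top ?X)"
  have Y: "F \<in> ?Y \<longleftrightarrow> (\<exists>i x. F = fc i x \<and> i \<in> {-1..n} \<and> x \<in> X)" for F
  proof
    assume "F \<in> ?Y"
    then consider "F = Bottom" | "F = Top" | "F \<in> ?X" by blast
    then show "\<exists>i x. F = fc i x \<and> i \<in> {-1..n} \<and> x \<in> X"
    proof cases
      case 1 then show ?thesis using ends(1) x0 n by (intro exI[of _ "-1"] exI[of _ x0]) auto
    next
      case 2 then show ?thesis using ends(2) x0 n by (intro exI[of _ n] exI[of _ x0]) auto
    qed fastforce
  next
    assume "\<exists>i x. F = fc i x \<and> i \<in> {-1..n} \<and> x \<in> X"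
    then obtain i x where F: "F = fc i x" "i \<in> {-1..n}" "x \<in> X" by blast
    then have "i = -1 \<or> i = n \<or> i \<in> {0..n-1}" by auto
    then show "F \<in> ?Y" using F ends by blast
  qed
  show ?thesis
  proof
    show "bounded_poset ?X ?R \<subseteq> face_poset"
    proof
      fix p assume "p \<in> bounded_poset ?X ?R"
      then consider F where "F \<in> ?Y" "p = (F, F) \<or> p = (Bottom, F) \<or> p = (F, Top)" | "p \<in> ?R"
        unfolding bounded_poset_def Let_def by blast
      then show "p \<in> face_poset"
      proof cases
        case 1
        then obtain i x where "F = fc i x" "i \<in> {-1..n}" "x \<in> X" using Y by blast
        then show ?thesis using 1(2) ends face_posetI[of x i i] face_posetI[of x "-1" i] face_posetI[of x i n]
          by auto
      next
        case 2
        then obtain i j x where "p = (fc i x, fc j x)" "0 \<le> i" "i < j" "j \<le> n - 1" "x \<in> X" by blast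
        then show ?thesis using face_posetI[of x i j] by auto
      qed
    qed
    show "face_poset \<subseteq> bounded_poset ?X ?R"
    proof
      fix p assume "p \<in> face_poset"
      then obtain i j x where p: "p = (fc i x, fc j x)" "x \<in> X" "-1 \<le> i" "i \<le> j" "j \<le> n"
        unfolding face_poset_def by auto
      have "fc i x \<in> ?Y" "fc j x \<in> ?Y" unfolding Y using p by force+
      moreover have "i = j \<or> i = -1 \<or> j = n \<or> 0 \<le> i \<and> i < j \<and> j \<le> n - 1" using p by auto
      ultimately show "p \<in> bounded_poset ?X ?R"
        unfolding bounded_poset_def Let_def using p ends by blast
    qed
  qed
qed

section \<open>Segments and polygons\<close>

lemma polytope_segment: "polytope 1 (bounded_poset {Vertex 0, Vertex 1} {} :: 'g mix_face rel)"
proof -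
  define fc :: "int \<Rightarrow> int \<Rightarrow> 'g mix_face" where
    "fc i t = (if i = -1 then Bottom else if i = 0 then Vertex t else Top)" for i t
  interpret flag_system "{0, 1}" fc 1
  proof
    fix m x y assume "m \<in> {0..1 - 1::int}" "x \<in> {0, 1}" "y \<in> {0, 1}" "fc m x = fc m y"
    then show "\<exists>z \<in> {0, 1}. (\<forall>j \<in> {-1..m}. fc j z = fc j x) \<and> (\<forall>j \<in> {m..1}. fc j z = fc j y)"
      by (auto simp: fc_def)
  qed (auto simp: fc_def split: if_splits)
  have "{fc i x | i x. i \<in> {0..1 - 1} \<and> x \<in> {0, 1}} = {Vertex 0, Vertex 1}" by (auto simp: fc_def)
  moreover have "{(fc i x, fc j x) | i j x. 0 \<le> i \<and> i < j \<and> j \<le> 1 - 1 \<and> x \<in> {0, 1}} = {}" by auto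
  moreover have "bounded_poset {fc i x | i x. i \<in> {0..1 - 1} \<and> x \<in> {0, 1}}
      {(fc i x, fc j x) | i j x. 0 \<le> i \<and> i < j \<and> j \<le> 1 - 1 \<and> x \<in> {0, 1}} = face_poset"
    by (rule bounded_poset_eq_face_poset[OF flag_system_axioms]) (simp_all add: fc_def)
  ultimately have eq: "bounded_poset {Vertex 0, Vertex 1} {} = face_poset" by (simp only:)
  have adj: "adjacent (flag_of x) (flag_of y)" if "x \<in> {0,1}" "y \<in> {0,1}" "x \<noteq> y" for x y
    using that by (intro adjacent_flag_of[where i = 0]) (auto simp: fc_def)
  have "strongly_flag_connected face_poset" unfolding strongly_flag_connected_def flags_face_poset
  proof (intro ballI)
    fix A B assume "A \<in> flag_of ` {0, 1}" "B \<in> flag_of ` {0, 1}"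
    then obtain x y where xy: "x \<in> {0,1}" "A = flag_of x" "y \<in> {0,1}" "B = flag_of y" by blast
    show "(A, B) \<in> {(X, Y). X \<in> flag_of ` {0, 1} \<and> Y \<in> flag_of ` {0, 1} \<and> adjacent X Y \<and>
        A \<inter> B \<subseteq> X \<and> A \<inter> B \<subseteq> Y}\<^sup>*"
    proof (cases "x = y")
      case False
      then show ?thesis using adj[of x y] xy by (intro r_into_rtrancl) blast
    qed (use xy in simp)
  qed
  moreover have "{fc 0 y | y. y \<in> {0, 1}} = {Vertex 0, Vertex 1}" by (auto simp: fc_def)
  then have "card {fc j y | y. y \<in> {0,1} \<and> fc (j-1) y = fc (j-1) x \<and> fc (j+1) y = fc (j+1) x} = 2"
    if "j \<in> {0..1 - 1}" "x \<in> {0,1}" for j x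
    using that by (simp add: fc_def cong: conj_cong)
  ultimately show ?thesis unfolding eq polytope_face_poset_iff by blast
qed

text \<open>The flags of a polygon, in cyclic order, are indexed by the integers \<open>t\<close>: passing from \<open>t\<close> to
  \<open>t + 1\<close> changes the vertex if \<open>t\<close> is even and the edge if \<open>t\<close> is odd.\<close>

lemma polytope_polygon:
  assumes p: "p \<noteq> 1"
  shows "polytope 2 (polygon p :: 'g mix_face rel)"
proof -
  define fc :: "int \<Rightarrow> int \<Rightarrow> 'g mix_face" where
    "fc i t = (if i = -1 then Bottom else if i = 0 then Vertex (((t + 1) div 2) mod int p)
      else if i = 1 then Edge ((t div 2) mod int p) else Top)" for i t
  have fc: "fc (-1) t = Bottom" "fc 0 t = Vertex (((t + 1) div 2) mod int p)"
    "fc 1 t = Edge ((t div 2) mod int p)" "fc 2 t = Top" for t by (auto simp: fc_def)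
  interpret flag_system UNIV fc 2
  proof
    fix m x y assume m: "m \<in> {0..2 - 1::int}" and eq: "fc m x = fc m y"
    show "\<exists>z \<in> UNIV. (\<forall>j \<in> {-1..m}. fc j z = fc j x) \<and> (\<forall>j \<in> {m..2}. fc j z = fc j y)"
    proof (cases "m = 0")
      case True
      then have "\<forall>j \<in> {-1..m}. fc j y = fc j x"
        using eq by (auto simp: fc_def)
      then show ?thesis by blast
    next
      case False
      then have "\<forall>j \<in> {m..2}. fc j x = fc j y" using eq m by (auto simp: fc_def)
      then show ?thesis by blast
    qed
  qed (auto simp: fc_def split: if_splits)
  have succ: "(k + 1) mod int p \<noteq> k mod int p" for k
  proof
    assume "(k + 1) mod int p = k mod int p"
    then have "int p dvd (k + 1) - k" by (simp only: mod_eq_dvd_iff)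
    then show False using p by simp
  qed
  have half: "(2 * k + 1) div 2 = k" "(2 * k + 1 + 1) div 2 = k + 1" for k :: int by presburger+
  have fc_double: "fc 0 (2 * k) = Vertex (k mod int p)" "fc 1 (2 * k) = Edge (k mod int p)"
    "fc 0 (2 * k + 1) = Vertex ((k + 1) mod int p)" "fc 1 (2 * k + 1) = Edge (k mod int p)" for k
    unfolding fc half by simp_all
  have "range (\<lambda>k. Vertex (k mod int p)) \<union> range (\<lambda>k. Edge (k mod int p)) =
      {fc i t | i t. i \<in> {0..2 - 1} \<and> t \<in> UNIV}" (is "?V \<union> ?E = ?X")
  proof
    have "fc 0 (2 * k) \<in> ?X" "fc 1 (2 * k) \<in> ?X" for k by force+
    then show "?V \<union> ?E \<subseteq> ?X" unfolding fc_double by blast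
    have "fc 0 t \<in> ?V \<union> ?E" "fc 1 t \<in> ?V \<union> ?E" for t unfolding fc by blast+
    moreover have "i = 0 \<or> i = 1" if "i \<in> {0..2 - 1}" for i :: int using that by auto
    ultimately show "?X \<subseteq> ?V \<union> ?E" by blast
  qed
  moreover have "range (\<lambda>k. (Vertex (k mod int p), Edge (k mod int p))) \<union>
        range (\<lambda>k. (Vertex ((k + 1) mod int p), Edge (k mod int p))) =
      {(fc i t, fc j t) | i j t. 0 \<le> i \<and> i < j \<and> j \<le> 2 - 1 \<and> t \<in> UNIV}" (is "?A \<union> ?B = ?R")
  proof
    have R: "(fc 0 t, fc 1 t) \<in> ?R" for t by force
    have "(Vertex (k mod int p), Edge (k mod int p)) \<in> ?R"
      "(Vertex ((k + 1) mod int p), Edge (k mod int p)) \<in> ?R" for k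
      using R[of "2 * k"] R[of "2 * k + 1"] unfolding fc_double by blast+
    then show "?A \<union> ?B \<subseteq> ?R" by blast
    have "(fc 0 t, fc 1 t) \<in> ?A \<union> ?B" for t
    proof -
      obtain k where "t = 2 * k \<or> t = 2 * k + 1" by (metis oddE evenE)
      then show ?thesis using fc_double[of k] by (elim disjE) (simp only:, blast)+
    qed
    moreover have "i = 0 \<and> j = 1" if "0 \<le> i" "i < j" "j \<le> 2 - 1" for i j :: int using that by auto
    ultimately show "?R \<subseteq> ?A \<union> ?B" by blast
  qed
  ultimately have eq: "polygon p = face_poset"
    using bounded_poset_eq_face_poset[OF flag_system_axioms] unfolding polygon_def by (simp add: fc)
  have index: "j = -1 \<or> j = 0 \<or> j = 1 \<or> j = 2" if "j \<in> {-1..2}" for j :: int using that by auto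
  have step: "adjacent (flag_of t) (flag_of (t + 1)) \<and> adjacent (flag_of (t + 1)) (flag_of t)" for t
  proof -
    have "fc 0 (t + 1) \<noteq> fc 0 t \<and> fc 1 (t + 1) = fc 1 t \<or> fc 0 (t + 1) = fc 0 t \<and> fc 1 (t + 1) \<noteq> fc 1 t"
    proof (cases "even t")
      case True
      then have "(t + 1 + 1) div 2 = t div 2 + 1" "(t + 1) div 2 = t div 2" by presburger+
      then show ?thesis using succ[of "t div 2"] by (simp add: fc)
    next
      case False
      then have "(t + 1 + 1) div 2 = (t + 1) div 2" "(t + 1) div 2 = t div 2 + 1" by presburger+
      then show ?thesis using succ[of "t div 2"] by (simp add: fc)
    qed
    then show ?thesis
    proof
      assume *: "fc 0 (t + 1) \<noteq> fc 0 t \<and> fc 1 (t + 1) = fc 1 t"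
      then have "fc j (t + 1) = fc j t" if "j \<in> {-1..2}" "j \<noteq> 0" for j
        using index[OF that(1)] that(2) fc(1,4) by auto
      then show ?thesis using * adjacent_flag_of[of t "t+1" 0] adjacent_flag_of[of "t+1" t 0]
        by auto
    next
      assume *: "fc 0 (t + 1) = fc 0 t \<and> fc 1 (t + 1) \<noteq> fc 1 t"
      then have "fc j (t + 1) = fc j t" if "j \<in> {-1..2}" "j \<noteq> 1" for j
        using index[OF that(1)] that(2) fc(1,4) by auto
      then show ?thesis using * adjacent_flag_of[of t "t+1" 1] adjacent_flag_of[of "t+1" t 1]
        by auto
    qed
  qed
  have "strongly_flag_connected face_poset" unfolding strongly_flag_connected_def flags_face_poset
  proof (intro ballI)
    fix A B assume "A \<in> range flag_of" "B \<in> range flag_of"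
    then obtain s t where st: "A = flag_of s" "B = flag_of t" by auto
    let ?R = "{(X, Y). X \<in> range flag_of \<and> Y \<in> range flag_of \<and> adjacent X Y \<and>
        A \<inter> B \<subseteq> X \<and> A \<inter> B \<subseteq> Y}"
    have ends: "fc j s = fc j t" if "j \<in> {-1..2}" "j \<notin> {0, 1}" for j
      using index[OF that(1)] that(2) fc(1,4) by auto
    consider "fc 0 s = fc 0 t" "fc 1 s = fc 1 t" | "fc 0 s = fc 0 t" "fc 1 s \<noteq> fc 1 t"
      | "fc 0 s \<noteq> fc 0 t" "fc 1 s = fc 1 t" | "fc 0 s \<noteq> fc 0 t" "fc 1 s \<noteq> fc 1 t" by blast
    then show "(A, B) \<in> ?R\<^sup>*"
    proof cases
      case 1
      then have "flag_of s = flag_of t"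
        using ends by (intro flag_of_eqI) (metis insert_iff singletonD)
      then show ?thesis using st by simp
    next
      case 2
      then have "adjacent (flag_of s) (flag_of t)" using ends
        by (intro adjacent_flag_of[where i = 1]) (simp_all, metis insert_iff singletonD atLeastAtMost_iff)
      then show ?thesis using st by (intro r_into_rtrancl) auto
    next
      case 3
      then have "adjacent (flag_of s) (flag_of t)" using ends
        by (intro adjacent_flag_of[where i = 0]) (simp_all, metis insert_iff singletonD atLeastAtMost_iff)
      then show ?thesis using st by (intro r_into_rtrancl) auto
    next
      case 4
      have common: "A \<inter> B \<subseteq> flag_of u" for u
      proof
        fix F assume F: "F \<in> A \<inter> B"
        then obtain j where j: "j \<in> {-1..2}" "F = fc j s" unfolding st flag_of_def by auto
        then have "fc j s = fc j t" using F in_flag_of_iff[of t s j] unfolding st by auto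
        then have "F = fc j u" using 4 index[OF j(1)] j(2) fc(1,4) by auto
        then show "F \<in> flag_of u" using j(1) by (auto simp: flag_of_def)
      qed
      have walk: "(flag_of u, flag_of (u + int k)) \<in> ?R\<^sup>* \<and> (flag_of (u + int k), flag_of u) \<in> ?R\<^sup>*" for u k
      proof (induction k)
        case (Suc k)
        have eq: "u + int (Suc k) = u + int k + 1" by simp
        have "(flag_of (u + int k), flag_of (u + int (Suc k))) \<in> ?R"
          "(flag_of (u + int (Suc k)), flag_of (u + int k)) \<in> ?R"
          unfolding eq using step[of "u + int k"] common by blast+
        then show ?case using Suc
          by (meson rtrancl.rtrancl_into_rtrancl converse_rtrancl_into_rtrancl)
      qed simp
      show ?thesis
      proof (cases "s \<le> t")
        case True
        then show ?thesis using walk[of s "nat (t - s)"] st by simp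
      next
        case False
        then show ?thesis using walk[of t "nat (s - t)"] st by simp
      qed
    qed
  qed
  moreover have "card {fc j y | y. y \<in> UNIV \<and> fc (j-1) y = fc (j-1) x \<and> fc (j+1) y = fc (j+1) x} = 2"
    if "j \<in> {0..2 - 1}" for j x
  proof -
    have "j = 0 \<or> j = 1" using that by auto
    then show ?thesis
    proof
      assume j: "j = 0"
      let ?k = "x div 2"
      have "{fc 0 y | y. fc 1 y = fc 1 x} = {Vertex (?k mod int p), Vertex ((?k + 1) mod int p)}"
      proof
        show "{fc 0 y | y. fc 1 y = fc 1 x} \<subseteq> {Vertex (?k mod int p), Vertex ((?k + 1) mod int p)}"
        proof
          fix F assume "F \<in> {fc 0 y | y. fc 1 y = fc 1 x}"
          then obtain y where y: "F = fc 0 y" "(y div 2) mod int p = ?k mod int p"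
            by (auto simp: fc)
          have "(y + 1) div 2 = y div 2 \<or> (y + 1) div 2 = y div 2 + 1" by presburger
          moreover have "(y div 2 + 1) mod int p = (?k + 1) mod int p" using y(2)
            by (rule mod_add_cong) simp
          ultimately show "F \<in> {Vertex (?k mod int p), Vertex ((?k + 1) mod int p)}"
            using y by (auto simp: fc)
        qed
        have "(2 * ?k + 1) div 2 = ?k" "(2 * ?k + 1 + 1) div 2 = ?k + 1" by presburger+
        then have "Vertex (?k mod int p) = fc 0 (2 * ?k)" "fc 1 (2 * ?k) = fc 1 x"
          "Vertex ((?k + 1) mod int p) = fc 0 (2 * ?k + 1)" "fc 1 (2 * ?k + 1) = fc 1 x"
          unfolding fc by (simp_all add: add.commute)
        then show "{Vertex (?k mod int p), Vertex ((?k + 1) mod int p)} \<subseteq> {fc 0 y | y. fc 1 y = fc 1 x}"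
          by blast
      qed
      then show ?thesis using succ[of ?k] by (simp add: j fc(1))
    next
      assume j: "j = 1"
      let ?k = "(x + 1) div 2"
      have "{fc 1 y | y. fc 0 y = fc 0 x} = {Edge (?k mod int p), Edge ((?k - 1) mod int p)}"
      proof
        show "{fc 1 y | y. fc 0 y = fc 0 x} \<subseteq> {Edge (?k mod int p), Edge ((?k - 1) mod int p)}"
        proof
          fix F assume "F \<in> {fc 1 y | y. fc 0 y = fc 0 x}"
          then obtain y where y: "F = fc 1 y" "((y + 1) div 2) mod int p = ?k mod int p"
            by (auto simp: fc)
          have "y div 2 = (y + 1) div 2 \<or> y div 2 = (y + 1) div 2 - 1" by presburger
          moreover have "((y + 1) div 2 - 1) mod int p = (?k - 1) mod int p" using y(2)
            by (rule mod_diff_cong) simp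
          ultimately show "F \<in> {Edge (?k mod int p), Edge ((?k - 1) mod int p)}"
            using y by (auto simp: fc)
        qed
        have "(2 * ?k + 1) div 2 = ?k" "(2 * ?k - 1) div 2 = ?k - 1" "(2 * ?k - 1 + 1) div 2 = ?k"
          by presburger+
        then have "Edge (?k mod int p) = fc 1 (2 * ?k)" "fc 0 (2 * ?k) = fc 0 x"
          "Edge ((?k - 1) mod int p) = fc 1 (2 * ?k - 1)" "fc 0 (2 * ?k - 1) = fc 0 x"
          unfolding fc by (simp_all add: add.commute)
        then show "{Edge (?k mod int p), Edge ((?k - 1) mod int p)} \<subseteq> {fc 1 y | y. fc 0 y = fc 0 x}"
          by blast
      qed
      then show ?thesis using succ[of "?k - 1"] by (simp add: j fc(4) eq_commute)
    qed
  qed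
  ultimately show ?thesis unfolding eq polytope_face_poset_iff by blast
qed

section \<open>Groups generated by involutions\<close>

text \<open>Elements of the groups below are handled as products over words of indices. This makes it easy to
  speak of parity, and to compare groups with different carriers through the relations between words.\<close>
definition word :: "('g, 'r) monoid_scheme \<Rightarrow> (int \<Rightarrow> 'g) \<Rightarrow> int list \<Rightarrow> 'g" where
  "word G r w = foldr (\<lambda>k x. r k \<otimes>\<^bsub>G\<^esub> x) w \<one>\<^bsub>G\<^esub>"

lemma word_Nil [simp]: "word G r [] = \<one>\<^bsub>G\<^esub>"
  and word_Cons [simp]: "word G r (i # w) = r i \<otimes>\<^bsub>G\<^esub> word G r w"
  by (simp_all add: word_def)

locale involution_system = group G for G (structure) +
  fixes r :: "int \<Rightarrow> 'a" and n :: int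
  assumes closed: "i \<in> {0..n-1} \<Longrightarrow> r i \<in> carrier G"
    and invol: "i \<in> {0..n-1} \<Longrightarrow> r i \<otimes> r i = \<one>"
begin

abbreviation "N \<equiv> {0..n-1}"
abbreviation "wd \<equiv> word G r"

definition span :: "int set \<Rightarrow> 'a set" where
  "span I = {wd w | w. set w \<subseteq> I}"

definition even_span :: "int set \<Rightarrow> 'a set" where
  "even_span I = {wd w | w. set w \<subseteq> I \<and> even (length w)}"

lemma word_closed: "set w \<subseteq> N \<Longrightarrow> wd w \<in> carrier G"
  by (induction w) (auto simp: closed)

lemma generator_carrier: "I \<subseteq> N \<Longrightarrow> i \<in> I \<Longrightarrow> r i \<in> carrier G"
  using closed by blast

lemma word_carrier: "I \<subseteq> N \<Longrightarrow> set w \<subseteq> I \<Longrightarrow> wd w \<in> carrier G"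
  using word_closed by blast

lemma word_append: "set u \<subseteq> N \<Longrightarrow> set v \<subseteq> N \<Longrightarrow> wd (u @ v) = wd u \<otimes> wd v"
  by (induction u) (auto simp: m_assoc closed word_closed)

lemma word_rev: "set w \<subseteq> N \<Longrightarrow> wd (rev w) \<otimes> wd w = \<one>"
proof (induction w)
  case (Cons i w)
  then have "wd (rev (i # w)) \<otimes> wd (i # w) = wd (rev w) \<otimes> (r i \<otimes> r i) \<otimes> wd w"
    by (simp add: word_append closed word_closed m_assoc)
  then show ?case using Cons by (simp add: closed word_closed invol)
qed simp

lemma inv_word: "set w \<subseteq> N \<Longrightarrow> inv (wd w) = wd (rev w)"
  using word_rev by (simp add: inv_equality word_closed)

lemma subgroup_span: "I \<subseteq> N \<Longrightarrow> subgroup (span I) G"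
proof (rule subgroupI)
  assume I: "I \<subseteq> N"
  show "span I \<subseteq> carrier G" using I word_closed by (auto simp: span_def)
  show "span I \<noteq> {}" by (auto simp: span_def intro: exI[of _ "[]"])
  show "inv a \<in> span I" if a: "a \<in> span I" for a
  proof -
    obtain w where "a = wd w" "set w \<subseteq> I" using a by (auto simp: span_def)
    then show ?thesis using I inv_word[of w] unfolding span_def
      by (intro CollectI exI[of _ "rev w"]) auto
  qed
  show "a \<otimes> b \<in> span I" if ab: "a \<in> span I" "b \<in> span I" for a b
  proof -
    obtain u v where "a = wd u" "b = wd v" "set u \<subseteq> I" "set v \<subseteq> I" using ab by (auto simp: span_def)
    then show ?thesis using I word_append[of u v] unfolding span_def
      by (intro CollectI exI[of _ "u @ v"]) auto
  qed
qed

lemma subgroup_even_span: "I \<subseteq> N \<Longrightarrow> subgroup (even_span I) G"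
proof (rule subgroupI)
  assume I: "I \<subseteq> N"
  show "even_span I \<subseteq> carrier G" using I word_closed by (auto simp: even_span_def)
  show "even_span I \<noteq> {}" by (auto simp: even_span_def intro: exI[of _ "[]"])
  show "inv a \<in> even_span I" if a: "a \<in> even_span I" for a
  proof -
    obtain w where "a = wd w" "set w \<subseteq> I" "even (length w)" using a by (auto simp: even_span_def)
    then show ?thesis using I inv_word[of w] unfolding even_span_def
      by (intro CollectI exI[of _ "rev w"]) auto
  qed
  show "a \<otimes> b \<in> even_span I" if ab: "a \<in> even_span I" "b \<in> even_span I" for a b
  proof -
    obtain u v where "a = wd u" "b = wd v" "set u \<subseteq> I" "set v \<subseteq> I" "even (length u)" "even (length v)"
      using ab by (auto simp: even_span_def)
    then show ?thesis using I word_append[of u v] unfolding even_span_def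
      by (intro CollectI exI[of _ "u @ v"]) auto
  qed
qed

lemma span_mono: "I \<subseteq> J \<Longrightarrow> span I \<subseteq> span J"
  by (auto simp: span_def)

lemma span_weaken: "a \<in> span I \<Longrightarrow> I \<subseteq> J \<Longrightarrow> a \<in> span J"
  using span_mono by blast

lemma span_carrier: "I \<subseteq> N \<Longrightarrow> a \<in> span I \<Longrightarrow> a \<in> carrier G"
  by (rule subgroup.mem_carrier[OF subgroup_span])

lemma span_mult: "I \<subseteq> N \<Longrightarrow> a \<in> span I \<Longrightarrow> b \<in> span I \<Longrightarrow> a \<otimes> b \<in> span I"
  by (rule subgroup.m_closed[OF subgroup_span])

lemma span_inv: "I \<subseteq> N \<Longrightarrow> a \<in> span I \<Longrightarrow> inv a \<in> span I"
  by (rule subgroup.m_inv_closed[OF subgroup_span])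

lemma span_gen: "i \<in> I \<Longrightarrow> I \<subseteq> N \<Longrightarrow> r i \<in> span I"
  unfolding span_def using closed by (intro CollectI exI[of _ "[i]"]) auto

lemma one_span: "\<one> \<in> span I"
  unfolding span_def by (intro CollectI exI[of _ "[]"]) auto

lemma span_wordI: "set w \<subseteq> I \<Longrightarrow> wd w \<in> span I"
  by (auto simp: span_def)

lemma even_span_sub_span: "even_span I \<subseteq> span I"
  by (auto simp: even_span_def span_def)

text \<open>An even word is a product of pairs \<open>r k \<otimes> r l\<close>; a pair with \<open>k > l\<close> is the inverse of one with \<open>k < l\<close>.\<close>
lemma generate_pairs_eq_even_span:
  assumes I: "I \<subseteq> N"
  shows "generate G {r k \<otimes> r l | k l. k \<in> I \<and> l \<in> I \<and> k < l} = even_span I" (is "generate G ?S = _")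
proof
  have S: "?S \<subseteq> even_span I"
  proof
    fix g assume "g \<in> ?S"
    then obtain k l where "g = r k \<otimes> r l" "k \<in> I" "l \<in> I" by auto
    then show "g \<in> even_span I" unfolding even_span_def using generator_carrier[OF I]
      by (intro CollectI exI[of _ "[k, l]"]) auto
  qed
  then show "generate G ?S \<subseteq> even_span I"
    by (rule generate_subgroup_incl[OF _ subgroup_even_span[OF I]])
  have Sc: "?S \<subseteq> carrier G" using generator_carrier[OF I] by auto
  have sub: "subgroup (generate G ?S) G" using generate_is_subgroup[OF Sc] .
  have pair: "r k \<otimes> r l \<in> generate G ?S" if "k \<in> I" "l \<in> I" for k l
  proof -
    consider "k < l" | "k = l" | "l < k" by linarith
    then show ?thesis
    proof cases
      case 1 then show ?thesis using that by (intro generate.incl) auto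
    next
      case 2
      then have "r k \<otimes> r l = \<one>" using that I invol[of k] by auto
      then show ?thesis using generate.one by simp
    next
      case 3
      then have "r l \<otimes> r k \<in> generate G ?S" using that by (intro generate.incl) auto
      moreover have "inv (r l \<otimes> r k) = r k \<otimes> r l"
        using inv_word[of "[l, k]"] that I generator_carrier[OF I] by (auto simp: subset_iff)
      ultimately show ?thesis using subgroup.m_inv_closed[OF sub, of "r l \<otimes> r k"] by simp
    qed
  qed
  have "wd w \<in> generate G ?S" if "set w \<subseteq> I" "even (length w)" for w
    using that
  proof (induction w rule: induct_list012)
    case 1 then show ?case using generate.one by simp
  next
    case (3 k l w)
    then have "(r k \<otimes> r l) \<otimes> wd w \<in> generate G ?S"
      using generate.eng[OF pair[of k l]] by simp
    then show ?case using 3 generator_carrier[OF I] word_carrier[OF I] by (auto simp: m_assoc)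
  qed simp
  then show "even_span I \<subseteq> generate G ?S" by (auto simp: even_span_def)
qed

abbreviation "rot \<equiv> \<lambda>i. r (i - 1) \<otimes> r i"

text \<open>The product telescopes, since each \<open>r k\<close> in its interior occurs twice in succession.\<close>
lemma range_prod_rot:
  assumes "1 \<le> i" "i \<le> j" "j \<le> n - 1"
  shows "range_prod G rot i j = r (i - 1) \<otimes> r j"
  using assms(2,1)
proof (induction i rule: int_le_induct)
  case base
  then show ?case using closed[of "j-1"] closed[of j] assms by (simp add: range_prod_def)
next
  case (step i)
  have "[i - 1..j] = (i - 1) # [i..j]" using step by (simp add: upto_rec1)
  then have "range_prod G rot (i - 1) j = rot (i - 1) \<otimes> range_prod G rot i j"
    by (simp add: range_prod_def)
  also have "\<dots> = (r (i - 2) \<otimes> r (i - 1)) \<otimes> (r (i - 1) \<otimes> r j)"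
    using step by (simp add: algebra_simps)
  also have "\<dots> = r (i - 2) \<otimes> (r (i - 1) \<otimes> r (i - 1)) \<otimes> r j"
    using closed[of "i-1"] closed[of "i-2"] closed[of j] step assms by (simp add: m_assoc)
  also have "\<dots> = r (i - 2) \<otimes> r j"
    using invol[of "i-1"] closed[of "i-2"] step assms by simp
  finally show ?case by (simp add: algebra_simps)
qed

lemma range_prods_eq:
  assumes I: "I \<subseteq> N"
  shows "{range_prod G rot i j | i j. 1 \<le> i \<and> i \<le> j \<and> j \<le> n - 1 \<and> i - 1 \<in> I \<and> j \<in> I} =
    {r k \<otimes> r l | k l. k \<in> I \<and> l \<in> I \<and> k < l}" (is "?L = ?R")
proof
  show "?L \<subseteq> ?R" using range_prod_rot by force
  show "?R \<subseteq> ?L"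
  proof
    fix g assume "g \<in> ?R"
    then obtain k l where kl: "g = r k \<otimes> r l" "k \<in> I" "l \<in> I" "k < l" by auto
    moreover have "k \<in> N" "l \<in> N" using kl I by auto
    ultimately have "g = range_prod G rot (k + 1) l" using range_prod_rot[of "k+1" l] by auto
    then show "g \<in> ?L" using kl I by (intro CollectI exI[of _ "k+1"] exI[of _ l]) auto
  qed
qed

lemma gen_subgroup_eq_even_span: "I \<subseteq> N \<Longrightarrow> gen_subgroup n G rot I = even_span I"
  unfolding gen_subgroup_def using range_prods_eq generate_pairs_eq_even_span by simp

lemma generate_rot: "generate G (rot ` {1..n-1}) = even_span N"
proof
  have "rot ` {1..n-1} \<subseteq> even_span N"
  proof
    fix g assume "g \<in> rot ` {1..n-1}"
    then obtain i where "i \<in> {1..n-1}" "g = rot i" by auto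
    then show "g \<in> even_span N" unfolding even_span_def using closed
      by (intro CollectI exI[of _ "[i - 1, i]"]) auto
  qed
  then show "generate G (rot ` {1..n-1}) \<subseteq> even_span N"
    by (rule generate_subgroup_incl[OF _ subgroup_even_span]) simp
  have rc: "rot ` {1..n-1} \<subseteq> carrier G" using closed by auto
  have "range_prod G rot i j \<in> generate G (rot ` {1..n-1})" if "1 \<le> i" "j \<le> n - 1" for i j
  proof (cases "i \<le> j")
    case True
    then show ?thesis using that(1)
    proof (induction i rule: int_le_induct)
      case base
      have "range_prod G rot j j = rot j" using closed[of "j-1"] closed[of j] that base
        by (simp add: range_prod_def)
      then show ?case using base that generate.incl[of "rot j" "rot ` {1..n-1}" G] by auto
    next
      case (step i)
      have "[i - 1..j] = (i - 1) # [i..j]" using step by (simp add: upto_rec1)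
      then have "range_prod G rot (i - 1) j = rot (i - 1) \<otimes> range_prod G rot i j"
        by (simp add: range_prod_def)
      moreover have "rot (i - 1) \<in> generate G (rot ` {1..n-1})"
        using step that by (intro generate.incl imageI) auto
      ultimately show ?case using step generate.eng by auto
    qed
  next
    case False
    then show ?thesis using generate.one by (simp add: range_prod_def)
  qed
  then have "generate G {range_prod G rot i j | i j. 1 \<le> i \<and> i \<le> j \<and> j \<le> n - 1 \<and> i - 1 \<in> N \<and> j \<in> N}
      \<subseteq> generate G (rot ` {1..n-1})"
    using generate_is_subgroup[OF rc] by (intro generate_subgroup_incl) auto
  then show "even_span N \<subseteq> generate G (rot ` {1..n-1})"
    using gen_subgroup_eq_even_span[of N] by (simp add: gen_subgroup_def)
qed

end

text \<open>Stated for words rather than for subgroups, so that it can be transported along any correspondence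
  of words that preserves and reflects relations.\<close>
definition intersection_property :: "('g, 'r) monoid_scheme \<Rightarrow> (int \<Rightarrow> 'g) \<Rightarrow> int set \<Rightarrow> bool" where
  "intersection_property G r A \<longleftrightarrow>
     (\<forall>u v. set u \<subseteq> A \<and> set v \<subseteq> A \<and> word G r u = word G r v \<longrightarrow>
        (\<exists>w. set w \<subseteq> set u \<inter> set v \<and> word G r w = word G r u))"

text \<open>The common properties of the automorphism group of a directly regular polytope and of the group
  of a pair of them: \<open>parity\<close> expresses that the even words form a proper subgroup, and \<open>separated\<close>
  that an element fixing every face of the base flag is trivial. Both are inherited by the
  subgroup of a product that is generated by the pairs of generators.\<close>
locale string_group = involution_system +
  assumes far_comm: "\<lbrakk>0 \<le> i; i + 1 < j; j \<le> n - 1\<rbrakk> \<Longrightarrow> r i \<otimes> r j = r j \<otimes> r i"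
    and parity: "set w \<subseteq> {0..n-1} \<Longrightarrow> word G r w = \<one> \<Longrightarrow> even (length w)"
    and separated: "\<lbrakk>set w \<subseteq> {0..n-1};
        \<And>j. j \<in> {0..n-1} \<Longrightarrow> \<exists>v. set v \<subseteq> {0..n-1} - {j} \<and> word G r v = word G r w\<rbrakk>
      \<Longrightarrow> word G r w = \<one>"
begin

lemma separated_span:
  assumes "g \<in> span N" "\<And>j. j \<in> N \<Longrightarrow> g \<in> span (N - {j})"
  shows "g = \<one>"
proof -
  obtain w where w: "g = wd w" "set w \<subseteq> N" using assms(1) by (auto simp: span_def)
  have "\<exists>v. set v \<subseteq> N - {j} \<and> wd v = wd w" if "j \<in> N" for j
    using assms(2)[OF that] w unfolding span_def by auto
  then show ?thesis using separated w by blast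
qed

text \<open>Otherwise the generator would lie in every maximal subgroup and be trivial, against parity.\<close>
lemma generator_notin: "j \<in> N \<Longrightarrow> r j \<notin> span (N - {j})"
proof
  assume j: "j \<in> N" "r j \<in> span (N - {j})"
  have "r j \<in> span (N - {i})" if "i \<in> N" for i
    using j that span_gen[of j "N - {i}"] by (cases "i = j") auto
  then have "r j = \<one>" using separated_span j span_gen[of j N] by auto
  then show False using parity[of "[j]"] j by auto
qed

lemma word_parity:
  assumes "set u \<subseteq> N" "set v \<subseteq> N" "wd u = wd v"
  shows "even (length u) \<longleftrightarrow> even (length v)"
proof -
  have "wd (rev u @ v) = \<one>" using assms word_rev[of u] word_append[of "rev u" v] by simp
  then show ?thesis using parity[of "rev u @ v"] assms by auto
qed

lemma lower_upper_commute:
  assumes I: "I \<subseteq> N" and a: "a \<in> span (I \<inter> {..<k})" and b: "b \<in> span (I \<inter> {k<..})"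
  shows "a \<otimes> b = b \<otimes> a"
proof -
  have 1: "r i \<otimes> b = b \<otimes> r i" if i: "i \<in> I" "i < k" for i
  proof -
    have "r i \<otimes> wd v = wd v \<otimes> r i" if "set v \<subseteq> I \<inter> {k<..}" for v
      using that
    proof (induction v)
      case Nil then show ?case using i generator_carrier[OF I] by auto
    next
      case (Cons j v)
      have v: "wd v \<in> carrier G" "r i \<in> carrier G" "r j \<in> carrier G"
        using Cons.prems i generator_carrier[OF I] word_carrier[OF I, of v] by auto
      have "i \<in> N" "j \<in> N" "i + 1 < j + 1" "k < j" using Cons.prems i I by auto
      then have "r i \<otimes> r j = r j \<otimes> r i" using i far_comm[of i j] by auto
      then have "r i \<otimes> wd (j # v) = r j \<otimes> (r i \<otimes> wd v)" using v by (metis m_assoc word_Cons)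
      then show ?case using Cons v by (simp add: m_assoc)
    qed
    then show ?thesis using b by (auto simp: span_def)
  qed
  have b': "b \<in> carrier G" using span_carrier[of "I \<inter> {k<..}" b] b I by auto
  have "wd u \<otimes> b = b \<otimes> wd u" if "set u \<subseteq> I \<inter> {..<k}" for u
    using that
  proof (induction u)
    case Nil then show ?case using b' by auto
  next
    case (Cons i u)
    have u: "wd u \<in> carrier G" "r i \<in> carrier G"
      using Cons.prems generator_carrier[OF I] word_carrier[OF I, of u] by auto
    have "wd (i # u) \<otimes> b = r i \<otimes> (b \<otimes> wd u)" using Cons u b' by (simp add: m_assoc)
    also have "\<dots> = b \<otimes> wd (i # u)" using 1[of i] Cons.prems u b' by (simp add: m_assoc[symmetric])
    finally show ?case .
  qed
  then show ?thesis using a by (auto simp: span_def)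
qed

text \<open>Leaving out the index \<open>k\<close> splits the generators into two sets that commute with each other.\<close>
lemma span_split:
  assumes I: "I \<subseteq> N" and k: "k \<notin> I" and g: "g \<in> span I"
  obtains a b where "a \<in> span (I \<inter> {..<k})" "b \<in> span (I \<inter> {k<..})" "g = a \<otimes> b" "g = b \<otimes> a"
proof -
  have "\<exists>a \<in> span (I \<inter> {..<k}). \<exists>b \<in> span (I \<inter> {k<..}). wd w = a \<otimes> b" if "set w \<subseteq> I" for w
    using that
  proof (induction w)
    case Nil
    show ?case using one_span by (auto intro!: bexI[of _ \<one>])
  next
    case (Cons i w)
    then obtain a b where ab: "a \<in> span (I \<inter> {..<k})" "b \<in> span (I \<inter> {k<..})" "wd w = a \<otimes> b" by auto
    have c: "a \<in> carrier G" "b \<in> carrier G" "r i \<in> carrier G"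
      using ab span_carrier[of "I \<inter> {..<k}"] span_carrier[of "I \<inter> {k<..}"] I Cons.prems generator_carrier[OF I]
        by auto
    show ?case
    proof (cases "i < k")
      case True
      then have "r i \<otimes> a \<in> span (I \<inter> {..<k})"
        using ab span_mult[of "I \<inter> {..<k}"] span_gen[of i "I \<inter> {..<k}"] I Cons.prems by auto
      then show ?thesis using ab c by (intro bexI[of _ "r i \<otimes> a"] bexI[of _ b]) (auto simp: m_assoc)
    next
      case False
      then have i: "i \<in> I \<inter> {k<..}" using Cons.prems k by (auto simp: less_le)
      then have rb: "r i \<otimes> b \<in> span (I \<inter> {k<..})"
        using ab span_mult[of "I \<inter> {k<..}"] span_gen[of i "I \<inter> {k<..}"] I by auto
      have "wd (i # w) = b' \<otimes> c'" if "b' = a" "c' = r i \<otimes> b" for b' c'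
      proof -
        have "a \<otimes> r i = r i \<otimes> a"
          using lower_upper_commute[OF I ab(1), of "r i"] span_gen[OF i] I by auto
        then show ?thesis using ab c that by (simp add: m_assoc[symmetric])
      qed
      then show ?thesis using ab rb by blast
    qed
  qed
  moreover obtain w where "g = wd w" "set w \<subseteq> I" using g by (auto simp: span_def)
  ultimately obtain a b where "a \<in> span (I \<inter> {..<k})" "b \<in> span (I \<inter> {k<..})" "g = a \<otimes> b"
    by blast
  then show thesis using that lower_upper_commute[OF I] by metis
qed

lemma intersection_property_iff:
  assumes A: "A \<subseteq> N"
  shows "intersection_property G r A \<longleftrightarrow>
    (\<forall>I J. I \<subseteq> A \<and> J \<subseteq> A \<longrightarrow> span I \<inter> span J \<subseteq> span (I \<inter> J))"
proof
  assume L: "intersection_property G r A"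
  show "\<forall>I J. I \<subseteq> A \<and> J \<subseteq> A \<longrightarrow> span I \<inter> span J \<subseteq> span (I \<inter> J)"
  proof (intro allI impI subsetI)
    fix I J g assume IJ: "I \<subseteq> A \<and> J \<subseteq> A" and g: "g \<in> span I \<inter> span J"
    obtain u where u: "g = wd u" "set u \<subseteq> I" using g by (auto simp: span_def)
    obtain v where v: "g = wd v" "set v \<subseteq> J" using g by (auto simp: span_def)
    note uv = u v
    then obtain w where "set w \<subseteq> set u \<inter> set v" "wd w = wd u"
      using L IJ unfolding intersection_property_def by (metis subset_trans)
    then show "g \<in> span (I \<inter> J)" unfolding span_def using uv by (intro CollectI exI[of _ w]) auto
  qed
next
  assume R: "\<forall>I J. I \<subseteq> A \<and> J \<subseteq> A \<longrightarrow> span I \<inter> span J \<subseteq> span (I \<inter> J)"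
  show "intersection_property G r A" unfolding intersection_property_def
  proof (intro allI impI)
    fix u v assume uv: "set u \<subseteq> A \<and> set v \<subseteq> A \<and> wd u = wd v"
    then have "wd u \<in> span (set u) \<inter> span (set v)"
      using span_wordI[of u "set u"] span_wordI[of v "set v"] by simp
    then have "wd u \<in> span (set u \<inter> set v)" using R uv by blast
    then show "\<exists>w. set w \<subseteq> set u \<inter> set v \<and> wd w = wd u" by (auto simp: span_def)
  qed
qed

lemma intersection_property_family:
  assumes ip: "intersection_property G r A" and A: "A \<subseteq> N" and fin: "finite S" "S \<noteq> {}"
    and f: "\<And>s. s \<in> S \<Longrightarrow> f s \<subseteq> A \<and> g \<in> span (f s)"
  shows "g \<in> span (\<Inter> (f ` S))"
  using fin f
proof (induction S rule: finite_ne_induct)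
  case (insert s S)
  have "\<Inter> (f ` S) \<subseteq> A" using insert by blast
  then have "span (f s) \<inter> span (\<Inter> (f ` S)) \<subseteq> span (f s \<inter> \<Inter> (f ` S))"
    using ip insert.prems[of s] unfolding intersection_property_iff[OF A] by auto
  then show ?case using insert by auto
qed simp

text \<open>It is enough to compare intersections of the stabilisers of single faces.\<close>

lemma intersection_property_N_iff:
  "intersection_property G r N \<longleftrightarrow>
    (\<forall>S g. S \<subseteq> N \<and> g \<in> span N \<and> (\<forall>j \<in> S. g \<in> span (N - {j})) \<longrightarrow> g \<in> span (N - S))"
proof
  assume ip: "intersection_property G r N"
  show "\<forall>S g. S \<subseteq> N \<and> g \<in> span N \<and> (\<forall>j \<in> S. g \<in> span (N - {j})) \<longrightarrow> g \<in> span (N - S)"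
  proof (intro allI impI)
    fix S g assume S: "S \<subseteq> N \<and> g \<in> span N \<and> (\<forall>j \<in> S. g \<in> span (N - {j}))"
    show "g \<in> span (N - S)"
    proof (cases "S = {}")
      case False
      have "finite S" using S finite_subset by blast
      then have "g \<in> span (\<Inter> ((\<lambda>j. N - {j}) ` S))"
        using False S by (intro intersection_property_family[OF ip subset_refl]) auto
      moreover have "\<Inter> ((\<lambda>j. N - {j}) ` S) = N - S" using False by auto
      ultimately show ?thesis by simp
    qed (use S in auto)
  qed
next
  assume R: "\<forall>S g. S \<subseteq> N \<and> g \<in> span N \<and> (\<forall>j \<in> S. g \<in> span (N - {j})) \<longrightarrow> g \<in> span (N - S)"
  show "intersection_property G r N" unfolding intersection_property_iff[OF subset_refl]
  proof (intro allI impI subsetI)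
    fix I J g assume IJ: "I \<subseteq> N \<and> J \<subseteq> N" and g: "g \<in> span I \<inter> span J"
    have "g \<in> span (N - {j})" if "j \<in> N - I \<inter> J" for j
      using that g IJ span_mono[of I "N - {j}"] span_mono[of J "N - {j}"] by blast
    moreover have "g \<in> span N" by (rule span_weaken[where I = I and J = N]) (use g IJ in auto)
    moreover have "N - (N - I \<inter> J) = I \<inter> J" using IJ by auto
    ultimately show "g \<in> span (I \<inter> J)" using R[rule_format, of "N - I \<inter> J" g] by auto
  qed
qed

text \<open>Write an element of the \<open>j\<close>-th maximal subgroup as \<open>a \<otimes> b\<close> with \<open>a\<close> below and \<open>b\<close> above \<open>j\<close>. If it is
  also generated without \<open>r (n - 1)\<close>, then so is \<open>b\<close>, which therefore lies in the common part of the
  two ends, and the intersection property of the upper end removes \<open>n - 1\<close> from \<open>b\<close>. So an element that lies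
  in the maximal subgroups of all \<open>j\<close> in a set containing \<open>n - 1\<close> is reduced to the lower end.
  For an arbitrary set, split at its maximum \<open>m\<close>: the upper factor
  belongs to all the required subgroups already, and the lower factor does not involve \<open>n - 1\<close>.\<close>
theorem intersection_property_from_ends:
  assumes ipA: "intersection_property G r {0..n-2}" and ipB: "intersection_property G r {1..n-1}"
    and middle: "span {0..n-2} \<inter> span {1..n-1} \<subseteq> span {1..n-2}"
  shows "intersection_property G r N"
proof -
  let ?A = "{0..n-2}" and ?B = "{1..n-1}"
  have NA: "N - {n-1} = ?A" by auto
  have A: "?A \<subseteq> N" and B: "?B \<subseteq> N" by auto
  have high: "g \<in> span (N - {n-1, j})" if g: "g \<in> span ?A" "g \<in> span (N - {j})" and j: "j \<in> N" for g j
  proof (cases "j = n-1")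
    case False
    obtain a b where ab: "a \<in> span ((N - {j}) \<inter> {..<j})" "b \<in> span ((N - {j}) \<inter> {j<..})" "g = a \<otimes> b"
      using span_split[of "N - {j}" j g] g by blast
    have a: "a \<in> span ?A"
      by (rule span_weaken[where I = "(N - {j}) \<inter> {..<j}" and J = ?A]) (use ab(1) j in auto)
    have bc: "b \<in> carrier G" by (rule span_carrier[OF _ ab(2)]) auto
    have "b = inv a \<otimes> g" using ab a bc span_carrier[OF A] by (simp add: m_assoc[symmetric])
    then have "b \<in> span ?A" using g(1) a span_mult[OF A] span_inv[OF A] by auto
    moreover have bB: "b \<in> span ((N - {j}) \<inter> {j<..})" using ab by auto
    moreover have "(N - {j}) \<inter> {j<..} \<subseteq> ?B" using j by auto
    ultimately have "b \<in> span {1..n-2}" using middle span_mono by blast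
    moreover have "{1..n-2} \<subseteq> ?B" by auto
    ultimately have "b \<in> span ((N - {j}) \<inter> {j<..} \<inter> {1..n-2})"
      using ipB bB \<open>(N - {j}) \<inter> {j<..} \<subseteq> ?B\<close> unfolding intersection_property_iff[OF B] by blast
    then have "b \<in> span (N - {n-1, j})"
      by (rule span_weaken[where I = "(N - {j}) \<inter> {j<..} \<inter> {1..n-2}" and J = "N - {n-1,j}"]) auto
    moreover have "a \<in> span (N - {n-1, j})"
      by (rule span_weaken[where I = "(N - {j}) \<inter> {..<j}" and J = "N - {n-1, j}"]) (use ab(1) j in auto)
    ultimately show ?thesis using ab span_mult[of "N - {n-1,j}"] by auto
  qed (use g in \<open>simp add: NA\<close>)
  have top: "g \<in> span (N - S)"
    if S: "S \<subseteq> N" "n - 1 \<in> S" and g: "\<And>j. j \<in> S \<Longrightarrow> g \<in> span (N - {j})" for S g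
  proof -
    have "g \<in> span (\<Inter> ((\<lambda>j. N - {n-1, j}) ` S))"
    proof (rule intersection_property_family[OF ipA A, where f = "\<lambda>j. N - {n-1, j}"])
      show "finite S" using S finite_subset by blast
      show "S \<noteq> {}" using S by auto
      fix j assume j: "j \<in> S"
      have "g \<in> span ?A" using g[OF S(2)] unfolding NA .
      then show "N - {n-1, j} \<subseteq> ?A \<and> g \<in> span (N - {n-1, j})"
        using high[OF _ g[OF j]] j S(1) NA by blast
    qed
    moreover have "\<Inter> ((\<lambda>j. N - {n-1, j}) ` S) = N - S" using S by auto
    ultimately show ?thesis by simp
  qed
  show ?thesis unfolding intersection_property_N_iff
  proof (intro allI impI)
    fix S g assume "S \<subseteq> N \<and> g \<in> span N \<and> (\<forall>j \<in> S. g \<in> span (N - {j}))"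
    then have S: "S \<subseteq> N" "g \<in> span N" "\<And>j. j \<in> S \<Longrightarrow> g \<in> span (N - {j})" by auto
    have fin: "finite S" using S finite_subset by blast
    show "g \<in> span (N - S)"
    proof (cases "S = {}")
      case False
      define m where "m = Max S"
      have m: "m \<in> S" "\<And>j. j \<in> S \<Longrightarrow> j \<le> m" unfolding m_def using fin False by auto
      obtain a b where ab: "a \<in> span ((N - {m}) \<inter> {..<m})" "b \<in> span ((N - {m}) \<inter> {m<..})" "g = a \<otimes> b"
        using span_split[of "N - {m}" m g] S(3)[OF m(1)] by blast
      have "(N - {m}) \<inter> {m<..} \<subseteq> N - S" using m(2) by (auto simp: not_less[symmetric])
      then have bS: "b \<in> span (N - S)" using ab(2) span_weaken by blast
      have ac: "a \<in> carrier G" by (rule span_carrier[OF _ ab(1)]) auto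
      have bc: "b \<in> carrier G" by (rule span_carrier[OF _ ab(2)]) auto
      have aN: "a \<in> span (N - {j})" if "j \<in> S \<or> j \<ge> m" for j
      proof (cases "j \<ge> m")
        case True
        show ?thesis
          by (rule span_weaken[where I = "(N - {m}) \<inter> {..<m}" and J = "N - {j}"]) (use ab(1) True in auto)
      next
        case False
        then have j: "j \<in> S" using that by auto
        have "b \<in> span (N - {j})"
          by (rule span_weaken[where I = "N - S" and J = "N - {j}"]) (use bS j in auto)
        moreover have "a = g \<otimes> inv b" using ab ac bc by (simp add: m_assoc)
        ultimately show ?thesis
          using S(3)[OF j] span_mult[of "N - {j}"] span_inv[of "N - {j}"] by auto
      qed
      have mN: "m \<in> N" using m S by auto
      have "a \<in> span (N - insert (n-1) S)"
      proof (rule top)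
        show "insert (n-1) S \<subseteq> N" using S mN by auto
        show "a \<in> span (N - {j})" if "j \<in> insert (n-1) S" for j using aN[of j] that mN by auto
      qed simp
      then have "a \<in> span (N - S)"
        by (rule span_weaken[where I = "N - insert (n-1) S" and J = "N - S"]) auto
      then show ?thesis using ab bS span_mult[of "N - S"] by auto
    qed (use S in auto)
  qed
qed

end

section \<open>Coset posets\<close>

text \<open>A system of elements whose words satisfy exactly the relations of the words in \<open>r s, ..., r (s + m - 1)\<close>
  is again such a system.\<close>
lemma (in string_group) string_group_transfer:
  fixes G' (structure) and r' :: "int \<Rightarrow> 'c" and m s :: int
  assumes G': "group G'" and closed_G': "\<And>i. i \<in> {0..m-1} \<Longrightarrow> r' i \<in> carrier G'"
    and s: "0 \<le> s" "s + m \<le> n"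
    and kernel: "\<And>u v. \<lbrakk>set u \<subseteq> {0..m-1}; set v \<subseteq> {0..m-1}\<rbrakk> \<Longrightarrow>
      word G' r' u = word G' r' v \<longleftrightarrow> wd (map ((+) s) u) = wd (map ((+) s) v)"
  shows "string_group G' r' m"
    and "\<And>A. \<lbrakk>A \<subseteq> {0..m-1}; intersection_property G' r' A\<rbrakk> \<Longrightarrow> intersection_property G r ((+) s ` A)"
proof -
  interpret G': group G' by (rule G')
  have shift: "set (map ((+) s) u) \<subseteq> N" if "set u \<subseteq> {0..m-1}" for u
    using that s by fastforce
  have word1: "r' i \<otimes>\<^bsub>G'\<^esub> r' j = word G' r' [i, j]" if "i \<in> {0..m-1}" "j \<in> {0..m-1}" for i j
    using that closed_G' by simp
  have rN: "r (s + i) \<in> carrier G" "s + i \<in> N" if "i \<in> {0..m-1}" for i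
    using that s closed[of "s + i"] by auto
  show "string_group G' r' m"
  proof (unfold_locales)
    fix i assume i: "i \<in> {0..m-1}"
    then show "r' i \<in> carrier G'" by (rule closed_G')
    have "word G' r' [i, i] = word G' r' []"
      using kernel[of "[i,i]" "[]"] i rN[OF i] invol[of "s + i"] by simp
    then show "r' i \<otimes>\<^bsub>G'\<^esub> r' i = \<one>\<^bsub>G'\<^esub>" using word1[OF i i] by simp
  next
    fix i j assume ij: "0 \<le> i" "i + 1 < j" "j \<le> m - 1"
    have "wd (map ((+) s) [i, j]) = wd (map ((+) s) [j, i])"
      using ij s rN[of i] rN[of j] far_comm[of "s + i" "s + j"] by simp
    then have "word G' r' [i, j] = word G' r' [j, i]" using kernel[of "[i,j]" "[j,i]"] ij by simp
    then show "r' i \<otimes>\<^bsub>G'\<^esub> r' j = r' j \<otimes>\<^bsub>G'\<^esub> r' i" using word1[of i j] word1[of j i] ij by simp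
  next
    fix w assume w: "set w \<subseteq> {0..m-1}" "word G' r' w = \<one>\<^bsub>G'\<^esub>"
    then have "wd (map ((+) s) w) = \<one>" using kernel[of w "[]"] by simp
    then show "even (length w)" using parity[OF shift[OF w(1)]] by simp
  next
    fix w assume w: "set w \<subseteq> {0..m-1}"
      and sep: "\<And>j. j \<in> {0..m-1} \<Longrightarrow> \<exists>v. set v \<subseteq> {0..m-1} - {j} \<and> word G' r' v = word G' r' w"
    have "wd (map ((+) s) w) = \<one>"
    proof (rule separated[OF shift[OF w]])
      fix j assume j: "j \<in> N"
      show "\<exists>v. set v \<subseteq> N - {j} \<and> wd v = wd (map ((+) s) w)"
      proof (cases "j - s \<in> {0..m-1}")
        case True
        then obtain v where v: "set v \<subseteq> {0..m-1} - {j - s}" "word G' r' v = word G' r' w"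
          using sep by blast
        then have v': "set v \<subseteq> {0..m-1}" by auto
        have "wd (map ((+) s) v) = wd (map ((+) s) w)" using kernel[OF v' w] v by simp
        moreover have "set (map ((+) s) v) \<subseteq> N - {j}" using v shift[OF v'] by auto
        ultimately show ?thesis by blast
      next
        case False
        then have "set (map ((+) s) w) \<subseteq> N - {j}" using shift[OF w] w by auto
        then show ?thesis by blast
      qed
    qed
    then show "word G' r' w = \<one>\<^bsub>G'\<^esub>" using kernel[of w "[]"] w by simp
  qed
  fix A assume A: "A \<subseteq> {0..m-1}" and ip: "intersection_property G' r' A"
  show "intersection_property G r ((+) s ` A)"
    unfolding intersection_property_def
  proof (intro allI impI)
    fix u v assume uv: "set u \<subseteq> (+) s ` A \<and> set v \<subseteq> (+) s ` A \<and> wd u = wd v"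
    have unshift: "\<exists>w'. set w' \<subseteq> A \<and> w = map ((+) s) w'" if w: "set w \<subseteq> (+) s ` A" for w
    proof (intro exI conjI)
      show "set (map (\<lambda>i. i - s) w) \<subseteq> A" using w by auto
      show "w = map ((+) s) (map (\<lambda>i. i - s) w)" by (simp add: comp_def)
    qed
    obtain u' v' where u': "set u' \<subseteq> A" "u = map ((+) s) u'" and v': "set v' \<subseteq> A" "v = map ((+) s) v'"
      using uv unshift[of u] unshift[of v] by blast
    then have "word G' r' u' = word G' r' v'" using kernel[of u' v'] A uv by (metis subset_trans)
    then obtain w where w: "set w \<subseteq> set u' \<inter> set v'" "word G' r' w = word G' r' u'"
      using ip u' v' unfolding intersection_property_def by blast
    then have "wd (map ((+) s) w) = wd u"
      using kernel[of w u'] A u' by (metis subset_trans le_inf_iff)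
    moreover have "set (map ((+) s) w) \<subseteq> set u \<inter> set v" using w u' v' by auto
    ultimately show "\<exists>w. set w \<subseteq> set u \<inter> set v \<and> wd w = wd u" by blast
  qed
qed

text \<open>Rank 3 is needed so that for any two indices there is a third generator, which changes the
  parity of an element without changing its faces of these two ranks.\<close>
locale string_group_ge3 = string_group +
  assumes n3: "3 \<le> n"
begin

text \<open>The part of a coset in the even subgroup is a coset of the even distinguished subgroup. Taking \<open>x\<close> in the
  whole group makes the elements of the group the indices of the flags, odd ones included.\<close>
definition face :: "int \<Rightarrow> 'a \<Rightarrow> 'a set" where
  "face j x = (span (N - {j}) #> x) \<inter> even_span N"

definition fc :: "int \<Rightarrow> 'a \<Rightarrow> 'a mix_face" where
  "fc j x = (if j = -1 then Bottom else if j = n then Top else Coset j (face j x))"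

lemma spanN_carrier: "x \<in> span N \<Longrightarrow> x \<in> carrier G"
  using span_carrier by blast

lemma mem_face:
  assumes x: "x \<in> span N"
  shows "z \<in> face j x \<longleftrightarrow> z \<in> even_span N \<and> z \<otimes> inv x \<in> span (N - {j})"
proof -
  have xc: "x \<in> carrier G" using x spanN_carrier by auto
  have "z \<in> span (N - {j}) #> x \<longleftrightarrow> z \<otimes> inv x \<in> span (N - {j})" if z: "z \<in> even_span N"
  proof -
    have zc: "z \<in> carrier G" using z spanN_carrier even_span_sub_span by auto
    have "z \<in> span (N - {j}) #> x \<longleftrightarrow> (\<exists>h \<in> span (N - {j}). z = h \<otimes> x)" by (auto simp: r_coset_def)
    also have "\<dots> \<longleftrightarrow> z \<otimes> inv x \<in> span (N - {j})"
    proof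
      assume "\<exists>h \<in> span (N - {j}). z = h \<otimes> x"
      then obtain h where h: "h \<in> span (N - {j})" "z = h \<otimes> x" by auto
      then have "h \<in> carrier G" using span_carrier[of "N - {j}" h] by auto
      then show "z \<otimes> inv x \<in> span (N - {j})" using h xc by (simp add: m_assoc)
    next
      assume "z \<otimes> inv x \<in> span (N - {j})"
      moreover have "z = (z \<otimes> inv x) \<otimes> x" using xc zc by (simp add: m_assoc)
      ultimately show "\<exists>h \<in> span (N - {j}). z = h \<otimes> x" by blast
    qed
    finally show ?thesis .
  qed
  then show ?thesis by (auto simp: face_def)
qed

lemma even_or_odd:
  assumes x: "x \<in> span N" and i: "i \<in> N"
  shows "x \<in> even_span N \<or> r i \<otimes> x \<in> even_span N"
proof -
  obtain w where w: "x = wd w" "set w \<subseteq> N" using x by (auto simp: span_def)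
  show ?thesis
  proof (cases "even (length w)")
    case True then show ?thesis using w by (auto simp: even_span_def)
  next
    case False
    then have "wd (i # w) \<in> even_span N" unfolding even_span_def using w i
      by (intro CollectI exI[of _ "i # w"]) auto
    then show ?thesis using w by simp
  qed
qed

lemma move_coset:
  assumes "x \<in> span N" "g \<in> span N"
  shows "g \<otimes> x \<in> span N" "g \<otimes> x \<otimes> inv x = g"
  using assms span_mult[of N g x] spanN_carrier by (auto simp: m_assoc)

lemma coset_trans:
  assumes "x \<in> span N" "y \<in> span N" "z \<in> span N" "y \<otimes> inv x \<in> span (N - {j})" "z \<otimes> inv y \<in> span (N - {j})"
  shows "z \<otimes> inv x \<in> span (N - {j})"
proof -
  have "z \<otimes> inv x = (z \<otimes> inv y) \<otimes> (y \<otimes> inv x)"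
    using assms(1-3) spanN_carrier by (simp add: m_assoc inv_solve_left)
  then show ?thesis using assms span_mult[of "N - {j}"] by auto
qed

lemma coset_sym:
  assumes "x \<in> span N" "y \<in> span N" "y \<otimes> inv x \<in> span (N - {j})"
  shows "x \<otimes> inv y \<in> span (N - {j})"
proof -
  have "x \<otimes> inv y = inv (y \<otimes> inv x)" using assms(1,2) spanN_carrier by (simp add: inv_mult_group)
  then show ?thesis using assms span_inv[of "N - {j}"] by auto
qed

text \<open>If \<open>x\<close> is odd, then multiplication by a generator other than \<open>r j\<close> and \<open>r k\<close> corrects its parity.\<close>
lemma face_representative:
  assumes x: "x \<in> span N" and j: "j \<in> N" and k: "k \<in> N"
  shows "\<exists>z \<in> even_span N. z \<otimes> inv x \<in> span (N - {j}) \<and> z \<otimes> inv x \<in> span (N - {k})"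
proof -
  obtain i where i: "i \<in> N" "i \<noteq> j" "i \<noteq> k"
  proof -
    have "0 \<in> N" "1 \<in> N" "2 \<in> N" using n3 by auto
    then show thesis using that[of 0] that[of 1] that[of 2] by fastforce
  qed
  have xc: "x \<in> carrier G" using x spanN_carrier by auto
  have "x \<otimes> inv x \<in> span (N - {l})" for l using xc one_span by simp
  moreover have "r i \<otimes> x \<otimes> inv x \<in> span (N - {l})" if "l \<in> {j, k}" for l
    using move_coset(2)[OF x, of "r i"] span_gen[of i "N - {l}"] span_gen[of i N] i that by auto
  ultimately show ?thesis using even_or_odd[OF x i(1)] by blast
qed

lemma face_eq_iff:
  assumes x: "x \<in> span N" and y: "y \<in> span N" and j: "j \<in> N"
  shows "face j x = face j y \<longleftrightarrow> y \<otimes> inv x \<in> span (N - {j})"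
proof
  assume eq: "face j x = face j y"
  obtain z where z: "z \<in> even_span N" "z \<otimes> inv x \<in> span (N - {j})"
    using face_representative[OF x j j] by auto
  then have "z \<in> face j y" using mem_face[OF x] eq by auto
  then have "y \<otimes> inv z \<in> span (N - {j})"
    using coset_sym[of y z j] mem_face[OF y] y z even_span_sub_span by auto
  then show "y \<otimes> inv x \<in> span (N - {j})"
    using coset_trans[of x z y j] z x y even_span_sub_span by auto
next
  assume H: "y \<otimes> inv x \<in> span (N - {j})"
  have "z \<in> face j x \<longleftrightarrow> z \<in> face j y" for z
  proof (cases "z \<in> even_span N")
    case True
    then have z: "z \<in> span N" using even_span_sub_span by auto
    show ?thesis using mem_face[OF x] mem_face[OF y] True coset_trans[OF x y z H]
        coset_trans[OF y x z coset_sym[OF x y H]] by blast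
  qed (simp add: face_def)
  then show "face j x = face j y" by blast
qed

text \<open>Since \<open>N - {i} = N\<close> for the ranks \<open>i\<close> of the two improper faces, they need no separate treatment.\<close>
lemma fc_eq_iff:
  assumes "x \<in> span N" "y \<in> span N" "i \<in> {-1..n}"
  shows "fc i x = fc i y \<longleftrightarrow> y \<otimes> inv x \<in> span (N - {i})"
proof (cases "i \<in> N")
  case True
  then show ?thesis using face_eq_iff[OF assms(1,2)] by (auto simp: fc_def)
next
  case False
  then have "N - {i} = N" by auto
  moreover have "y \<otimes> inv x \<in> span N" using assms span_mult[of N] span_inv[of N] by auto
  moreover have "i = -1 \<or> i = n" using False assms(3) by auto
  ultimately show ?thesis by (auto simp: fc_def)
qed

lemma fc_mult_eq:
  assumes "x \<in> span N" "g \<in> span N" "g \<in> span (N - {i})" "i \<in> {-1..n}"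
  shows "fc i (g \<otimes> x) = fc i x"
  using fc_eq_iff[of x "g \<otimes> x" i] move_coset[of x g] assms by auto

lemma fc_graded: "\<lbrakk>i \<in> {-1..n}; j \<in> {-1..n}; fc i x = fc j y\<rbrakk> \<Longrightarrow> i = j"
  using n3 by (auto simp: fc_def split: if_splits)

text \<open>If \<open>x\<close> and \<open>y = a \<otimes> b \<otimes> x\<close> share the face of rank \<open>m\<close>, where \<open>a\<close> only involves indices below \<open>m\<close> and \<open>b\<close>
  only indices above \<open>m\<close>, then \<open>b \<otimes> x\<close> has the lower faces of \<open>x\<close> and the upper faces of \<open>y\<close>.\<close>
sublocale flag_system "span N" fc n
proof
  show "-1 \<le> n" using n3 by simp
  show "span N \<noteq> {}" using one_span by auto
  fix m x y assume m: "m \<in> N" and x: "x \<in> span N" and y: "y \<in> span N" and eq: "fc m x = fc m y"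
  have g: "y \<otimes> inv x \<in> span (N - {m})" using fc_eq_iff[OF x y] eq m by auto
  obtain a b where a: "a \<in> span ((N - {m}) \<inter> {..<m})" and b: "b \<in> span ((N - {m}) \<inter> {m<..})"
    and ab: "y \<otimes> inv x = a \<otimes> b"
    using span_split[OF _ _ g, of m] by blast
  have bN: "b \<in> span N" by (rule span_weaken[OF b]) auto
  have aN: "a \<in> span N" by (rule span_weaken[OF a]) auto
  have z: "b \<otimes> x \<in> span N" using move_coset[OF x bN] by auto
  have yab: "y = a \<otimes> (b \<otimes> x)"
    using ab x y aN bN spanN_carrier by (metis m_assoc m_closed inv_closed l_inv r_one)
  have "fc j (b \<otimes> x) = fc j x" if "j \<in> {-1..m}" for j
    by (rule fc_mult_eq[OF x bN span_weaken[OF b]]) (use that m in auto)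
  moreover have "fc j (b \<otimes> x) = fc j y" if "j \<in> {m..n}" for j
    unfolding yab by (rule fc_mult_eq[OF z aN span_weaken[OF a], symmetric]) (use that m in auto)
  ultimately show "\<exists>z \<in> span N. (\<forall>j \<in> {-1..m}. fc j z = fc j x) \<and> (\<forall>j \<in> {m..n}. fc j z = fc j y)"
    using z by blast
next
  fix i j x y assume "i \<in> {-1..n}" "j \<in> {-1..n}" "fc i x = fc j y"
  then show "i = j" by (rule fc_graded)
next
  show "fc (-1) x = fc (-1) y" for x y by (simp add: fc_def)
  show "fc n x = fc n y" for x y by (simp add: fc_def)
qed

abbreviation "R \<equiv> G\<lparr>carrier := even_span N\<rparr>"

lemma even_span_coset:
  assumes x: "x \<in> even_span N" and j: "j \<in> N"
  shows "even_span (N - {j}) #>\<^bsub>R\<^esub> x = face j x"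
proof -
  have xs: "x \<in> span N" using x even_span_sub_span by auto
  have xc: "x \<in> carrier G" using xs spanN_carrier by auto
  have "z \<in> even_span (N - {j}) #> x \<longleftrightarrow> z \<in> face j x" for z
  proof
    assume "z \<in> even_span (N - {j}) #> x"
    then obtain h where h: "h \<in> even_span (N - {j})" "z = h \<otimes> x" by (auto simp: r_coset_def)
    have "h \<in> even_span N" using h(1) by (auto simp: even_span_def)
    then have "z \<in> even_span N" using h subgroup.m_closed[OF subgroup_even_span[of N]] x by auto
    then show "z \<in> face j x"
      using h even_span_sub_span unfolding face_def by (auto simp: r_coset_def)
  next
    assume z: "z \<in> face j x"
    then obtain h where h: "h \<in> span (N - {j})" "z = h \<otimes> x" by (auto simp: r_coset_def face_def)
    then obtain w where w: "h = wd w" "set w \<subseteq> N - {j}" by (auto simp: span_def)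
    have ze: "z \<in> even_span N" using z by (auto simp: face_def)
    have hc: "h \<in> carrier G" using h(1) span_carrier[of "N - {j}" h] by auto
    have "h = z \<otimes> inv x" using h hc xc by (simp add: m_assoc)
    then have "h \<in> even_span N" using ze x subgroup.m_closed[OF subgroup_even_span[of N]]
        subgroup.m_inv_closed[OF subgroup_even_span[of N]] by auto
    then obtain v where v: "h = wd v" "set v \<subseteq> N" "even (length v)" by (auto simp: even_span_def)
    then have "even (length w)" using word_parity[of w v] w by auto
    then have "h \<in> even_span (N - {j})" using w by (auto simp: even_span_def)
    then show "z \<in> even_span (N - {j}) #> x" using h by (auto simp: r_coset_def)
  qed
  moreover have "even_span (N - {j}) #>\<^bsub>R\<^esub> x = even_span (N - {j}) #> x" by (simp add: r_coset_def)
  ultimately show ?thesis by blast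
qed

lemma rcosets_eq_faces:
  assumes j: "j \<in> N"
  shows "rcosets\<^bsub>R\<^esub> (even_span (N - {j})) = face j ` span N"
proof -
  have "rcosets\<^bsub>R\<^esub> (even_span (N - {j})) = (\<lambda>x. even_span (N - {j}) #>\<^bsub>R\<^esub> x) ` even_span N"
    by (auto simp: RCOSETS_def)
  also have "\<dots> = face j ` even_span N" using even_span_coset[OF _ j] by auto
  also have "\<dots> = face j ` span N"
  proof
    show "face j ` span N \<subseteq> face j ` even_span N"
    proof
      fix A assume "A \<in> face j ` span N"
      then obtain x where x: "x \<in> span N" "A = face j x" by auto
      obtain z where z: "z \<in> even_span N" "z \<otimes> inv x \<in> span (N - {j})"
        using face_representative[OF x(1) j j] by auto
      then have "face j x = face j z" using face_eq_iff[of x z j] x j even_span_sub_span by auto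
      then show "A \<in> face j ` even_span N" using x z by auto
    qed
    show "face j ` even_span N \<subseteq> face j ` span N" using even_span_sub_span by (intro image_mono)
  qed
  finally show ?thesis .
qed

lemma gen_subgroup_R:
  assumes I: "I \<subseteq> N"
  shows "gen_subgroup n R rot I = even_span I"
proof -
  let ?S = "{range_prod G rot i j | i j. 1 \<le> i \<and> i \<le> j \<and> j \<le> n - 1 \<and> i - 1 \<in> I \<and> j \<in> I}"
  have rp: "range_prod R rot i j = range_prod G rot i j" for i j by (simp add: range_prod_def)
  have gen: "generate G ?S = even_span I"
    using gen_subgroup_eq_even_span[OF I] by (simp add: gen_subgroup_def)
  have "?S \<subseteq> generate G ?S" by (rule subsetI, rule generate.incl)
  also have "\<dots> \<subseteq> even_span N" unfolding gen using I by (auto simp: even_span_def)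
  finally have "generate R ?S = generate G ?S"
    by (rule generate_consistent[OF _ subgroup_even_span]) simp
  then show ?thesis using gen by (simp add: gen_subgroup_def rp)
qed

lemma face_intersect_iff:
  assumes x: "x \<in> span N" and y: "y \<in> span N" and j: "j \<in> N" and k: "k \<in> N"
  shows "face j x \<inter> face k y \<noteq> {} \<longleftrightarrow> (\<exists>z \<in> span N. face j z = face j x \<and> face k z = face k y)"
proof
  assume "face j x \<inter> face k y \<noteq> {}"
  then obtain z where z: "z \<in> face j x" "z \<in> face k y" by auto
  then have "z \<in> span N" "z \<otimes> inv x \<in> span (N - {j})" "z \<otimes> inv y \<in> span (N - {k})"
    using mem_face[OF x] mem_face[OF y] even_span_sub_span by blast+
  then show "\<exists>z \<in> span N. face j z = face j x \<and> face k z = face k y"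
    using face_eq_iff[OF x _ j] face_eq_iff[OF y _ k] by (intro bexI[of _ z]) auto
next
  assume "\<exists>z \<in> span N. face j z = face j x \<and> face k z = face k y"
  then obtain z where z: "z \<in> span N" "face j z = face j x" "face k z = face k y" by auto
  obtain z' where "z' \<in> even_span N" "z' \<otimes> inv z \<in> span (N - {j})" "z' \<otimes> inv z \<in> span (N - {k})"
    using face_representative[OF z(1) j k] by auto
  then have "z' \<in> face j z" "z' \<in> face k z" using mem_face[OF z(1)] by auto
  then show "face j x \<inter> face k y \<noteq> {}" using z by auto
qed

theorem coset_poset_eq_face_poset: "coset_poset n R rot = face_poset"
proof -
  define X where "X = {Coset j A | j A. j \<in> N \<and> A \<in> rcosets\<^bsub>R\<^esub> (gen_subgroup n R rot (N - {j}))}"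
  have X: "X = {fc j x | j x. j \<in> N \<and> x \<in> span N}"
  proof -
    have "rcosets\<^bsub>R\<^esub> (gen_subgroup n R rot (N - {j})) = face j ` span N" if "j \<in> N" for j
      using rcosets_eq_faces[OF that] gen_subgroup_R[of "N - {j}"] by auto
    then have 1: "X = {Coset j A | j A. j \<in> N \<and> A \<in> face j ` span N}"
      unfolding X_def by (intro Collect_cong ex_cong1 conj_cong refl) auto
    have "Coset j (face j x) = fc j x" if "j \<in> N" for j x using that by (auto simp: fc_def)
    then show ?thesis unfolding 1 by (auto simp del: atLeastAtMost_iff) (metis imageI)
  qed
  define S where "S = {(x, y). x \<in> X \<and> y \<in> X \<and>
              (\<exists>j k A B. x = Coset j A \<and> y = Coset k B \<and> j < k \<and> A \<inter> B \<noteq> {})}"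
  have S': "S = {(fc j z, fc k z) | j k z. 0 \<le> j \<and> j < k \<and> k \<le> n - 1 \<and> z \<in> span N}"
  proof
    show "S \<subseteq> {(fc j z, fc k z) | j k z. 0 \<le> j \<and> j < k \<and> k \<le> n - 1 \<and> z \<in> span N}"
    proof
      fix p assume "p \<in> S"
      then obtain F H where p: "p = (F, H)" "F \<in> X" "H \<in> X" and
        *: "\<exists>j k A B. F = Coset j A \<and> H = Coset k B \<and> j < k \<and> A \<inter> B \<noteq> {}" unfolding S_def by blast
      obtain j x where jx: "F = fc j x" "j \<in> N" "x \<in> span N" using p X by auto
      obtain k y where ky: "H = fc k y" "k \<in> N" "y \<in> span N" using p X by auto
      have "j < k" "face j x \<inter> face k y \<noteq> {}" using * jx ky by (auto simp: fc_def)
      then obtain z where "z \<in> span N" "face j z = face j x" "face k z = face k y"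
        using face_intersect_iff[OF jx(3) ky(3) jx(2) ky(2)] by auto
      then show "p \<in> {(fc j z, fc k z) | j k z. 0 \<le> j \<and> j < k \<and> k \<le> n - 1 \<and> z \<in> span N}"
        using jx ky p \<open>j < k\<close>
        by (intro CollectI exI[of _ j] exI[of _ k] exI[of _ z]) (auto simp: fc_def)
    qed
    show "{(fc j z, fc k z) | j k z. 0 \<le> j \<and> j < k \<and> k \<le> n - 1 \<and> z \<in> span N} \<subseteq> S"
    proof
      fix p assume "p \<in> {(fc j z, fc k z) | j k z. 0 \<le> j \<and> j < k \<and> k \<le> n - 1 \<and> z \<in> span N}"
      then obtain j k z where z: "p = (fc j z, fc k z)" "j \<in> N" "k \<in> N" "j < k" "z \<in> span N" by auto
      then have "face j z \<inter> face k z \<noteq> {}" using face_intersect_iff[of z z j k] by auto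
      moreover have "fc j z \<in> X" "fc k z \<in> X" unfolding X using z by blast+
      ultimately show "p \<in> S" unfolding S_def using z by (auto simp: fc_def)
    qed
  qed
  have "bounded_poset X S = face_poset" unfolding X S'
    by (rule bounded_poset_eq_face_poset[OF flag_system_axioms]) (use n3 in \<open>auto simp: fc_def\<close>)
  then show ?thesis unfolding coset_poset_def Let_def X_def S_def by simp
qed

lemma generator_moves:
  assumes z: "z \<in> span N" and i: "i \<in> N"
  shows "r i \<otimes> z \<in> span N" "fc i (r i \<otimes> z) \<noteq> fc i z"
    "\<And>j. j \<in> {-1..n} \<Longrightarrow> j \<noteq> i \<Longrightarrow> fc j (r i \<otimes> z) = fc j z"
proof -
  have ri: "r i \<in> span N" using span_gen[of i N] i by auto
  show z': "r i \<otimes> z \<in> span N" using move_coset(1)[OF z ri] .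
  show "fc i (r i \<otimes> z) \<noteq> fc i z"
  proof
    assume "fc i (r i \<otimes> z) = fc i z"
    then have "r i \<otimes> z \<otimes> inv z \<in> span (N - {i})" using fc_eq_iff[OF z z', of i] i by auto
    then show False using move_coset(2)[OF z ri] generator_notin[OF i] by auto
  qed
  show "fc j (r i \<otimes> z) = fc j z" if "j \<in> {-1..n}" "j \<noteq> i" for j
    using fc_mult_eq[OF z ri _ that(1)] span_gen[of i "N - {j}"] i that by auto
qed

lemma adjacent_generator:
  "z \<in> span N \<Longrightarrow> i \<in> N \<Longrightarrow> adjacent (flag_of z) (flag_of (r i \<otimes> z))"
  using generator_moves[of z i] by (intro adjacent_flag_of[where i = i]) auto

text \<open>The flags of the coset poset are faithfully indexed by the group.\<close>
lemma fc_all_eq: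
  assumes x: "x \<in> span N" and y: "y \<in> span N" and eq: "\<And>j. j \<in> N \<Longrightarrow> fc j x = fc j y"
  shows "x = y"
proof -
  have "y \<otimes> inv x = \<one>"
  proof (rule separated_span)
    show "y \<otimes> inv x \<in> span N" using x y span_mult[of N] span_inv[of N] by auto
    show "y \<otimes> inv x \<in> span (N - {j})" if "j \<in> N" for j using fc_eq_iff[OF x y, of j] eq that by auto
  qed
  then show ?thesis using x y spanN_carrier by (metis inv_closed inv_equality inv_inv r_inv)
qed

text \<open>An element that preserves the faces of ranks \<open>j - 1\<close> and \<open>j + 1\<close> is a word without these indices. Its
  letters below \<open>j - 1\<close> and above \<open>j + 1\<close> preserve the face of rank \<open>j\<close>, and what is left is \<open>\<one>\<close> or \<open>r j\<close>.\<close>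
lemma diamond_of_intersection_property:
  assumes ip: "intersection_property G r N" and j: "j \<in> N" and x: "x \<in> span N"
  shows "{fc j y | y. y \<in> span N \<and> fc (j-1) y = fc (j-1) x \<and> fc (j+1) y = fc (j+1) x} =
    {fc j x, fc j (r j \<otimes> x)}" (is "?L = ?R")
proof
  show "?R \<subseteq> ?L" using generator_moves[OF x j] x j by fastforce
  show "?L \<subseteq> ?R"
  proof
    fix F assume "F \<in> ?L"
    then obtain y where y: "F = fc j y" "y \<in> span N" "fc (j-1) y = fc (j-1) x" "fc (j+1) y = fc (j+1) x"
      by auto
    define g where "g = y \<otimes> inv x"
    have gN: "g \<in> span N" unfolding g_def using x y span_mult[of N] span_inv[of N] by auto
    have gx: "y = g \<otimes> x" unfolding g_def using x y spanN_carrier by (simp add: m_assoc)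
    have "g \<in> span (N - {j-1})" "g \<in> span (N - {j+1})" unfolding g_def
      using fc_eq_iff[OF x y(2), of "j-1"] fc_eq_iff[OF x y(2), of "j+1"] y j by auto
    moreover have "(N - {j-1}) \<inter> (N - {j+1}) = N - {j-1, j+1}" by auto
    moreover have "span (N - {j-1}) \<inter> span (N - {j+1}) \<subseteq> span ((N - {j-1}) \<inter> (N - {j+1}))"
      using ip unfolding intersection_property_iff[OF subset_refl] by (meson Diff_subset)
    ultimately have g: "g \<in> span (N - {j-1, j+1})" by auto
    obtain a b where a: "a \<in> span ((N - {j-1, j+1}) \<inter> {..<j+1})"
      and b: "b \<in> span ((N - {j-1, j+1}) \<inter> {j+1<..})" and gab: "g = b \<otimes> a"
      using span_split[OF _ _ g, of "j+1"] by blast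
    obtain c d where c: "c \<in> span ((N - {j-1, j+1}) \<inter> {..<j+1} \<inter> {..<j-1})"
      and d: "d \<in> span ((N - {j-1, j+1}) \<inter> {..<j+1} \<inter> {j-1<..})" and acd: "a = c \<otimes> d"
      using span_split[OF _ _ a, of "j-1"] by blast
    have bN: "b \<in> span N" by (rule span_weaken[OF b]) auto
    have cN: "c \<in> span N" by (rule span_weaken[OF c]) auto
    have bj: "b \<in> span (N - {j})" by (rule span_weaken[OF b]) auto
    have cj: "c \<in> span (N - {j})" by (rule span_weaken[OF c]) auto
    have d': "d \<in> span {j}" by (rule span_weaken[OF d]) auto
    have dc: "d = \<one> \<or> d = r j"
    proof -
      have "wd w = \<one> \<or> wd w = r j" if "set w \<subseteq> {j}" for w
        using that by (induction w) (auto simp: closed[OF j] invol[OF j])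
      then show ?thesis using d' by (auto simp: span_def)
    qed
    then have dN: "d \<in> span N" using one_span span_gen[of j N] j by auto
    have dx: "d \<otimes> x \<in> span N" using move_coset(1)[OF x dN] .
    have "y = b \<otimes> (c \<otimes> (d \<otimes> x))" unfolding gx gab acd
      using bN cN dN x spanN_carrier by (simp add: m_assoc)
    moreover have "fc j (c \<otimes> (d \<otimes> x)) = fc j (d \<otimes> x)" using fc_mult_eq[OF dx cN cj] j by auto
    moreover have "fc j (b \<otimes> (c \<otimes> (d \<otimes> x))) = fc j (c \<otimes> (d \<otimes> x))"
      using fc_mult_eq[OF move_coset(1)[OF dx cN] bN bj] j by auto
    ultimately have "fc j y = fc j (d \<otimes> x)" by simp
    then show "F \<in> ?R" using dc y x spanN_carrier by auto
  qed
qed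


text \<open>Reading a word letter by letter gives a chain of adjacent flags; \<open>D\<close> consists of faces that no letter
  of the word can move.\<close>
lemma flag_walk:
  assumes x: "x \<in> span N" and w: "set w \<subseteq> N - S"
    and D: "D \<subseteq> (\<lambda>i. fc i x) ` ({-1..n} - (N - S))"
  shows "(flag_of x, flag_of (wd w \<otimes> x)) \<in>
    (flag_adjacency_above face_poset D)\<^sup>*"
  using w
proof (induction w)
  case Nil
  then show ?case using x spanN_carrier by simp
next
  case (Cons i w)
  have stay: "D \<subseteq> flag_of (wd v \<otimes> x)" if v: "set v \<subseteq> N - S" for v
  proof
    fix F assume "F \<in> D"
    then obtain k where k: "F = fc k x" "k \<in> {-1..n}" "k \<notin> N - S" using D by blast
    have "wd v \<in> span N" "wd v \<in> span (N - {k})" using v k by (auto intro!: span_wordI)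
    then have "F = fc k (wd v \<otimes> x)" using fc_mult_eq[OF x] k by auto
    then show "F \<in> flag_of (wd v \<otimes> x)" using k by (auto simp: flag_of_def)
  qed
  let ?z = "wd w \<otimes> x"
  have z: "?z \<in> span N" using Cons.prems by (intro move_coset(1)[OF x] span_wordI) auto
  have i: "i \<in> N" using Cons.prems by auto
  have iz: "wd (i # w) \<otimes> x = r i \<otimes> ?z"
    using closed[OF i] spanN_carrier[OF x] word_carrier[OF _ _, of "N - S" w] Cons.prems
    by (simp add: m_assoc)
  have "adjacent (flag_of ?z) (flag_of (r i \<otimes> ?z))" using adjacent_generator[OF z i] .
  moreover have "D \<subseteq> flag_of ?z" "D \<subseteq> flag_of (r i \<otimes> ?z)"
    using stay[of w] stay[of "i # w"] Cons.prems unfolding iz by auto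
  moreover have "r i \<otimes> ?z \<in> span N" using generator_moves(1)[OF z i] .
  ultimately have "(flag_of ?z, flag_of (r i \<otimes> ?z)) \<in>
    flag_adjacency_above face_poset D"
    using z flags_face_poset by auto
  then show ?case unfolding iz using Cons by (auto intro: rtrancl.rtrancl_into_rtrancl)
qed

text \<open>By the diamond condition there is only one \<open>i\<close>-adjacent flag, and \<open>r i\<close> leads to one.\<close>
lemma adjacent_flag_is_generator:
  assumes poly: "polytope n face_poset" and z: "z \<in> span N" and y: "y \<in> span N"
    and adj: "adjacent (flag_of z) (flag_of y)"
  shows "\<exists>i \<in> N. y = r i \<otimes> z \<and> fc i z \<notin> flag_of y"
proof -
  obtain F where F: "flag_of z - flag_of y = {F}" using adj by (auto simp: adjacent_def)
  then have "F \<in> flag_of z" by auto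
  then obtain i where i: "i \<in> {-1..n}" "F = fc i z" by (auto simp: flag_of_def)
  have other: "fc j z = fc j y" if j: "j \<in> {-1..n}" "j \<noteq> i" for j
  proof -
    have "fc j z \<noteq> F" using j i fc_graded by blast
    moreover have "fc j z \<in> flag_of z" using j by (auto simp: flag_of_def)
    ultimately have "fc j z \<in> flag_of y" using F by blast
    then show ?thesis using in_flag_of_iff[OF y z j(1)] by auto
  qed
  have niy: "fc i z \<notin> flag_of y" using F i by auto
  have ne: "fc i y \<noteq> fc i z" using niy in_flag_of_iff[OF y z i(1)] by auto
  then have iN: "i \<in> N" using bot[OF y z] top[OF y z] i by (cases "i = -1 \<or> i = n") auto
  let ?D = "{fc i u | u. u \<in> span N \<and> fc (i-1) u = fc (i-1) z \<and> fc (i+1) u = fc (i+1) z}"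
  have "card ?D = 2" using poly iN z unfolding polytope_face_poset_iff by blast
  moreover have "fc i z \<in> ?D" using z by auto
  moreover have "fc i (r i \<otimes> z) \<in> ?D" using generator_moves[OF z iN] iN by fastforce
  moreover have "fc i y \<in> ?D" using other[of "i-1"] other[of "i+1"] y iN by fastforce
  ultimately have "fc i y = fc i (r i \<otimes> z)"
    using ne generator_moves(2)[OF z iN] unfolding card_2_iff by (metis insertE singletonD)
  moreover have "fc j y = fc j (r i \<otimes> z)" if "j \<in> N" "j \<noteq> i" for j
    using other[of j] generator_moves(3)[OF z iN, of j] that by auto
  ultimately have "y = r i \<otimes> z" using fc_all_eq[OF y generator_moves(1)[OF z iN]] by metis
  then show ?thesis using iN niy by blast
qed

theorem polytope_coset_poset_iff:
  "polytope n (coset_poset n R rot) \<longleftrightarrow> intersection_property G r N"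
  unfolding coset_poset_eq_face_poset
proof
  assume ip: "intersection_property G r N"
  have "strongly_flag_connected face_poset" unfolding strongly_flag_connected_def
  proof (intro ballI)
    fix A B assume "A \<in> flags face_poset" "B \<in> flags face_poset"
    then obtain x y where x: "x \<in> span N" "A = flag_of x" and y: "y \<in> span N" "B = flag_of y"
      unfolding flags_face_poset by auto
    define S where "S = {j \<in> N. fc j x = fc j y}"
    define g where "g = y \<otimes> inv x"
    have gN: "g \<in> span N" unfolding g_def using x y span_mult[of N] span_inv[of N] by auto
    have gx: "y = g \<otimes> x" unfolding g_def using x y spanN_carrier by (simp add: m_assoc)
    have "g \<in> span (N - {j})" if "j \<in> S" for j
      using that fc_eq_iff[OF x(1) y(1), of j] unfolding S_def g_def by auto
    then have "g \<in> span (N - S)"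
      using ip[unfolded intersection_property_N_iff, rule_format, of S g] gN S_def by blast
    then obtain w where w: "g = wd w" "set w \<subseteq> N - S" by (auto simp: span_def)
    have "A \<inter> B \<subseteq> (\<lambda>i. fc i x) ` ({-1..n} - (N - S))"
    proof
      fix F assume F: "F \<in> A \<inter> B"
      then obtain i where i: "F = fc i x" "i \<in> {-1..n}" using x by (auto simp: flag_of_def)
      then have "fc i x = fc i y" using F y in_flag_of_iff[OF y(1) x(1) i(2)] by auto
      then have "i \<in> {-1..n} - (N - S)" using i by (auto simp: S_def)
      then show "F \<in> (\<lambda>i. fc i x) ` ({-1..n} - (N - S))" using i(1) by blast
    qed
    from flag_walk[OF x(1) w(2) this]
    show "(A, B) \<in> (flag_adjacency_above face_poset (A \<inter> B))\<^sup>*"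
      using x(2) y(2) gx w(1) by simp
  qed
  moreover have "card {fc j y | y. y \<in> span N \<and> fc (j-1) y = fc (j-1) x \<and> fc (j+1) y = fc (j+1) x} = 2"
    if j: "j \<in> N" and x: "x \<in> span N" for j x
    unfolding diamond_of_intersection_property[OF ip j x] using generator_moves(2)[OF x j] by simp
  ultimately show "polytope n face_poset" unfolding polytope_face_poset_iff by blast
next
  assume poly: "polytope n face_poset"
  show "intersection_property G r N" unfolding intersection_property_N_iff
  proof (intro allI impI)
    fix S g assume S: "S \<subseteq> N \<and> g \<in> span N \<and> (\<forall>j \<in> S. g \<in> span (N - {j}))"
    then have g: "g \<in> span N" by auto
    have one: "\<one> \<in> span N" by (rule one_span)
    let ?A = "flag_of \<one>" and ?B = "flag_of g"
    have shared: "fc j \<one> \<in> ?A \<inter> ?B" if j: "j \<in> S" for j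
    proof -
      have jn: "j \<in> {-1..n}" using j S by auto
      have "g \<otimes> inv \<one> \<in> span (N - {j})" using S j spanN_carrier[OF g] by auto
      then have "fc j \<one> = fc j g" using fc_eq_iff[OF one g jn] by auto
      then show ?thesis using in_flag_of_iff[OF one one jn] in_flag_of_iff[OF g one jn] by auto
    qed
    have "(?A, ?B) \<in> (flag_adjacency_above face_poset (?A \<inter> ?B))\<^sup>*"
      using poly one g unfolding polytope_def strongly_flag_connected_def flags_face_poset by blast
    then have "\<exists>w. set w \<subseteq> N - S \<and> ?B = flag_of (wd w)"
    proof (induction rule: rtrancl_induct)
      case base
      show ?case by (intro exI[of _ "[]"]) auto
    next
      case (step Y Y')
      then obtain w where w: "set w \<subseteq> N - S" "Y = flag_of (wd w)" by auto
      have z: "wd w \<in> span N" using w by (auto intro: span_wordI)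
      obtain y where y: "y \<in> span N" "Y' = flag_of y" using step(2) flags_face_poset by auto
      obtain i where i: "i \<in> N" "y = r i \<otimes> wd w" "fc i (wd w) \<notin> Y'"
        using adjacent_flag_is_generator[OF poly z y(1)] step(2) w y by auto
      have "i \<notin> S"
      proof
        assume iS: "i \<in> S"
        then have "fc i \<one> \<in> flag_of (wd w)" "fc i \<one> \<in> Y'" using shared[OF iS] step(2) w by auto
        then show False using in_flag_of_iff[OF z one, of i] i by auto
      qed
      then show ?case using w i y by (intro exI[of _ "i # w"]) auto
    qed
    then obtain w where w: "set w \<subseteq> N - S" "?B = flag_of (wd w)" by auto
    have z: "wd w \<in> span N" using w by (auto intro: span_wordI)
    have "g = wd w" using w(2) fc_all_eq[OF g z] flag_of_subset[OF g z] by auto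
    then show "g \<in> span (N - S)" using w by (auto intro: span_wordI)
  qed
qed

end

section \<open>Isomorphisms of posets\<close>

lemma Chains_subset_Field: "C \<in> Chains P \<Longrightarrow> C \<subseteq> Field P"
  by (auto simp: Chains_def Field_def)

lemma flags_subset_Field: "A \<in> flags P \<Longrightarrow> A \<subseteq> Field P"
  using Chains_subset_Field by (auto simp: flags_def)

lemma is_isomorphism_inv:
  assumes f: "is_isomorphism P Q f"
  shows "is_isomorphism Q P (inv_into (Field P) f)"
proof -
  have b: "bij_betw f (Field P) (Field Q)" using f by (auto simp: is_isomorphism_def)
  have "(x, y) \<in> Q \<longleftrightarrow> (inv_into (Field P) f x, inv_into (Field P) f y) \<in> P"
    if "x \<in> Field Q" "y \<in> Field Q" for x y
  proof -
    have "inv_into (Field P) f x \<in> Field P" "inv_into (Field P) f y \<in> Field P"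
      using b that by (auto simp: bij_betw_def inv_into_into)
    then have "(inv_into (Field P) f x, inv_into (Field P) f y) \<in> P \<longleftrightarrow>
      (f (inv_into (Field P) f x), f (inv_into (Field P) f y)) \<in> Q"
      using f by (auto simp: is_isomorphism_def)
    then show ?thesis using bij_betw_inv_into_right[OF b] that by simp
  qed
  then show ?thesis using bij_betw_inv_into[OF b] by (auto simp: is_isomorphism_def)
qed

lemma is_isomorphism_comp:
  assumes "is_isomorphism P Q f" "is_isomorphism Q R g"
  shows "is_isomorphism P R (g \<circ> f)"
proof -
  have f: "bij_betw f (Field P) (Field Q)" and g: "bij_betw g (Field Q) (Field R)"
    using assms by (auto simp: is_isomorphism_def)
  have "(F, G) \<in> P \<longleftrightarrow> ((g \<circ> f) F, (g \<circ> f) G) \<in> R" if "F \<in> Field P" "G \<in> Field P" for F G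
    using assms that bij_betw_apply[OF f] by (auto simp: is_isomorphism_def)
  then show ?thesis using bij_betw_trans[OF f g] by (auto simp: is_isomorphism_def)
qed

lemma is_isomorphism_cong:
  assumes "is_isomorphism P Q f" "\<And>x. x \<in> Field P \<Longrightarrow> f x = g x"
  shows "is_isomorphism P Q g"
  using assms bij_betw_cong[of "Field P" f g "Field Q"] unfolding is_isomorphism_def by auto

lemma image_chain_iff:
  assumes f: "is_isomorphism P Q f" and C: "C \<subseteq> Field P"
  shows "f ` C \<in> Chains Q \<longleftrightarrow> C \<in> Chains P"
proof -
  have *: "(x, y) \<in> P \<longleftrightarrow> (f x, f y) \<in> Q" if "x \<in> C" "y \<in> C" for x y
    using that f C by (auto simp: is_isomorphism_def)
  show ?thesis unfolding Chains_def using * by auto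
qed

lemma image_inv_image:
  assumes f: "is_isomorphism P Q f"
  shows "C \<subseteq> Field P \<Longrightarrow> inv_into (Field P) f ` (f ` C) = C"
    and "D \<subseteq> Field Q \<Longrightarrow> f ` (inv_into (Field P) f ` D) = D"
proof -
  have "bij_betw f (Field P) (Field Q)" using f by (auto simp: is_isomorphism_def)
  then show "C \<subseteq> Field P \<Longrightarrow> inv_into (Field P) f ` (f ` C) = C"
    and "D \<subseteq> Field Q \<Longrightarrow> f ` (inv_into (Field P) f ` D) = D"
    by (simp_all add: bij_betw_def inv_into_image_cancel image_inv_into_cancel)
qed

lemma image_subset_Field:
  assumes f: "is_isomorphism P Q f" and C: "C \<subseteq> Field P"
  shows "f ` C \<subseteq> Field Q"
  using assms by (auto simp: is_isomorphism_def bij_betw_def)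

lemma inj_on_isomorphism: "is_isomorphism P Q f \<Longrightarrow> inj_on f (Field P)"
  by (auto simp: is_isomorphism_def bij_betw_def)

lemma face_rank_image:
  assumes f: "is_isomorphism P Q f" and F: "F \<in> Field P"
  shows "face_rank Q (f F) = face_rank P F"
proof -
  let ?S = "{C \<in> Chains P. \<forall>G \<in> C. (G, F) \<in> P}" and ?T = "{C \<in> Chains Q. \<forall>G \<in> C. (G, f F) \<in> Q}"
  have inj: "inj_on f (Field P)" using inj_on_isomorphism f .
  have below: "(\<forall>G \<in> f ` C. (G, f F) \<in> Q) \<longleftrightarrow> (\<forall>G \<in> C. (G, F) \<in> P)" if "C \<subseteq> Field P" for C
    using that f F by (auto simp: is_isomorphism_def)
  have "?T = (`) f ` ?S"
  proof
    show "?T \<subseteq> (`) f ` ?S"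
    proof
      fix D assume D: "D \<in> ?T"
      define C where "C = inv_into (Field P) f ` D"
      have DQ: "D \<subseteq> Field Q" using D Chains_subset_Field by auto
      then have C: "C \<subseteq> Field P" "f ` C = D"
        unfolding C_def using image_subset_Field[OF is_isomorphism_inv[OF f]] image_inv_image[OF f]
          by auto
      then have "C \<in> ?S" using D below[OF C(1)] image_chain_iff[OF f C(1)] by auto
      then show "D \<in> (`) f ` ?S" using C by auto
    qed
    show "(`) f ` ?S \<subseteq> ?T"
    proof
      fix D assume "D \<in> (`) f ` ?S"
      then obtain C where C: "D = f ` C" "C \<in> ?S" by auto
      then have "C \<subseteq> Field P" using Chains_subset_Field by auto
      then show "D \<in> ?T" using C below image_chain_iff[OF f] by auto
    qed
  qed
  then have "card ` ?T = card ` ?S"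
  proof -
    have "card (f ` C) = card C" if "C \<in> ?S" for C
      using that inj Chains_subset_Field by (intro card_image) (auto intro: inj_on_subset)
    then have "card ` (`) f ` ?S = card ` ?S" unfolding image_image by (rule image_cong[OF refl])
    then show ?thesis using \<open>?T = (`) f ` ?S\<close> by simp
  qed
  then show ?thesis by (simp add: face_rank_def)
qed

lemma flag_image:
  assumes f: "is_isomorphism P Q f" and A: "A \<in> flags P"
  shows "f ` A \<in> flags Q"
  unfolding flags_def
proof (intro CollectI conjI ballI impI)
  have AP: "A \<subseteq> Field P" using flags_subset_Field[OF A] .
  show "f ` A \<in> Chains Q" using image_chain_iff[OF f AP] A by (auto simp: flags_def)
  fix D assume D: "D \<in> Chains Q" "f ` A \<subseteq> D"
  define C where "C = inv_into (Field P) f ` D"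
  have DQ: "D \<subseteq> Field Q" using Chains_subset_Field[OF D(1)] .
  then have C: "C \<subseteq> Field P" "f ` C = D"
    unfolding C_def using image_subset_Field[OF is_isomorphism_inv[OF f]] image_inv_image[OF f]
      by auto
  have "inv_into (Field P) f ` (f ` A) \<subseteq> C" unfolding C_def using D(2) by (rule image_mono)
  then have "A \<subseteq> C" using image_inv_image(1)[OF f AP] by simp
  moreover have "C \<in> Chains P" using image_chain_iff[OF f C(1)] C D by auto
  ultimately have "C = A" using A by (auto simp: flags_def)
  then show "D = f ` A" using C by auto
qed

lemma adjacent_at_image:
  assumes f: "is_isomorphism P Q f" and "A \<subseteq> Field P" "B \<subseteq> Field P" "adjacent_at P i A B"
  shows "adjacent_at Q i (f ` A) (f ` B)"
proof -
  obtain F G where FG: "F \<in> faces P i" "G \<in> faces P i" "A - B = {F}" "B - A = {G}"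
    using assms(4) by (auto simp: adjacent_at_def)
  have "f H \<in> faces Q i" if H: "H \<in> faces P i" for H
    using face_rank_image[OF f, of H] image_subset_Field[OF f, of "{H}"] H by (auto simp: faces_def)
  moreover have "f ` A - f ` B = {f F}" "f ` B - f ` A = {f G}"
  proof -
    have "f ` A - f ` B = f ` (A - B)" "f ` B - f ` A = f ` (B - A)"
      by (rule inj_on_image_set_diff[OF inj_on_isomorphism[OF f], symmetric]; use assms in auto)+
    then show "f ` A - f ` B = {f F}" "f ` B - f ` A = {f G}" using FG by simp_all
  qed
  ultimately show ?thesis using FG unfolding adjacent_at_def by blast
qed

section \<open>Automorphism groups\<close>

lemma aut_iff: "f \<in> carrier (aut_group P) \<longleftrightarrow> f \<in> extensional (Field P) \<and> is_isomorphism P P f"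
  by (auto simp: aut_group_def Bij_def is_isomorphism_def)

lemma aut_iso: "f \<in> carrier (aut_group P) \<Longrightarrow> is_isomorphism P P f"
  by (simp add: aut_iff)

lemma aut_mult_apply:
  assumes "f \<in> carrier (aut_group P)" "g \<in> carrier (aut_group P)" "x \<in> Field P"
  shows "(f \<otimes>\<^bsub>aut_group P\<^esub> g) x = f (g x)"
  using assms by (auto simp: aut_group_def BijGroup_def compose_def)

lemma aut_one_apply: "x \<in> Field P \<Longrightarrow> \<one>\<^bsub>aut_group P\<^esub> x = x"
  by (simp add: aut_group_def BijGroup_def)

lemma group_aut_group: "group (aut_group P)"
proof -
  interpret B: group "BijGroup (Field P)" by (rule group_BijGroup)
  let ?H = "{f \<in> Bij (Field P). is_isomorphism P P f}"
  have "subgroup ?H (BijGroup (Field P))"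
  proof (rule B.subgroupI)
    show "?H \<subseteq> carrier (BijGroup (Field P))" by (auto simp: BijGroup_def)
    have "(\<lambda>x \<in> Field P. x) \<in> ?H" using id_Bij by (auto simp: is_isomorphism_def Bij_def)
    then show "?H \<noteq> {}" by auto
    fix f assume f: "f \<in> ?H"
    then have "inv\<^bsub>BijGroup (Field P)\<^esub> f = (\<lambda>x \<in> Field P. inv_into (Field P) f x)"
      by (simp add: inv_BijGroup)
    moreover have "is_isomorphism P P (\<lambda>x \<in> Field P. inv_into (Field P) f x)"
      by (rule is_isomorphism_cong[OF is_isomorphism_inv[of P P f]]) (use f in auto)
    ultimately show "inv\<^bsub>BijGroup (Field P)\<^esub> f \<in> ?H" using f restrict_inv_into_Bij by auto
    fix g assume g: "g \<in> ?H"
    have "is_isomorphism P P (compose (Field P) f g)"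
      by (rule is_isomorphism_cong[OF is_isomorphism_comp[of P P g P f]]) (use f g in \<open>auto simp: compose_def\<close>)
    then show "f \<otimes>\<^bsub>BijGroup (Field P)\<^esub> g \<in> ?H" using f g compose_Bij by (auto simp: BijGroup_def)
  qed
  then show ?thesis unfolding aut_group_def
    by (rule subgroup.subgroup_is_group) (rule group_BijGroup)
qed

lemma aut_eqI:
  assumes "f \<in> carrier (aut_group P)" "g \<in> carrier (aut_group P)" "\<And>x. x \<in> Field P \<Longrightarrow> f x = g x"
  shows "f = g"
  using assms by (auto simp: aut_iff intro: extensionalityI)

section \<open>Rigidity\<close>

text \<open>A consequence of the definition of a polytope that suffices to determine automorphisms by their effect on
  one flag, and that is easily passed on to sections and to isomorphic posets.\<close>
definition thin_connected :: "'a rel \<Rightarrow> bool" where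
  "thin_connected P \<longleftrightarrow>
     Field P \<subseteq> \<Union> (flags P) \<and> (\<forall>A \<in> flags P. inj_on (face_rank P) A) \<and>
     (\<forall>A \<in> flags P. \<forall>B \<in> flags P. \<forall>C \<in> flags P. \<forall>i. adjacent_at P i A B \<and> adjacent_at P i A C \<longrightarrow> B = C) \<and>
     (\<forall>A \<in> flags P. \<forall>B \<in> flags P.
        (A, B) \<in> (flag_adjacency P)\<^sup>*)"

lemma thin_connectedD:
  assumes "thin_connected P"
  shows "x \<in> Field P \<Longrightarrow> \<exists>A \<in> flags P. x \<in> A"
    and "A \<in> flags P \<Longrightarrow> inj_on (face_rank P) A"
    and "\<lbrakk>A \<in> flags P; B \<in> flags P; C \<in> flags P; adjacent_at P i A B; adjacent_at P i A C\<rbrakk> \<Longrightarrow> B = C"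
    and "\<lbrakk>A \<in> flags P; B \<in> flags P\<rbrakk> \<Longrightarrow>
      (A, B) \<in> (flag_adjacency P)\<^sup>*"
  using assms unfolding thin_connected_def
    by (auto simp only: subset_iff Union_iff Ball_def Bex_def)

text \<open>Agreement spreads from a flag to its adjacent flags, as these are determined by the position
  at which they differ.\<close>
lemma automorphisms_agreeing_on_flag:
  assumes P: "thin_connected P" and \<Phi>: "\<Phi> \<in> flags P"
    and f: "f \<in> carrier (aut_group P)" and g: "g \<in> carrier (aut_group P)" and eq: "f ` \<Phi> = g ` \<Phi>"
  shows "f = g"
proof (rule aut_eqI[OF f g])
  have all: "f ` B = g ` B" if B: "B \<in> flags P" for B
  proof -
    have "(\<Phi>, B) \<in> (flag_adjacency P)\<^sup>*"
      by (rule thin_connectedD(4)[OF P \<Phi> B])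
    then show ?thesis
    proof (induction rule: rtrancl_induct)
      case base then show ?case using eq .
    next
      case (step Y Z)
      then obtain i where YZ: "Y \<in> flags P" "Z \<in> flags P" "adjacent_at P i Y Z" by auto
      then have "adjacent_at P i (f ` Y) (f ` Z)" "adjacent_at P i (g ` Y) (g ` Z)"
        using adjacent_at_image aut_iso f g flags_subset_Field by metis+
      moreover have "f ` Y \<in> flags P" "f ` Z \<in> flags P" "g ` Z \<in> flags P"
        using YZ f g flag_image aut_iso by metis+
      ultimately show ?case
        using step(3) thin_connectedD(3)[OF P, of "f ` Y" "f ` Z" "g ` Z" i] by simp
    qed
  qed
  fix x assume x: "x \<in> Field P"
  then obtain B where B: "B \<in> flags P" "x \<in> B" using thin_connectedD(1)[OF P] by blast
  have "f x \<in> f ` B" "g x \<in> f ` B" using B all[OF B(1)] by auto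
  moreover have "face_rank P (f x) = face_rank P (g x)"
    using face_rank_image[OF aut_iso] f g x by metis
  moreover have "inj_on (face_rank P) (f ` B)"
    using thin_connectedD(2)[OF P flag_image[OF aut_iso[OF f] B(1)]] .
  ultimately show "f x = g x" by (auto dest: inj_onD)
qed

lemma rho_eqI:
  assumes P: "thin_connected P" and \<Phi>: "\<Phi> \<in> flags P" and f: "f \<in> carrier (aut_group P)"
    and adj: "adjacent_at P i \<Phi> (f ` \<Phi>)"
  shows "rho P \<Phi> i = f"
  unfolding rho_def
proof (rule the_equality)
  fix g assume g: "g \<in> carrier (aut_group P) \<and> adjacent_at P i \<Phi> (g ` \<Phi>)"
  then have "g ` \<Phi> \<in> flags P" "f ` \<Phi> \<in> flags P" using f flag_image aut_iso \<Phi> by metis+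
  then have "g ` \<Phi> = f ` \<Phi>" using thin_connectedD(3)[OF P \<Phi>] g adj by blast
  then show "g = f" using automorphisms_agreeing_on_flag[OF P \<Phi>] f g by blast
qed (use f adj in simp)

lemma thin_connected_isomorphic:
  assumes P: "thin_connected P" and f: "is_isomorphism P Q f"
  shows "thin_connected Q"
proof -
  let ?h = "inv_into (Field P) f"
  have h: "is_isomorphism Q P ?h" using is_isomorphism_inv[OF f] .
  have fh: "B = f ` (?h ` B)" if "B \<in> flags Q" for B
    using image_inv_image(2)[OF f] flags_subset_Field[OF that] by auto
  have hf: "?h ` B \<in> flags P" if "B \<in> flags Q" for B using flag_image[OF h that] .
  have fl: "A \<subseteq> Field Q" if "A \<in> flags Q" for A using flags_subset_Field that .
  show ?thesis unfolding thin_connected_def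
  proof (intro conjI ballI allI impI)
    show "Field Q \<subseteq> \<Union> (flags Q)"
    proof
      fix y assume y: "y \<in> Field Q"
      then have "?h y \<in> Field P" using image_subset_Field[OF h, of "{y}"] by auto
      then obtain A where "A \<in> flags P" "?h y \<in> A" using thin_connectedD(1)[OF P] by blast
      moreover have "f (?h y) = y"
        using y f by (auto simp: is_isomorphism_def bij_betw_inv_into_right)
      ultimately show "y \<in> \<Union> (flags Q)" using flag_image[OF f, of A] by (metis UnionI imageI)
    qed
    fix A assume A: "A \<in> flags Q"
    show "inj_on (face_rank Q) A"
    proof (rule inj_onI)
      fix x y assume xy: "x \<in> A" "y \<in> A" "face_rank Q x = face_rank Q y"
      then have xyQ: "x \<in> Field Q" "y \<in> Field Q" using fl[OF A] by auto
      then have "face_rank P (?h x) = face_rank P (?h y)" using xy face_rank_image[OF h] by auto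
      moreover have "inj_on (face_rank P) (?h ` A)" using thin_connectedD(2)[OF P hf[OF A]] .
      ultimately have "?h x = ?h y" using xy by (auto dest: inj_onD)
      then show "x = y" using xyQ inj_on_isomorphism[OF h] by (auto dest: inj_onD)
    qed
    fix B assume B: "B \<in> flags Q"
    {
      fix C i assume C: "C \<in> flags Q" "adjacent_at Q i A B \<and> adjacent_at Q i A C"
      then have "adjacent_at P i (?h ` A) (?h ` B)" "adjacent_at P i (?h ` A) (?h ` C)"
        using adjacent_at_image[OF h] fl A B by auto
      then have "?h ` B = ?h ` C" by (rule thin_connectedD(3)[OF P hf[OF A] hf[OF B] hf[OF C(1)]])
      then show "B = C" using fh[OF B] fh[OF C(1)] by simp
    }
    have "(?h ` A, ?h ` B) \<in> (flag_adjacency P)\<^sup>*"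
      by (rule thin_connectedD(4)[OF P hf[OF A] hf[OF B]])
    then have "(f ` (?h ` A), f ` (?h ` B)) \<in> (flag_adjacency Q)\<^sup>*"
    proof (induction rule: rtrancl_induct)
      case (step Y Z)
      then obtain i where YZ: "Y \<in> flags P" "Z \<in> flags P" "adjacent_at P i Y Z" by auto
      then have "adjacent_at Q i (f ` Y) (f ` Z)"
        using adjacent_at_image[OF f flags_subset_Field flags_subset_Field] by blast
      then have "(f ` Y, f ` Z) \<in> flag_adjacency Q"
        using flag_image[OF f YZ(1)] flag_image[OF f YZ(2)] by blast
      then show ?case using step(3) by (rule rtrancl_into_rtrancl[rotated])
    qed simp
    then show "(A, B) \<in> (flag_adjacency Q)\<^sup>*"
      using fh[OF A] fh[OF B] by simp
  qed
qed

section \<open>Flags of a polytope\<close>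

definition face_at :: "'a rel \<Rightarrow> 'a set \<Rightarrow> int \<Rightarrow> 'a" where
  "face_at P A i = (THE F. F \<in> A \<and> face_rank P F = i)"

locale abstract_polytope =
  fixes n :: int and P :: "'a rel"
  assumes polytope: "polytope n P"
begin

lemma order_refl: "F \<in> Field P \<Longrightarrow> (F, F) \<in> P"
  using polytope by (auto simp: polytope_def order_on_defs refl_on_def)

lemma order_transitive: "(F, G) \<in> P \<Longrightarrow> (G, H) \<in> P \<Longrightarrow> (F, H) \<in> P"
  using polytope by (auto simp: polytope_def order_on_defs dest: transD)

lemma rank_strict: "(F, G) \<in> P \<Longrightarrow> F \<noteq> G \<Longrightarrow> face_rank P F < face_rank P G"
  using polytope by (auto simp: polytope_def ranked_def)

lemma rank_mono: "(F, G) \<in> P \<Longrightarrow> face_rank P F \<le> face_rank P G"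
  using rank_strict by (cases "F = G") force+

lemma rank_range: "F \<in> Field P \<Longrightarrow> face_rank P F \<in> {-1..n}"
  using polytope by (auto simp: polytope_def ranked_def)

lemma inj_on_rank: "C \<in> Chains P \<Longrightarrow> inj_on (face_rank P) C"
  using rank_strict unfolding inj_on_def Chains_def by fastforce

lemma chain_bound: "C \<in> Chains P \<Longrightarrow> finite C \<and> card C \<le> nat (n + 2)"
proof -
  assume C: "C \<in> Chains P"
  have sub: "face_rank P ` C \<subseteq> {-1..n}" using rank_range Chains_subset_Field[OF C] by auto
  then have "finite C" using inj_on_rank[OF C] finite_subset[OF sub] finite_image_iff by auto
  moreover have "card C = card (face_rank P ` C)" using inj_on_rank[OF C] by (simp add: card_image)
  moreover have "card (face_rank P ` C) \<le> card {-1..n}" using sub by (intro card_mono) auto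
  ultimately show ?thesis by simp
qed

lemma flagD: "A \<in> flags P \<Longrightarrow> A \<in> Chains P"
  by (simp add: flags_def)

lemma chain_extends:
  assumes C: "C \<in> Chains P"
  shows "\<exists>A \<in> flags P. C \<subseteq> A"
proof -
  have "\<forall>D. D \<in> Chains P \<and> C \<subseteq> D \<longrightarrow> card D \<le> nat (n + 2)" using chain_bound by auto
  then obtain D where D: "D \<in> Chains P" "C \<subseteq> D" "\<And>E. E \<in> Chains P \<and> C \<subseteq> E \<Longrightarrow> card E \<le> card D"
    using ex_has_greatest_nat[of "\<lambda>D. D \<in> Chains P \<and> C \<subseteq> D" C card "nat (n + 2) + 1"] C
    by (metis (no_types, lifting) subset_refl less_Suc_eq_le Suc_eq_plus1)
  have "D \<in> flags P" unfolding flags_def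
  proof (intro CollectI conjI ballI impI)
    fix E assume E: "E \<in> Chains P" "D \<subseteq> E"
    then show "E = D" using D chain_bound[OF E(1)] by (metis card_seteq subset_trans)
  qed (rule D)
  then show ?thesis using D by auto
qed

lemma rank_image_flag:
  assumes A: "A \<in> flags P"
  shows "face_rank P ` A = {-1..n}"
proof (rule card_subset_eq)
  have "finite A \<and> int (card A) = n + 2" using polytope A by (auto simp: polytope_def)
  then show "card (face_rank P ` A) = card {-1..n}"
    using inj_on_rank[OF flagD[OF A]] by (auto simp: card_image)
  show "face_rank P ` A \<subseteq> {-1..n}" using rank_range flags_subset_Field[OF A] by auto
qed simp

abbreviation "at \<equiv> face_at P"

lemma at_eqI: "\<lbrakk>A \<in> flags P; F \<in> A\<rbrakk> \<Longrightarrow> at A (face_rank P F) = F"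
  unfolding face_at_def using inj_on_rank[OF flagD] by (intro the_equality) (auto dest: inj_onD)

lemma at_in:
  assumes "A \<in> flags P" "i \<in> {-1..n}"
  shows "at A i \<in> A" "face_rank P (at A i) = i"
proof -
  have "i \<in> face_rank P ` A" using rank_image_flag[OF assms(1)] assms(2) by simp
  then obtain F where "F \<in> A" "face_rank P F = i" by auto
  then show "at A i \<in> A" "face_rank P (at A i) = i" using at_eqI[OF assms(1)] by auto
qed

lemma at_in_Field: "A \<in> flags P \<Longrightarrow> i \<in> {-1..n} \<Longrightarrow> at A i \<in> Field P"
  using at_in flags_subset_Field by blast

lemma flag_eq_at: "A \<in> flags P \<Longrightarrow> A = at A ` {-1..n}"
  using at_in(1) at_eqI rank_image_flag by (auto simp: image_iff) (metis imageI)

lemma flag_eqI: "\<lbrakk>A \<in> flags P; B \<in> flags P; \<And>i. i \<in> {-1..n} \<Longrightarrow> at A i = at B i\<rbrakk> \<Longrightarrow> A = B"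
  using flag_eq_at[of A] flag_eq_at[of B] by (metis (no_types, lifting) image_cong)

lemma flag_le_iff:
  assumes "A \<in> flags P" "F \<in> A" "G \<in> A"
  shows "(F, G) \<in> P \<longleftrightarrow> face_rank P F \<le> face_rank P G"
proof
  assume "face_rank P F \<le> face_rank P G"
  moreover have "(F, G) \<in> P \<or> (G, F) \<in> P" using flagD[OF assms(1)] assms by (auto simp: Chains_def)
  moreover have "(F, F) \<in> P" using order_refl flags_subset_Field[OF assms(1)] assms by auto
  ultimately show "(F, G) \<in> P" using rank_strict[of G F] by (cases "F = G") auto
qed (rule rank_mono)

lemma at_le: "\<lbrakk>A \<in> flags P; -1 \<le> i; i \<le> j; j \<le> n\<rbrakk> \<Longrightarrow> (at A i, at A j) \<in> P"
  using flag_le_iff at_in by auto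

text \<open>A chain with a face of every rank has no room for a further face, as ranks on a chain are distinct.\<close>
lemma flagI:
  assumes C: "C \<in> Chains P" and ranks: "{-1..n} \<subseteq> face_rank P ` C"
  shows "C \<in> flags P"
  unfolding flags_def
proof (intro CollectI conjI ballI impI)
  fix E assume E: "E \<in> Chains P" "C \<subseteq> E"
  have "x \<in> C" if x: "x \<in> E" for x
  proof -
    have "face_rank P x \<in> {-1..n}" using rank_range Chains_subset_Field[OF E(1)] x by auto
    then obtain c where "c \<in> C" "face_rank P c = face_rank P x"
      using ranks by (metis imageE subsetD)
    then show ?thesis using inj_on_rank[OF E(1)] x E(2) by (metis inj_onD subsetD)
  qed
  then show "E = C" using E by auto
qed (rule C)

lemma at_faces: "A \<in> flags P \<Longrightarrow> i \<in> {-1..n} \<Longrightarrow> at A i \<in> faces P i"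
  using at_in_Field at_in(2) by (simp add: faces_def)

lemma adjacent_atI:
  assumes A: "A \<in> flags P" and B: "B \<in> flags P" and i: "i \<in> {-1..n}"
    and ne: "at A i \<noteq> at B i" and eq: "\<And>j. j \<in> {-1..n} \<Longrightarrow> j \<noteq> i \<Longrightarrow> at A j = at B j"
  shows "adjacent_at P i A B"
proof -
  have diff: "X - Y = {at X i}"
    if X: "X \<in> flags P" and Y: "Y \<in> flags P" and ne: "at X i \<noteq> at Y i"
      and eq: "\<And>j. j \<in> {-1..n} \<Longrightarrow> j \<noteq> i \<Longrightarrow> at X j = at Y j" for X Y
  proof
    show "X - Y \<subseteq> {at X i}"
    proof
      fix F assume F: "F \<in> X - Y"
      then have "F \<in> at X ` {-1..n}" using flag_eq_at[OF X] by blast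
      then obtain j where j: "j \<in> {-1..n}" "F = at X j" by auto
      then have "j = i" using eq[OF j(1)] at_in(1)[OF Y j(1)] F by (metis DiffD2)
      then show "F \<in> {at X i}" using j by simp
    qed
    have "at X i \<notin> Y" using at_eqI[OF Y, of "at X i"] at_in(2)[OF X i] ne by auto
    then show "{at X i} \<subseteq> X - Y" using at_in(1)[OF X i] by auto
  qed
  have "A - B = {at A i}" using diff[OF A B] ne eq by auto
  moreover have "B - A = {at B i}" using diff[OF B A] ne eq by metis
  ultimately show ?thesis unfolding adjacent_at_def using at_faces i A B by blast
qed

lemma adjacent_atD:
  assumes A: "A \<in> flags P" and B: "B \<in> flags P" and adj: "adjacent_at P i A B"
  shows "i \<in> {-1..n}" "at A i \<noteq> at B i" "\<And>j. j \<in> {-1..n} \<Longrightarrow> j \<noteq> i \<Longrightarrow> at A j = at B j"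
proof -
  obtain F where F: "F \<in> faces P i" "A - B = {F}" using adj by (auto simp: adjacent_at_def)
  show i: "i \<in> {-1..n}" using F rank_range by (auto simp: faces_def)
  have "F \<in> A" "face_rank P F = i" using F by (auto simp: faces_def)
  then have Fi: "F = at A i" using at_eqI[OF A, of F] by simp
  have "F \<notin> B" using F(2) by blast
  then show "at A i \<noteq> at B i" using Fi at_in(1)[OF B i] by metis
  fix j assume j: "j \<in> {-1..n}" "j \<noteq> i"
  then have "at A j \<noteq> F" using Fi at_in(2)[OF A i] at_in(2)[OF A j(1)] j by auto
  then have "at A j \<in> B" using F at_in(1)[OF A j(1)] by blast
  then show "at A j = at B j" using at_eqI[OF B, of "at A j"] at_in(2)[OF A j(1)] by auto
qed

lemma least_face_at:
  assumes A: "A \<in> flags P" and n: "-1 \<le> n"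
  shows "at A (-1) = least_face P"
proof -
  have ex1: "\<exists>!F. is_least_face P F" using polytope by (simp add: polytope_def)
  then obtain F where F: "is_least_face P F" by auto
  have least: "least_face P = F" unfolding least_face_def using ex1 F by (rule the1_equality)
  have FP: "F \<in> Field P" "\<And>G. G \<in> Field P \<Longrightarrow> (F, G) \<in> P" using F by (auto simp: is_least_face_def)
  have "insert F A \<in> Chains P"
    using flagD[OF A] FP flags_subset_Field[OF A] by (auto simp: Chains_def)
  then have "F \<in> A" using A by (auto simp: flags_def)
  moreover have "face_rank P F = -1"
    using rank_mono[OF FP(2)[OF at_in_Field[OF A, of "-1"]]] at_in(2)[OF A, of "-1"] rank_range[OF FP(1)] n
    by auto
  ultimately show ?thesis using at_eqI[OF A, of F] least by auto
qed

lemma greatest_face_at: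
  assumes A: "A \<in> flags P" and n: "-1 \<le> n"
  shows "at A n = greatest_face P"
proof -
  have ex1: "\<exists>!F. is_greatest_face P F" using polytope by (simp add: polytope_def)
  then obtain F where F: "is_greatest_face P F" by auto
  have greatest: "greatest_face P = F" unfolding greatest_face_def using ex1 F
    by (rule the1_equality)
  have FP: "F \<in> Field P" "\<And>G. G \<in> Field P \<Longrightarrow> (G, F) \<in> P" using F by (auto simp: is_greatest_face_def)
  have "insert F A \<in> Chains P"
    using flagD[OF A] FP flags_subset_Field[OF A] by (auto simp: Chains_def)
  then have "F \<in> A" using A by (auto simp: flags_def)
  moreover have "face_rank P F = n"
    using rank_mono[OF FP(2)[OF at_in_Field[OF A, of n]]] at_in(2)[OF A, of n] rank_range[OF FP(1)] n
    by auto
  ultimately show ?thesis using at_eqI[OF A, of F] greatest by auto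
qed

lemma adjacent_imp_adjacent_at:
  assumes A: "A \<in> flags P" and B: "B \<in> flags P" and adj: "adjacent A B"
  shows "\<exists>i \<in> {0..n-1}. adjacent_at P i A B"
proof -
  obtain F where F: "A - B = {F}" using adj by (auto simp: adjacent_def)
  define i where "i = face_rank P F"
  have FA: "F \<in> A" using F by auto
  have i: "i \<in> {-1..n}" unfolding i_def using rank_range flags_subset_Field[OF A] FA by auto
  have Fi: "F = at A i" unfolding i_def by (rule at_eqI[OF A FA, symmetric])
  have "F \<notin> B" using F by blast
  then have ne: "at A i \<noteq> at B i" using Fi at_in(1)[OF B i] by metis
  have eq: "at A j = at B j" if j: "j \<in> {-1..n}" "j \<noteq> i" for j
  proof -
    have "at A j \<noteq> F" using Fi at_in(2)[OF A i] at_in(2)[OF A j(1)] j by auto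
    then have "at A j \<in> B" using F at_in(1)[OF A j(1)] by blast
    then show ?thesis using at_eqI[OF B, of "at A j"] at_in(2)[OF A j(1)] by auto
  qed
  have n: "-1 \<le> n" using i by auto
  have "i \<noteq> -1" using ne least_face_at[OF A n] least_face_at[OF B n] by auto
  moreover have "i \<noteq> n" using ne greatest_face_at[OF A n] greatest_face_at[OF B n] by auto
  ultimately have "i \<in> {0..n-1}" using i by auto
  then show ?thesis using adjacent_atI[OF A B i ne eq] by blast
qed

lemma replace_face:
  assumes A: "A \<in> flags P" and i: "i \<in> {0..n-1}" and H: "H \<in> faces P i"
    and le: "(at A (i-1), H) \<in> P" "(H, at A (i+1)) \<in> P"
  shows "\<exists>B \<in> flags P. at B i = H \<and> (\<forall>j \<in> {-1..n}. j \<noteq> i \<longrightarrow> at B j = at A j)"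
proof -
  let ?B = "insert H (at A ` ({-1..n} - {i}))"
  have HF: "H \<in> Field P" "face_rank P H = i" using H by (auto simp: faces_def)
  have cmp: "(at A j, H) \<in> P \<or> (H, at A j) \<in> P" if j: "j \<in> {-1..n} - {i}" for j
  proof (cases "j < i")
    case True
    then have "(at A j, at A (i-1)) \<in> P" using at_le[OF A, of j "i-1"] i j by auto
    then show ?thesis using order_transitive le by blast
  next
    case False
    then have "(at A (i+1), at A j) \<in> P" using at_le[OF A, of "i+1" j] i j by auto
    then show ?thesis using order_transitive le by blast
  qed
  have "?B \<in> Chains P"
    unfolding Chains_def
  proof (intro CollectI ballI)
    fix F G assume FG: "F \<in> ?B" "G \<in> ?B"
    have AA: "(F, G) \<in> P \<or> (G, F) \<in> P" if "F \<in> A" "G \<in> A"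
      using flagD[OF A] that by (auto simp: Chains_def)
    have mem: "at A j \<in> A" if "j \<in> {-1..n} - {i}" for j using at_in(1)[OF A] that by auto
    show "(F, G) \<in> P \<or> (G, F) \<in> P"
      using FG AA mem cmp order_refl[OF HF(1)] by (elim insertE imageE) blast+
  qed
  moreover have "{-1..n} \<subseteq> face_rank P ` ?B"
  proof
    fix j assume j: "j \<in> {-1..n}"
    show "j \<in> face_rank P ` ?B"
    proof (cases "j = i")
      case False
      then have "at A j \<in> ?B" "face_rank P (at A j) = j" using j at_in(2)[OF A j] by auto
      then show ?thesis by (metis imageI)
    qed (use HF in auto)
  qed
  ultimately have B: "?B \<in> flags P" by (rule flagI)
  have "at ?B i = H" using at_eqI[OF B, of H] HF by auto
  moreover have "at ?B j = at A j" if "j \<in> {-1..n}" "j \<noteq> i" for j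
    using at_eqI[OF B, of "at A j"] at_in(2)[OF A that(1)] that by auto
  ultimately show ?thesis using B by (intro bexI[of _ ?B]) auto
qed

lemma diamond:
  assumes A: "A \<in> flags P" and i: "i \<in> {0..n-1}"
  shows "\<exists>H. H \<noteq> at A i \<and> {H \<in> faces P i. (at A (i-1), H) \<in> P \<and> (H, at A (i+1)) \<in> P} = {at A i, H}"
proof -
  let ?D = "{H \<in> faces P i. (at A (i-1), H) \<in> P \<and> (H, at A (i+1)) \<in> P}"
  have "at A (i-1) \<in> faces P (i-1)" "at A (i+1) \<in> faces P (i+1)" "(at A (i-1), at A (i+1)) \<in> P"
    using at_faces[OF A] at_le[OF A] i by auto
  then have "card ?D = 2" using polytope unfolding polytope_def by blast
  moreover have "at A i \<in> ?D" using at_faces[OF A, of i] at_le[OF A] i by auto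
  ultimately obtain x y where xy: "?D = {x, y}" "x \<noteq> y" "at A i \<in> {x, y}"
    unfolding card_2_iff by auto
  show ?thesis
  proof (cases "at A i = x")
    case True then show ?thesis using xy by (intro exI[of _ y]) auto
  next
    case False then show ?thesis using xy by (intro exI[of _ x]) auto
  qed
qed

lemma adjacent_flag_exists:
  assumes A: "A \<in> flags P" and i: "i \<in> {0..n-1}"
  shows "\<exists>B \<in> flags P. adjacent_at P i A B"
proof -
  obtain H where H: "H \<noteq> at A i" "H \<in> faces P i" "(at A (i-1), H) \<in> P" "(H, at A (i+1)) \<in> P"
    using diamond[OF A i] by blast
  obtain B where "B \<in> flags P" "at B i = H" "\<forall>j \<in> {-1..n}. j \<noteq> i \<longrightarrow> at B j = at A j"
    using replace_face[OF A i H(2-4)] by auto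
  then show ?thesis using adjacent_atI[OF A, of B i] i H(1) by auto
qed

lemma adjacent_at_rank:
  assumes A: "A \<in> flags P" and B: "B \<in> flags P" and adj: "adjacent_at P i A B"
  shows "i \<in> {0..n-1}"
proof -
  have "i \<noteq> -1" "i \<noteq> n" using adjacent_atD(1,2)[OF A B adj] least_face_at[OF A] least_face_at[OF B]
      greatest_face_at[OF A] greatest_face_at[OF B] by auto
  then show ?thesis using adjacent_atD(1)[OF A B adj] by auto
qed

lemma adjacent_flag_unique:
  assumes A: "A \<in> flags P" and B: "B \<in> flags P" and C: "C \<in> flags P"
    and AB: "adjacent_at P i A B" and AC: "adjacent_at P i A C"
  shows "B = C"
proof (rule flag_eqI[OF B C])
  have i: "i \<in> {0..n-1}" using adjacent_at_rank[OF A B AB] .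
  obtain H where H: "{H \<in> faces P i. (at A (i-1), H) \<in> P \<and> (H, at A (i+1)) \<in> P} = {at A i, H}"
    using diamond[OF A i] by blast
  have "at X i = H" if X: "X \<in> flags P" "adjacent_at P i A X" for X
  proof -
    have "at X (i-1) = at A (i-1)" "at X (i+1) = at A (i+1)"
      using adjacent_atD(3)[OF A X, of "i-1"] adjacent_atD(3)[OF A X, of "i+1"] i by auto
    then have "at X i \<in> {H \<in> faces P i. (at A (i-1), H) \<in> P \<and> (H, at A (i+1)) \<in> P}"
      using at_le[OF X(1), of "i-1" i] at_le[OF X(1), of i "i+1"] at_faces[OF X(1), of i] i by auto
    then show ?thesis using H adjacent_atD(2)[OF A X] by auto
  qed
  then have eq: "at B i = at C i" using B C AB AC by auto
  fix j assume "j \<in> {-1..n}"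
  then show "at B j = at C j"
    using eq adjacent_atD(3)[OF A B AB, of j] adjacent_atD(3)[OF A C AC, of j]
      by (cases "j = i") auto
qed

lemma flag_path:
  assumes "A \<in> flags P" "B \<in> flags P"
  shows "(A, B) \<in> (flag_adjacency_above P (A \<inter> B))\<^sup>*"
  using polytope assms unfolding polytope_def strongly_flag_connected_def by blast

lemma thin_connected: "thin_connected P"
  unfolding thin_connected_def
proof (intro conjI ballI allI impI)
  show "Field P \<subseteq> \<Union> (flags P)"
  proof
    fix x assume "x \<in> Field P"
    then have "{x} \<in> Chains P" using order_refl by (auto simp: Chains_def)
    then show "x \<in> \<Union> (flags P)" using chain_extends by blast
  qed
  fix A assume A: "A \<in> flags P"
  show "inj_on (face_rank P) A" using inj_on_rank flagD A by auto
  fix B assume B: "B \<in> flags P"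
  show "B = C" if "C \<in> flags P" "adjacent_at P i A B \<and> adjacent_at P i A C" for C i
    using adjacent_flag_unique A B that by blast
  have "(A, B) \<in> (flag_adjacency_above P (A \<inter> B))\<^sup>*"
    by (rule flag_path[OF A B])
  moreover have "flag_adjacency_above P (A \<inter> B)
      \<subseteq> flag_adjacency P"
    using adjacent_imp_adjacent_at by blast
  ultimately show "(A, B) \<in> (flag_adjacency P)\<^sup>*"
    using rtrancl_mono by blast
qed

lemma aut_at:
  assumes f: "f \<in> carrier (aut_group P)" and A: "A \<in> flags P" and i: "i \<in> {-1..n}"
  shows "f (at A i) = at (f ` A) i"
proof -
  have "f (at A i) \<in> f ` A" using at_in(1)[OF A i] by auto
  moreover have "face_rank P (f (at A i)) = i"
    using face_rank_image[OF aut_iso[OF f] at_in_Field[OF A i]] at_in(2)[OF A i] by simp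
  ultimately show ?thesis using at_eqI[OF flag_image[OF aut_iso[OF f] A]] by metis
qed

end

section \<open>Directly regular polytopes\<close>

locale directly_regular_polytope =
  fixes n :: int and P :: "'a rel" and \<Phi> :: "'a set"
  assumes directly_regular: "directly_regular n P" and base_flag: "\<Phi> \<in> flags P"
begin

sublocale abstract_polytope n P
  using directly_regular by unfold_locales (simp add: directly_regular_def)

abbreviation "\<Gamma> \<equiv> aut_group P"
abbreviation "\<rho> \<equiv> rho P \<Phi>"

lemma rho_spec:
  assumes i: "i \<in> {0..n-1}"
  shows "\<rho> i \<in> carrier \<Gamma>" "adjacent_at P i \<Phi> (\<rho> i ` \<Phi>)"
proof -
  obtain B where B: "B \<in> flags P" "adjacent_at P i \<Phi> B"
    using adjacent_flag_exists[OF base_flag i] by auto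
  then obtain f where f: "f \<in> carrier \<Gamma>" "f ` \<Phi> = B"
    using directly_regular base_flag unfolding directly_regular_def regular_def by metis
  then have "\<rho> i = f" using rho_eqI[OF thin_connected base_flag f(1)] B by simp
  then show "\<rho> i \<in> carrier \<Gamma>" "adjacent_at P i \<Phi> (\<rho> i ` \<Phi>)" using f B by auto
qed

lemma aut_flag: "f \<in> carrier \<Gamma> \<Longrightarrow> f ` \<Phi> \<in> flags P"
  using flag_image[OF aut_iso base_flag] .

lemma aut_determined: "\<lbrakk>f \<in> carrier \<Gamma>; g \<in> carrier \<Gamma>; f ` \<Phi> = g ` \<Phi>\<rbrakk> \<Longrightarrow> f = g"
  using automorphisms_agreeing_on_flag[OF thin_connected base_flag] .

lemma mult_image:
  assumes "f \<in> carrier \<Gamma>" "g \<in> carrier \<Gamma>"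
  shows "(f \<otimes>\<^bsub>\<Gamma>\<^esub> g) ` \<Phi> = f ` (g ` \<Phi>)"
  using aut_mult_apply[OF assms] flags_subset_Field[OF base_flag]
    by (auto simp: image_iff subset_iff)

lemma one_image: "\<one>\<^bsub>\<Gamma>\<^esub> ` \<Phi> = \<Phi>"
proof -
  have "\<one>\<^bsub>\<Gamma>\<^esub> x = x" if "x \<in> \<Phi>" for x
    using that flags_subset_Field[OF base_flag] by (intro aut_one_apply) auto
  then show ?thesis by simp
qed

lemma adjacent_at_sym: "adjacent_at P i A B \<Longrightarrow> adjacent_at P i B A"
  by (auto simp: adjacent_at_def)

lemma adjacent_mult_rho:
  assumes f: "f \<in> carrier \<Gamma>" and i: "i \<in> {0..n-1}"
  shows "adjacent_at P i (f ` \<Phi>) ((f \<otimes>\<^bsub>\<Gamma>\<^esub> \<rho> i) ` \<Phi>)"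
  unfolding mult_image[OF f rho_spec(1)[OF i]]
  by (rule adjacent_at_image[OF aut_iso[OF f] flags_subset_Field[OF base_flag]
        flags_subset_Field[OF aut_flag[OF rho_spec(1)[OF i]]] rho_spec(2)[OF i]])

sublocale involution_system \<Gamma> \<rho> n
proof -
  interpret group \<Gamma> by (rule group_aut_group)
  show "involution_system \<Gamma> \<rho> n"
  proof
    fix i assume i: "i \<in> {0..n-1}"
    show c: "\<rho> i \<in> carrier \<Gamma>" using rho_spec[OF i] by auto
    have cc: "\<rho> i \<otimes>\<^bsub>\<Gamma>\<^esub> \<rho> i \<in> carrier \<Gamma>" using c by simp
    have "(\<rho> i \<otimes>\<^bsub>\<Gamma>\<^esub> \<rho> i) ` \<Phi> = \<Phi>"
      by (rule adjacent_flag_unique[OF aut_flag[OF c] aut_flag[OF cc] base_flag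
            adjacent_mult_rho[OF c i] adjacent_at_sym[OF rho_spec(2)[OF i]]])
    then show "\<rho> i \<otimes>\<^bsub>\<Gamma>\<^esub> \<rho> i = \<one>\<^bsub>\<Gamma>\<^esub>" using aut_determined[OF cc one_closed] one_image by simp
  qed
qed

lemma rho_fixes:
  assumes i: "i \<in> {0..n-1}" and j: "j \<in> {-1..n}" "j \<noteq> i"
  shows "\<rho> i (at \<Phi> j) = at \<Phi> j"
proof -
  have c: "\<rho> i \<in> carrier \<Gamma>" using rho_spec[OF i] by auto
  have "\<rho> i (at \<Phi> j) = at (\<rho> i ` \<Phi>) j" using aut_at[OF c base_flag j(1)] .
  also have "\<dots> = at \<Phi> j"
    using adjacent_atD(3)[OF base_flag aut_flag[OF c] rho_spec(2)[OF i] j] by simp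
  finally show ?thesis .
qed

lemma word_fixes:
  assumes "set w \<subseteq> N" "j \<in> {-1..n}" "j \<notin> set w"
  shows "wd w (at \<Phi> j) = at \<Phi> j"
  using assms
proof (induction w)
  case Nil
  then show ?case using at_in_Field[OF base_flag, of j] by (simp add: aut_one_apply)
next
  case (Cons i w)
  then have "wd (i # w) (at \<Phi> j) = \<rho> i (wd w (at \<Phi> j))"
    using aut_mult_apply[of "\<rho> i" P "wd w"] closed[of i] word_closed[of w] at_in_Field[OF base_flag]
      by auto
  then show ?case using Cons rho_fixes[of i j] by auto
qed

text \<open>Changing the faces of two ranks that are not consecutive can be done in either order: the face that replaces
  the \<open>j\<close>-face of the base flag still fits between the neighbours, which the change of the \<open>i\<close>-face left alone.\<close>
lemma commute_far:
  assumes ij: "0 \<le> i" "i + 1 < j" "j \<le> n - 1"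
  shows "\<rho> i \<otimes>\<^bsub>\<Gamma>\<^esub> \<rho> j = \<rho> j \<otimes>\<^bsub>\<Gamma>\<^esub> \<rho> i"
proof -
  have i: "i \<in> N" and j: "j \<in> N" using ij by auto
  have c: "\<rho> i \<in> carrier \<Gamma>" "\<rho> j \<in> carrier \<Gamma>" using closed i j by auto
  let ?B = "\<rho> i ` \<Phi>" and ?C = "\<rho> j ` \<Phi>"
  have B: "?B \<in> flags P" and C: "?C \<in> flags P" using aut_flag c by auto
  note Bi = adjacent_atD[OF base_flag B rho_spec(2)[OF i]]
  note Cj = adjacent_atD[OF base_flag C rho_spec(2)[OF j]]
  have "(at ?C (j-1), at ?C j) \<in> P" "(at ?C j, at ?C (j+1)) \<in> P" using at_le[OF C] j by auto
  then have "(at ?B (j-1), at ?C j) \<in> P" "(at ?C j, at ?B (j+1)) \<in> P"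
    using Bi(3)[of "j-1"] Bi(3)[of "j+1"] Cj(3)[of "j-1"] Cj(3)[of "j+1"] ij by auto
  then obtain D where D: "D \<in> flags P" "at D j = at ?C j" "\<forall>k \<in> {-1..n}. k \<noteq> j \<longrightarrow> at D k = at ?B k"
    using replace_face[OF B j] at_faces[OF C, of j] j by auto
  have "adjacent_at P j ?B D"
  proof (rule adjacent_atI[OF B D(1)])
    show "at ?B j \<noteq> at D j" using D(2) Bi(3)[of j] Cj(2) ij by auto
  qed (use D j in auto)
  then have 1: "(\<rho> i \<otimes>\<^bsub>\<Gamma>\<^esub> \<rho> j) ` \<Phi> = D"
    using adjacent_flag_unique[OF B _ D(1) adjacent_mult_rho[OF c(1) j]] aut_flag m_closed[OF c]
      by blast
  have "adjacent_at P i ?C D"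
  proof (rule adjacent_atI[OF C D(1)])
    have Di: "at D i = at ?B i" using D(3) ij by auto
    show "at ?C i \<noteq> at D i" using Di Bi(2) Cj(3)[of i] ij by auto
    fix k assume k: "k \<in> {-1..n}" "k \<noteq> i"
    show "at ?C k = at D k"
    proof (cases "k = j")
      case True
      then show ?thesis using D(2) by simp
    next
      case False
      then have "at D k = at ?B k" using k D(3) by blast
      then show ?thesis using Bi(3)[OF k] Cj(3)[OF k(1) False] by simp
    qed
  next
    show "i \<in> {-1..n}" using i by auto
  qed
  then have 2: "(\<rho> j \<otimes>\<^bsub>\<Gamma>\<^esub> \<rho> i) ` \<Phi> = D"
    using adjacent_flag_unique[OF C _ D(1) adjacent_mult_rho[OF c(2) i]] aut_flag m_closed[OF c(2,1)]
      by blast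
  show ?thesis using aut_determined[of "\<rho> i \<otimes>\<^bsub>\<Gamma>\<^esub> \<rho> j" "\<rho> j \<otimes>\<^bsub>\<Gamma>\<^esub> \<rho> i"] 1 2 m_closed[OF c] m_closed[OF c(2,1)]
    by simp
qed

text \<open>This is where strong flag-connectivity enters: the faces common to the two ends of the chain
  of flags are never changed, so the word that describes the chain avoids their ranks.\<close>

lemma word_reaching_flag:
  assumes B: "B \<in> flags P" and I: "I \<subseteq> N" and fixed: "\<And>j. j \<in> {-1..n} - I \<Longrightarrow> at B j = at \<Phi> j"
  shows "\<exists>w. set w \<subseteq> I \<and> wd w ` \<Phi> = B"
proof -
  have shared: "at \<Phi> j \<in> \<Phi> \<inter> B" if j: "j \<in> {-1..n} - I" for j
    using at_in(1)[OF base_flag, of j] at_in(1)[OF B, of j] fixed[OF j] j by auto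
  have "(\<Phi>, B) \<in> (flag_adjacency_above P (\<Phi> \<inter> B))\<^sup>*"
    by (rule flag_path[OF base_flag B])
  then show ?thesis
  proof (induction rule: rtrancl_induct)
    case base
    then show ?case using one_image by (intro exI[of _ "[]"]) auto
  next
    case (step X Y)
    then obtain w where w: "set w \<subseteq> I" "wd w ` \<Phi> = X" by auto
    have XY: "X \<in> flags P" "Y \<in> flags P" "adjacent X Y" "\<Phi> \<inter> B \<subseteq> X" "\<Phi> \<inter> B \<subseteq> Y"
      using step(2) by auto
    obtain i where i: "i \<in> N" "adjacent_at P i X Y"
      using adjacent_imp_adjacent_at[OF XY(1-3)] by auto
    have iI: "i \<in> I"
    proof (rule ccontr)
      assume "i \<notin> I"
      then have ii: "i \<in> {-1..n} - I" using i by auto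
      then have m: "at \<Phi> i \<in> X" "at \<Phi> i \<in> Y" using shared XY by auto
      have "face_rank P (at \<Phi> i) = i" using at_in(2)[OF base_flag] ii by auto
      then have "at X i = at \<Phi> i" "at Y i = at \<Phi> i"
        using at_eqI[OF XY(1) m(1)] at_eqI[OF XY(2) m(2)] by auto
      then show False using adjacent_atD(2)[OF XY(1,2) i(2)] by simp
    qed
    have wN: "set w \<subseteq> N" using w I by auto
    have wc: "wd w \<in> carrier \<Gamma>" using word_closed wN by auto
    have ww: "wd (w @ [i]) = wd w \<otimes>\<^bsub>\<Gamma>\<^esub> \<rho> i"
      using word_append[OF wN, of "[i]"] closed[OF i(1)] i(1) by auto
    have "adjacent_at P i X (wd (w @ [i]) ` \<Phi>)" unfolding ww
      using adjacent_mult_rho[OF wc i(1)] w by simp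
    moreover have "wd (w @ [i]) ` \<Phi> \<in> flags P"
      by (rule aut_flag, rule word_closed) (use wN i in auto)
    ultimately have "wd (w @ [i]) ` \<Phi> = Y"
      using adjacent_flag_unique[OF XY(1) _ XY(2) _ i(2)] by blast
    then show ?case using w iI by (intro exI[of _ "w @ [i]"]) auto
  qed
qed

lemma word_of_stabilizer:
  assumes f: "f \<in> carrier \<Gamma>" and I: "I \<subseteq> N" and fixed: "\<And>j. j \<in> {-1..n} - I \<Longrightarrow> f (at \<Phi> j) = at \<Phi> j"
  shows "\<exists>w. set w \<subseteq> I \<and> wd w = f"
proof -
  obtain w where w: "set w \<subseteq> I" "wd w ` \<Phi> = f ` \<Phi>"
    using word_reaching_flag[OF aut_flag[OF f] I] aut_at[OF f base_flag] fixed by auto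
  then show ?thesis using aut_determined[OF word_closed f] I by blast
qed

lemma fixing_base_flag:
  assumes f: "f \<in> carrier \<Gamma>" and fixed: "\<And>j. j \<in> {-1..n} \<Longrightarrow> f (at \<Phi> j) = at \<Phi> j"
  shows "f = \<one>\<^bsub>\<Gamma>\<^esub>"
  using word_of_stabilizer[OF f, of "{}"] fixed by auto

lemma rotation_group_eq: "carrier (rotation_group n P \<Phi>) = even_span N"
  using generate_rot by (simp add: rotation_group_def sigma_def)

text \<open>The index 2 of the rotation subgroup enters the proof in this form.\<close>
lemma rotations_proper: "even_span N \<noteq> carrier \<Gamma>"
proof
  assume "even_span N = carrier \<Gamma>"
  then have "rcosets\<^bsub>\<Gamma>\<^esub> (carrier (rotation_group n P \<Phi>)) = {carrier \<Gamma>}"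
    using coset_join2[OF _ subgroup_self] one_closed unfolding rotation_group_eq RCOSETS_def by auto
  moreover have "card (rcosets\<^bsub>\<Gamma>\<^esub> (carrier (rotation_group n P \<Phi>))) = 2"
    using directly_regular base_flag by (simp add: directly_regular_def)
  ultimately show False by simp
qed

lemma span_N: "span N = carrier \<Gamma>"
proof
  show "span N \<subseteq> carrier \<Gamma>" using span_carrier by blast
  show "carrier \<Gamma> \<subseteq> span N"
  proof
    fix f assume f: "f \<in> carrier \<Gamma>"
    have "f (at \<Phi> j) = at \<Phi> j" if j: "j \<in> {-1..n} - N" for j
    proof -
      have "-1 \<le> n" "j = -1 \<or> j = n" using j by auto
      then have "at (f ` \<Phi>) j = at \<Phi> j"
        using least_face_at[OF base_flag] least_face_at[OF aut_flag[OF f]]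
          greatest_face_at[OF base_flag] greatest_face_at[OF aut_flag[OF f]] by auto
      then show ?thesis using aut_at[OF f base_flag] j by auto
    qed
    then obtain w where "set w \<subseteq> N" "wd w = f" using word_of_stabilizer[OF f subset_refl] by auto
    then show "f \<in> span N" by (auto simp: span_def)
  qed
qed

text \<open>In ranks up to 0 there are no generators, so that the whole group would consist of rotations.\<close>
lemma rank_positive: "1 \<le> n"
proof (rule ccontr)
  assume "\<not> 1 \<le> n"
  then have "even_span N = span N" unfolding even_span_def span_def by auto
  then show False using rotations_proper span_N by simp
qed

text \<open>An odd relation would turn every odd word into an even one.\<close>
lemma even_relations:
  assumes w: "set w \<subseteq> N" "wd w = \<one>\<^bsub>\<Gamma>\<^esub>"
  shows "even (length w)"
proof (rule ccontr)
  assume odd: "odd (length w)"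
  have "f \<in> even_span N" if f: "f \<in> carrier \<Gamma>" for f
  proof -
    have "f \<in> span N" using f span_N by simp
    then obtain v where v: "f = wd v" "set v \<subseteq> N" by (auto simp: span_def)
    have "f = wd (w @ v)" using v w word_append[OF w(1) v(2)] word_closed[OF v(2)] by simp
    moreover have "set (w @ v) \<subseteq> N" "even (length v) \<or> even (length (w @ v))" using v w odd by auto
    ultimately show ?thesis unfolding even_span_def using v by blast
  qed
  moreover have "even_span N \<subseteq> carrier \<Gamma>" using even_span_sub_span span_N by blast
  ultimately show False using rotations_proper by blast
qed

sublocale string_group \<Gamma> \<rho> n
proof
  fix w assume w: "set w \<subseteq> N"
    and sep: "\<And>j. j \<in> N \<Longrightarrow> \<exists>v. set v \<subseteq> N - {j} \<and> wd v = wd w"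
  show "wd w = \<one>\<^bsub>\<Gamma>\<^esub>"
  proof (rule fixing_base_flag[OF word_closed[OF w]])
    fix j assume j: "j \<in> {-1..n}"
    show "wd w (at \<Phi> j) = at \<Phi> j"
    proof (cases "j \<in> N")
      case True
      then obtain v where v: "set v \<subseteq> N - {j}" "wd v = wd w" using sep by blast
      then show ?thesis using word_fixes[of v j] j by auto
    next
      case False
      then have "j \<notin> set w" using w by blast
      then show ?thesis using word_fixes[OF w j] by simp
    qed
  qed
qed (use commute_far even_relations in auto)

end

section \<open>Sections of directly regular polytopes\<close>

text \<open>Facets, vertex-figures and medial sections are the sections between the base faces of ranks \<open>a\<close> and \<open>b\<close>
  for \<open>a \<in> {-1, 0}\<close> and \<open>b \<in> {n - 1, n}\<close>. The \<open>i\<close>-faces of the section are the \<open>(a + 1 + i)\<close>-faces of \<open>P\<close> in it.\<close>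
locale base_section = directly_regular_polytope +
  fixes a b :: int
  assumes ab: "-1 \<le> a" "a < b" "b \<le> n"
begin

abbreviation "S \<equiv> face_section P (at \<Phi> a) (at \<Phi> b)"

definition inner :: "'a set" where
  "inner = {H. (at \<Phi> a, H) \<in> P \<and> (H, at \<Phi> b) \<in> P}"

definition outer :: "'a set" where
  "outer = at \<Phi> ` ({-1..a} \<union> {b..n})"

lemma inner_Field: "H \<in> inner \<Longrightarrow> H \<in> Field P"
  by (auto simp: inner_def Field_def)

lemma section_iff: "(F, G) \<in> S \<longleftrightarrow> (F, G) \<in> P \<and> F \<in> inner \<and> G \<in> inner"
  by (auto simp: face_section_def inner_def)

lemma Field_section: "Field S = inner"
proof
  show "Field S \<subseteq> inner" by (auto simp: Field_def section_iff)
  show "inner \<subseteq> Field S" using order_refl inner_Field section_iff unfolding Field_def by blast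
qed

lemma Chains_section: "C \<in> Chains S \<longleftrightarrow> C \<in> Chains P \<and> C \<subseteq> inner"
  unfolding Chains_def section_iff by blast

lemma at_inner: "a \<le> j \<Longrightarrow> j \<le> b \<Longrightarrow> at \<Phi> j \<in> inner"
  unfolding inner_def using at_le[OF base_flag] ab by auto

lemma outer_base: "outer \<subseteq> \<Phi>"
  unfolding outer_def using at_in(1)[OF base_flag] ab by auto

lemma at_outer:
  assumes X: "X \<in> flags P" "outer \<subseteq> X" and i: "i \<in> {-1..a} \<union> {b..n}"
  shows "at X i = at \<Phi> i"
proof -
  have "at \<Phi> i \<in> X" "i \<in> {-1..n}" using X(2) i ab by (auto simp: outer_def)
  then show ?thesis using at_eqI[OF X(1), of "at \<Phi> i"] at_in(2)[OF base_flag, of i] by simp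
qed

lemma mem_inner_iff:
  assumes X: "X \<in> flags P" "outer \<subseteq> X" and F: "F \<in> X"
  shows "F \<in> inner \<longleftrightarrow> a \<le> face_rank P F \<and> face_rank P F \<le> b"
proof -
  have "at \<Phi> a \<in> X" "at \<Phi> b \<in> X" using X(2) ab by (auto simp: outer_def)
  then show ?thesis unfolding inner_def
    using flag_le_iff[OF X(1) _ F, of "at \<Phi> a"] flag_le_iff[OF X(1) F, of "at \<Phi> b"]
      at_in(2)[OF base_flag, of a] at_in(2)[OF base_flag, of b] ab by auto
qed

lemma not_inner_outer:
  assumes X: "X \<in> flags P" "outer \<subseteq> X" and F: "F \<in> X" "F \<notin> inner"
  shows "F \<in> outer"
proof -
  let ?i = "face_rank P F"
  have "?i \<in> {-1..n}" using rank_range flags_subset_Field[OF X(1)] F by auto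
  then have i: "?i \<in> {-1..a} \<union> {b..n}" using mem_inner_iff[OF X F(1)] F(2) by auto
  have "F = at X ?i" by (rule at_eqI[OF X(1) F(1), symmetric])
  also have "\<dots> = at \<Phi> ?i" by (rule at_outer[OF X i])
  finally show ?thesis unfolding outer_def using i by blast
qed

lemma outer_comparable:
  assumes F: "F \<in> outer" and G: "G \<in> inner"
  shows "(F, G) \<in> P \<or> (G, F) \<in> P"
proof -
  obtain i where i: "i \<in> {-1..a} \<union> {b..n}" "F = at \<Phi> i" using F unfolding outer_def by blast
  show ?thesis
  proof (cases "i \<le> a")
    case True
    then have "(F, at \<Phi> a) \<in> P" using at_le[OF base_flag, of i a] i ab by auto
    then show ?thesis using G order_transitive unfolding inner_def by blast
  next
    case False
    then have "(at \<Phi> b, F) \<in> P" using at_le[OF base_flag, of b i] i ab by auto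
    then show ?thesis using G order_transitive unfolding inner_def by blast
  qed
qed

lemma chain_union_outer:
  assumes C: "C \<in> Chains P" "C \<subseteq> inner"
  shows "C \<union> outer \<in> Chains P"
  unfolding Chains_def
proof (intro CollectI ballI)
  fix F G assume "F \<in> C \<union> outer" "G \<in> C \<union> outer"
  moreover have "(F, G) \<in> P \<or> (G, F) \<in> P" if "F \<in> C" "G \<in> C"
    using that C(1) by (auto simp: Chains_def)
  moreover have "(F, G) \<in> P \<or> (G, F) \<in> P" if "F \<in> outer" "G \<in> outer"
    using that outer_base flagD[OF base_flag] by (auto simp: Chains_def)
  ultimately show "(F, G) \<in> P \<or> (G, F) \<in> P" using outer_comparable C(2) by blast
qed

lemma section_flag:
  assumes X: "X \<in> flags P" "outer \<subseteq> X"
  shows "X \<inter> inner \<in> flags S"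
  unfolding flags_def
proof (intro CollectI conjI ballI impI)
  show "X \<inter> inner \<in> Chains S" unfolding Chains_section
    using flagD[OF X(1)] by (auto simp: Chains_def)
  fix C assume C: "C \<in> Chains S" "X \<inter> inner \<subseteq> C"
  have CC: "C \<in> Chains P" "C \<subseteq> inner" using C(1) by (auto simp: Chains_section)
  have "X \<subseteq> C \<union> outer" using C(2) not_inner_outer[OF X] by blast
  then have "C \<union> outer = X" using chain_union_outer[OF CC] X(1) by (auto simp: flags_def)
  then show "C = X \<inter> inner" using C(2) CC(2) by blast
qed

text \<open>Adding the base faces of ranks at most \<open>a\<close> and at least \<open>b\<close> identifies the flags of the section with the
  flags of \<open>P\<close> that contain these faces.\<close>
lemma section_flag_lift:
  assumes A: "A \<in> flags S"
  shows "A \<union> outer \<in> flags P" "(A \<union> outer) \<inter> inner = A"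
proof -
  have AC: "A \<in> Chains P" "A \<subseteq> inner" using A by (auto simp: flags_def Chains_section)
  obtain X where X: "X \<in> flags P" "A \<union> outer \<subseteq> X"
    using chain_extends[OF chain_union_outer[OF AC]] by auto
  have Xo: "outer \<subseteq> X" using X(2) by simp
  have "X \<inter> inner \<in> Chains S" using section_flag[OF X(1) Xo] by (simp add: flags_def)
  moreover have "A \<subseteq> X \<inter> inner" using X(2) AC by blast
  ultimately have eq: "X \<inter> inner = A" using A by (auto simp: flags_def)
  then have "X = A \<union> outer" using X(2) not_inner_outer[OF X(1) Xo] by blast
  then show "A \<union> outer \<in> flags P" "(A \<union> outer) \<inter> inner = A" using X(1) eq by auto
qed

lemma section_rank:
  assumes H: "H \<in> inner"
  shows "face_rank S H = face_rank P H - (a + 1)"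
proof -
  have HP: "H \<in> Field P" using inner_Field H .
  have low: "a \<le> face_rank P F" if "F \<in> inner" for F
    using rank_mono[of "at \<Phi> a" F] that at_in(2)[OF base_flag, of a] ab by (auto simp: inner_def)
  have "{H} \<in> Chains P" using order_refl[OF HP] by (auto simp: Chains_def)
  then obtain X where X: "X \<in> flags P" "{H} \<union> outer \<subseteq> X"
    using chain_extends[OF chain_union_outer[of "{H}"]] H by auto
  have Xo: "outer \<subseteq> X" "H \<in> X" using X(2) by auto
  have Hb: "a \<le> face_rank P H" "face_rank P H \<le> b" using mem_inner_iff[OF X(1) Xo] H by auto
  let ?C = "at X ` {a..face_rank P H}"
  have mem: "at X j \<in> X" "face_rank P (at X j) = j" if "j \<in> {a..face_rank P H}" for j
    using at_in[OF X(1), of j] that Hb ab by auto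
  show ?thesis
  proof (rule face_rank_eqI[where C = ?C])
    show "face_rank P F - (a + 1) < face_rank P G - (a + 1)" if "(F, G) \<in> S" "F \<noteq> G" for F G
      using that rank_strict section_iff by auto
    show "-1 \<le> face_rank P F - (a + 1)" if "F \<in> Field S" for F
      using that low[of F] unfolding Field_section by auto
    have inn: "?C \<subseteq> inner" using mem mem_inner_iff[OF X(1) Xo(1)] Hb by auto
    have CX: "?C \<subseteq> X" using mem by auto
    then have "?C \<in> Chains P" using flagD[OF X(1)] unfolding Chains_def by blast
    then show "?C \<in> Chains S" using inn Chains_section by blast
    show "\<forall>G \<in> ?C. (G, H) \<in> S"
      using mem flag_le_iff[OF X(1) _ Xo(2)] inn H unfolding section_iff by auto
    have "inj_on (at X) {a..face_rank P H}"
      using mem(2) by (intro inj_on_inverseI[of _ "face_rank P"]) auto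
    then show "int (card ?C) = face_rank P H - (a + 1) + 2" using Hb by (simp add: card_image)
  qed
qed

lemma faces_section: "F \<in> faces S k \<longleftrightarrow> F \<in> inner \<and> F \<in> faces P (k + a + 1)"
  using section_rank[of F] inner_Field[of F] by (auto simp: faces_def Field_section)

lemma adjacent_at_section:
  assumes X: "X \<in> flags P" "outer \<subseteq> X" and Y: "Y \<in> flags P" "outer \<subseteq> Y"
  shows "adjacent_at S k (X \<inter> inner) (Y \<inter> inner) \<longleftrightarrow> adjacent_at P (k + a + 1) X Y"
proof -
  have XY: "(X \<inter> inner) - (Y \<inter> inner) = X - Y" "X - Y \<subseteq> inner"
    using not_inner_outer[OF X] Y(2) by blast+
  have YX: "(Y \<inter> inner) - (X \<inter> inner) = Y - X" "Y - X \<subseteq> inner"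
    using not_inner_outer[OF Y] X(2) by blast+
  show ?thesis unfolding adjacent_at_def XY(1) YX(1) Bex_def faces_section using XY(2) YX(2) by auto
qed

lemma thin_connected_section: "thin_connected S"
  unfolding thin_connected_def
proof (intro conjI ballI allI impI)
  show "Field S \<subseteq> \<Union> (flags S)"
  proof
    fix H assume "H \<in> Field S"
    then have H: "H \<in> inner" by (simp add: Field_section)
    then have "{H} \<in> Chains P" using order_refl inner_Field by (auto simp: Chains_def)
    then obtain X where X: "X \<in> flags P" "{H} \<union> outer \<subseteq> X"
      using chain_extends[OF chain_union_outer[of "{H}"]] H by auto
    then have "X \<inter> inner \<in> flags S" "H \<in> X \<inter> inner" using section_flag[of X] H by auto
    then show "H \<in> \<Union> (flags S)" by blast
  qed
  fix A assume A: "A \<in> flags S"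
  note A' = section_flag_lift[OF A]
  show "inj_on (face_rank S) A"
  proof (rule inj_onI)
    fix x y assume xy: "x \<in> A" "y \<in> A" "face_rank S x = face_rank S y"
    then have "x \<in> inner" "y \<in> inner" using A'(2) by blast+
    then have "face_rank P x = face_rank P y" using xy section_rank by auto
    then show "x = y" using inj_on_rank[OF flagD[OF A'(1)]] xy by (auto dest: inj_onD)
  qed
  fix B assume B: "B \<in> flags S"
  note B' = section_flag_lift[OF B]
  {
    fix C k assume C: "C \<in> flags S" "adjacent_at S k A B \<and> adjacent_at S k A C"
    note C' = section_flag_lift[OF C(1)]
    have "adjacent_at P (k + a + 1) (A \<union> outer) (B \<union> outer)"
      using adjacent_at_section[OF A'(1) _ B'(1), of k] A'(2) B'(2) C by auto
    moreover have "adjacent_at P (k + a + 1) (A \<union> outer) (C \<union> outer)"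
      using adjacent_at_section[OF A'(1) _ C'(1), of k] A'(2) C'(2) C by auto
    ultimately have "B \<union> outer = C \<union> outer" by (rule adjacent_flag_unique[OF A'(1) B'(1) C'(1)])
    then show "B = C" using arg_cong[of _ _ "\<lambda>X. X \<inter> inner"] B'(2) C'(2) by metis
  }
  let ?X = "A \<union> outer" and ?Y = "B \<union> outer"
  have "(?X, ?Y) \<in> (flag_adjacency_above P (?X \<inter> ?Y))\<^sup>*"
    by (rule flag_path[OF A'(1) B'(1)])
  then have "(?X \<inter> inner, ?Y \<inter> inner) \<in>
      (flag_adjacency S)\<^sup>*"
  proof (induction rule: rtrancl_induct)
    case (step Y Z)
    have YZ': "Y \<in> flags P" "Z \<in> flags P" "adjacent Y Z" "?X \<inter> ?Y \<subseteq> Y" "?X \<inter> ?Y \<subseteq> Z"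
      using step(2) unfolding mem_Collect_eq prod.case by blast+
    have "outer \<subseteq> ?X \<inter> ?Y" by blast
    then have YZ: "Y \<in> flags P" "Z \<in> flags P" "adjacent Y Z" "outer \<subseteq> Y" "outer \<subseteq> Z"
      using YZ' subset_trans by blast+
    obtain i where "adjacent_at P i Y Z" using adjacent_imp_adjacent_at[OF YZ(1-3)] by auto
    then have "adjacent_at S (i - a - 1) (Y \<inter> inner) (Z \<inter> inner)"
      using adjacent_at_section[OF YZ(1,4,2,5), of "i - a - 1"] by simp
    then have "(Y \<inter> inner, Z \<inter> inner) \<in> flag_adjacency S"
      using section_flag[OF YZ(1,4)] section_flag[OF YZ(2,5)] by blast
    then show ?case using step(3) by (rule rtrancl_into_rtrancl[rotated])
  qed simp
  then show "(A, B) \<in> (flag_adjacency S)\<^sup>*"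
    unfolding A'(2) B'(2) .
qed

lemma restrict_automorphism:
  assumes f: "f \<in> carrier \<Gamma>" and fix_ab: "f (at \<Phi> a) = at \<Phi> a" "f (at \<Phi> b) = at \<Phi> b"
  shows "is_isomorphism S S f" "f ` inner = inner"
proof -
  have aF: "at \<Phi> a \<in> Field P" "at \<Phi> b \<in> Field P" using at_in_Field[OF base_flag] ab by auto
  have iff: "(x, y) \<in> P \<longleftrightarrow> (f x, f y) \<in> P" if "x \<in> Field P" "y \<in> Field P" for x y
    using aut_iso[OF f] that by (auto simp: is_isomorphism_def)
  have inner: "f x \<in> inner \<longleftrightarrow> x \<in> inner" if "x \<in> Field P" for x
    using iff[OF aF(1) that] iff[OF that aF(2)] fix_ab by (simp add: inner_def)
  have surj: "f ` Field P = Field P"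
    using aut_iso[OF f] by (auto simp: is_isomorphism_def bij_betw_def)
  show img: "f ` inner = inner"
  proof
    show "f ` inner \<subseteq> inner" using inner inner_Field by auto
    show "inner \<subseteq> f ` inner"
    proof
      fix y assume y: "y \<in> inner"
      then have "y \<in> f ` Field P" using surj inner_Field by auto
      then obtain x where "x \<in> Field P" "y = f x" by auto
      then show "y \<in> f ` inner" using inner y by auto
    qed
  qed
  have "inj_on f inner"
    using inj_on_isomorphism[OF aut_iso[OF f]] inner_Field by (auto intro: inj_on_subset)
  then show "is_isomorphism S S f"
    unfolding is_isomorphism_def Field_section bij_betw_def section_iff
    using img inner iff inner_Field by blast
qed

text \<open>By regularity the base flag of \<open>K\<close> can be chosen freely: an automorphism of \<open>P\<close> that moves the base
  flag to the lift of the chosen one fixes the two ends of the section.\<close>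
lemma isomorphism_matching_flag:
  assumes K: "isomorphic S K" and \<Phi>K: "\<Phi>K \<in> flags K"
  obtains h where "is_isomorphism S K h" "h ` (\<Phi> \<inter> inner) = \<Phi>K"
proof -
  obtain h0 where h0: "is_isomorphism S K h0" using K by (auto simp: isomorphic_def)
  define A where "A = inv_into (Field S) h0 ` \<Phi>K"
  have A: "A \<in> flags S" unfolding A_def by (rule flag_image[OF is_isomorphism_inv[OF h0] \<Phi>K])
  have hA: "h0 ` A = \<Phi>K" unfolding A_def using image_inv_image(2)[OF h0 flags_subset_Field[OF \<Phi>K]] .
  note A' = section_flag_lift[OF A]
  obtain f where f: "f \<in> carrier \<Gamma>" "f ` \<Phi> = A \<union> outer"
    using directly_regular base_flag A'(1) unfolding directly_regular_def regular_def by metis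
  have fix_ab: "f (at \<Phi> a) = at \<Phi> a" "f (at \<Phi> b) = at \<Phi> b"
    using aut_at[OF f(1) base_flag] at_outer[OF A'(1)] f(2) ab by auto
  note r = restrict_automorphism[OF f(1) fix_ab]
  have inj: "inj_on f (Field P)" using inj_on_isomorphism[OF aut_iso[OF f(1)]] .
  have "f ` (\<Phi> \<inter> inner) = f ` \<Phi> \<inter> f ` inner"
    using flags_subset_Field[OF base_flag] inner_Field by (intro inj_on_image_Int[OF inj]) auto
  also have "\<dots> = A" using f(2) r(2) A'(2) by simp
  finally have "h0 ` (f ` (\<Phi> \<inter> inner)) = \<Phi>K" using hA by simp
  then have "(h0 \<circ> f) ` (\<Phi> \<inter> inner) = \<Phi>K" by (simp only: image_comp)
  then show thesis using that is_isomorphism_comp[OF r(1) h0] by blast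
qed

lemma rho_section:
  assumes h: "is_isomorphism S K h" "h ` (\<Phi> \<inter> inner) = \<Phi>K" and \<Phi>K: "\<Phi>K \<in> flags K"
    and i: "i \<in> {0..b - a - 2}"
  shows "rho K \<Phi>K i \<in> carrier (aut_group K)"
    and "H \<in> inner \<Longrightarrow> rho K \<Phi>K i (h H) = h (\<rho> (a + 1 + i) H)"
proof -
  let ?k = "a + 1 + i"
  have k: "?k \<in> N" "?k \<noteq> a" "?k \<noteq> b" using i ab by auto
  let ?g = "\<rho> ?k"
  have g: "?g \<in> carrier \<Gamma>" using closed[OF k(1)] .
  have fix_ab: "?g (at \<Phi> a) = at \<Phi> a" "?g (at \<Phi> b) = at \<Phi> b" using rho_fixes[OF k(1)] k ab by auto
  note r = restrict_automorphism[OF g fix_ab]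
  let ?hi = "inv_into (Field S) h"
  define f where "f = (\<lambda>y \<in> Field K. h (?g (?hi y)))"
  have "is_isomorphism K K ((h \<circ> ?g) \<circ> ?hi)"
    by (rule is_isomorphism_comp[OF is_isomorphism_inv[OF h(1)] is_isomorphism_comp[OF r(1) h(1)]])
  then have "is_isomorphism K K f" by (rule is_isomorphism_cong) (simp add: f_def)
  then have fc: "f \<in> carrier (aut_group K)" by (simp add: aut_iff f_def)
  have hb: "bij_betw h inner (Field K)" using h(1) by (simp add: is_isomorphism_def Field_section)
  have fh: "f (h H) = h (?g H)" if "H \<in> inner" for H
    using that bij_betw_inv_into_left[OF hb that] bij_betw_apply[OF hb that]
      by (simp add: f_def Field_section)
  have "f ` \<Phi>K = h ` (?g ` (\<Phi> \<inter> inner))" unfolding h(2)[symmetric] image_image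
    using fh by (intro image_cong) auto
  moreover have "?g ` (\<Phi> \<inter> inner) = ?g ` \<Phi> \<inter> ?g ` inner"
    using flags_subset_Field[OF base_flag] inner_Field
    by (intro inj_on_image_Int[OF inj_on_isomorphism[OF aut_iso[OF g]]]) auto
  ultimately have img: "f ` \<Phi>K = h ` (?g ` \<Phi> \<inter> inner)" using r(2) by simp
  have gF: "?g ` \<Phi> \<in> flags P" using aut_flag[OF g] .
  have go: "outer \<subseteq> ?g ` \<Phi>"
  proof
    fix F assume "F \<in> outer"
    then obtain j where j: "j \<in> {-1..a} \<union> {b..n}" "F = at \<Phi> j" unfolding outer_def by blast
    then have "j \<in> {-1..n}" "j \<noteq> ?k" using i ab by auto
    then have "?g F = F" "F \<in> \<Phi>"
      using rho_fixes[OF k(1), of j] at_in(1)[OF base_flag, of j] j by auto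
    then show "F \<in> ?g ` \<Phi>" by (metis imageI)
  qed
  have "adjacent_at P (i + a + 1) \<Phi> (?g ` \<Phi>)"
    using rho_spec(2)[OF k(1)] by (simp add: algebra_simps)
  then have "adjacent_at S i (\<Phi> \<inter> inner) (?g ` \<Phi> \<inter> inner)"
    using adjacent_at_section[OF base_flag outer_base gF go] by simp
  then have "adjacent_at K i (h ` (\<Phi> \<inter> inner)) (h ` (?g ` \<Phi> \<inter> inner))"
    using adjacent_at_image[OF h(1)] unfolding Field_section by blast
  then have "adjacent_at K i \<Phi>K (f ` \<Phi>K)" using h(2) img by simp
  then have "rho K \<Phi>K i = f"
    by (rule rho_eqI[OF thin_connected_isomorphic[OF thin_connected_section h(1)] \<Phi>K fc])
  then show "rho K \<Phi>K i \<in> carrier (aut_group K)"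
    and "H \<in> inner \<Longrightarrow> rho K \<Phi>K i (h H) = h (\<rho> (a + 1 + i) H)" using fc fh by auto
qed

text \<open>The isomorphism onto \<open>K\<close> carries the action of a shifted word to that of the word. Conversely, an
  element generated by the shifted generators is determined by its action on the section, because these
  generators fix the rest of the base flag.\<close>
theorem section_words:
  assumes K: "isomorphic S K" and \<Phi>K: "\<Phi>K \<in> flags K"
  shows "\<And>i. i \<in> {0..b - a - 2} \<Longrightarrow> rho K \<Phi>K i \<in> carrier (aut_group K)"
    and "\<And>u v. \<lbrakk>set u \<subseteq> {0..b - a - 2}; set v \<subseteq> {0..b - a - 2}\<rbrakk> \<Longrightarrow>
      word (aut_group K) (rho K \<Phi>K) u = word (aut_group K) (rho K \<Phi>K) v \<longleftrightarrow>
      wd (map ((+) (a + 1)) u) = wd (map ((+) (a + 1)) v)"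
proof -
  obtain h where h: "is_isomorphism S K h" "h ` (\<Phi> \<inter> inner) = \<Phi>K"
    using isomorphism_matching_flag[OF K \<Phi>K] .
  note rho = rho_section[OF h \<Phi>K]
  show "\<And>i. i \<in> {0..b - a - 2} \<Longrightarrow> rho K \<Phi>K i \<in> carrier (aut_group K)" using rho(1) .
  interpret AK: group "aut_group K" by (rule group_aut_group)
  let ?wK = "word (aut_group K) (rho K \<Phi>K)"
  let ?s = "map ((+) (a + 1))"
  have hb: "bij_betw h inner (Field K)" using h(1) by (simp add: is_isomorphism_def Field_section)
  have cK: "?wK u \<in> carrier (aut_group K)" if "set u \<subseteq> {0..b - a - 2}" for u
    using that by (induction u) (auto simp: rho(1))
  have sN: "set (?s u) \<subseteq> {a+1..b-1}" if "set u \<subseteq> {0..b - a - 2}" for u using that by auto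
  have sub: "{a+1..b-1} \<subseteq> N" using ab by auto
  have act: "wd (?s u) H \<in> inner \<and> ?wK u (h H) = h (wd (?s u) H)"
    if "set u \<subseteq> {0..b - a - 2}" "H \<in> inner" for u H
    using that(1)
  proof (induction u)
    case Nil
    then show ?case using that(2) inner_Field bij_betw_apply[OF hb] by (simp add: aut_one_apply)
  next
    case (Cons i u)
    then have u: "set u \<subseteq> {0..b - a - 2}" and i: "i \<in> {0..b - a - 2}" by auto
    have k: "a + 1 + i \<in> N" "a + 1 + i \<noteq> a" "a + 1 + i \<noteq> b" using i ab by auto
    have HF: "H \<in> Field P" "h H \<in> Field K" using that(2) inner_Field bij_betw_apply[OF hb] by auto
    have wc: "wd (?s u) \<in> carrier \<Gamma>" by (rule word_carrier[OF sub sN[OF u]])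
    have 1: "wd (?s (i # u)) H = \<rho> (a + 1 + i) (wd (?s u) H)"
      using aut_mult_apply[OF closed[OF k(1)] wc HF(1)] by simp
    have IH: "wd (?s u) H \<in> inner" "?wK u (h H) = h (wd (?s u) H)" using Cons.IH[OF u] by auto
    have "\<rho> (a + 1 + i) (at \<Phi> a) = at \<Phi> a" "\<rho> (a + 1 + i) (at \<Phi> b) = at \<Phi> b"
      using rho_fixes[OF k(1)] k ab by auto
    then have "\<rho> (a + 1 + i) ` inner = inner"
      using restrict_automorphism(2)[OF closed[OF k(1)]] by blast
    then have 2: "wd (?s (i # u)) H \<in> inner" unfolding 1 using IH(1) by blast
    have "?wK (i # u) (h H) = rho K \<Phi>K i (?wK u (h H))"
      using aut_mult_apply[OF rho(1)[OF i] cK[OF u] HF(2)] by simp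
    also have "\<dots> = h (\<rho> (a + 1 + i) (wd (?s u) H))" unfolding IH(2) using rho(2)[OF i IH(1)] .
    finally show ?case using 1 2 by simp
  qed
  fix u v assume u: "set u \<subseteq> {0..b - a - 2}" and v: "set v \<subseteq> {0..b - a - 2}"
  show "?wK u = ?wK v \<longleftrightarrow> wd (?s u) = wd (?s v)"
  proof
    assume eq: "wd (?s u) = wd (?s v)"
    show "?wK u = ?wK v"
    proof (rule aut_eqI[OF cK[OF u] cK[OF v]])
      fix y assume "y \<in> Field K"
      then obtain H where "H \<in> inner" "y = h H" using hb by (auto simp: bij_betw_def)
      then show "?wK u y = ?wK v y" using act[OF u] act[OF v] eq by auto
    qed
  next
    assume eq: "?wK u = ?wK v"
    have same: "wd (?s u) (at \<Phi> j) = wd (?s v) (at \<Phi> j)" if j: "j \<in> {-1..n}" for j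
    proof (cases "j \<in> {a..b}")
      case True
      then have H: "at \<Phi> j \<in> inner" using at_inner by auto
      then have "h (wd (?s u) (at \<Phi> j)) = h (wd (?s v) (at \<Phi> j))"
        using act[OF u H] act[OF v H] eq by simp
      then show ?thesis using act[OF u H] act[OF v H] hb by (auto simp: bij_betw_def dest: inj_onD)
    next
      case False
      have "j \<notin> set (?s u)" "j \<notin> set (?s v)" using sN[OF u] sN[OF v] False by auto
      then show ?thesis using word_fixes[OF _ j] sN[OF u] sN[OF v] sub by (metis subset_trans)
    qed
    have "wd (?s u) ` at \<Phi> ` {-1..n} = wd (?s v) ` at \<Phi> ` {-1..n}"
      unfolding image_image by (rule image_cong[OF refl same])
    then have "wd (?s u) ` \<Phi> = wd (?s v) ` \<Phi>" using flag_eq_at[OF base_flag] by simp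
    then show "wd (?s u) = wd (?s v)"
      by (rule aut_determined[OF word_carrier[OF sub sN[OF u]] word_carrier[OF sub sN[OF v]]])
  qed
qed

end

section \<open>The mix\<close>

abbreviation prod_aut :: "'a rel \<Rightarrow> 'b rel \<Rightarrow> (('a \<Rightarrow> 'a) \<times> ('b \<Rightarrow> 'b)) monoid" where
  "prod_aut P Q \<equiv> aut_group P \<times>\<times> aut_group Q"

abbreviation rho_pair :: "'a rel \<Rightarrow> 'a set \<Rightarrow> 'b rel \<Rightarrow> 'b set \<Rightarrow> int \<Rightarrow> ('a \<Rightarrow> 'a) \<times> ('b \<Rightarrow> 'b)" where
  "rho_pair P \<Phi> Q \<Psi> \<equiv> \<lambda>i. (rho P \<Phi> i, rho Q \<Psi> i)"

lemma word_DirProd: "word (G \<times>\<times> H) (\<lambda>i. (r i, s i)) w = (word G r w, word H s w)"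
  by (induction w) (simp_all add: DirProd_def)

lemma string_group_DirProd:
  assumes "string_group G r n" "string_group H s n"
  shows "string_group (G \<times>\<times> H) (\<lambda>i. (r i, s i)) n"
proof -
  interpret G: string_group G r n by fact
  interpret H: string_group H s n by fact
  interpret D: group "G \<times>\<times> H" by (rule DirProd_group[OF G.is_group H.is_group])
  show ?thesis
  proof
    show "(r i, s i) \<in> carrier (G \<times>\<times> H)" if "i \<in> {0..n-1}" for i
      using G.closed[OF that] H.closed[OF that] by (simp add: DirProd_def)
    show "(r i, s i) \<otimes>\<^bsub>G \<times>\<times> H\<^esub> (r i, s i) = \<one>\<^bsub>G \<times>\<times> H\<^esub>" if "i \<in> {0..n-1}" for i
      using G.invol[OF that] H.invol[OF that] by (simp add: DirProd_def)
    show "(r i, s i) \<otimes>\<^bsub>G \<times>\<times> H\<^esub> (r j, s j) = (r j, s j) \<otimes>\<^bsub>G \<times>\<times> H\<^esub> (r i, s i)"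
      if "0 \<le> i" "i + 1 < j" "j \<le> n - 1" for i j
      using G.far_comm[OF that] H.far_comm[OF that] by (simp add: DirProd_def)
    show "even (length w)"
      if "set w \<subseteq> {0..n-1}" "word (G \<times>\<times> H) (\<lambda>i. (r i, s i)) w = \<one>\<^bsub>G \<times>\<times> H\<^esub>" for w
      using G.parity[OF that(1)] that(2) unfolding word_DirProd by (simp add: DirProd_def)
    fix w assume w: "set w \<subseteq> {0..n-1}"
      and sep: "\<And>j. j \<in> {0..n-1} \<Longrightarrow> \<exists>v. set v \<subseteq> {0..n-1} - {j} \<and>
        word (G \<times>\<times> H) (\<lambda>i. (r i, s i)) v = word (G \<times>\<times> H) (\<lambda>i. (r i, s i)) w"
    have "word G r w = \<one>\<^bsub>G\<^esub>" by (rule G.separated[OF w]) (use sep in \<open>force simp: word_DirProd\<close>)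
    moreover have "word H s w = \<one>\<^bsub>H\<^esub>"
      by (rule H.separated[OF w]) (use sep in \<open>force simp: word_DirProd\<close>)
    ultimately show "word (G \<times>\<times> H) (\<lambda>i. (r i, s i)) w = \<one>\<^bsub>G \<times>\<times> H\<^esub>"
      unfolding word_DirProd by (simp add: DirProd_def)
  qed
qed

text \<open>The mix is defined inside the product of the rotation groups, but generates the same group inside the
  product of the full automorphism groups.\<close>
lemma mix_group_eq:
  assumes "string_group (prod_aut K K') (rho_pair K \<Phi> K' \<Psi>) m"
  shows "mix_group m K \<Phi> K' \<Psi> =
    (prod_aut K K')\<lparr>carrier := involution_system.even_span (prod_aut K K') (rho_pair K \<Phi> K' \<Psi>) {0..m-1}\<rparr>"
proof -
  interpret string_group "prod_aut K K'" "rho_pair K \<Phi> K' \<Psi>" m by fact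
  interpret A: group "aut_group K" by (rule group_aut_group)
  interpret B: group "aut_group K'" by (rule group_aut_group)
  have c: "rho K \<Phi> i \<in> carrier (aut_group K)" "rho K' \<Psi> i \<in> carrier (aut_group K')" if "i \<in> {0..m-1}" for i
    using closed[OF that] by (auto simp: DirProd_def)
  let ?A = "generate (aut_group K) (sigma K \<Phi> ` {1..m-1})"
  let ?B = "generate (aut_group K') (sigma K' \<Psi> ` {1..m-1})"
  have sub: "sigma K \<Phi> ` {1..m-1} \<subseteq> carrier (aut_group K)" "sigma K' \<Psi> ` {1..m-1} \<subseteq> carrier (aut_group K')"
    using c by (auto simp: sigma_def)
  have AB: "subgroup (?A \<times> ?B) (prod_aut K K')"
    by (rule DirProd_subgroups[OF A.is_group A.generate_is_subgroup[OF sub(1)]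
          B.is_group B.generate_is_subgroup[OF sub(2)]])
  have D: "rotation_group m K \<Phi> \<times>\<times> rotation_group m K' \<Psi> = (prod_aut K K')\<lparr>carrier := ?A \<times> ?B\<rparr>"
    by (simp add: DirProd_def rotation_group_def)
  have beta: "beta K \<Phi> K' \<Psi> = rot"
    by (rule ext) (simp add: beta_def sigma_def DirProd_def)
  have "beta K \<Phi> K' \<Psi> ` {1..m-1} \<subseteq> ?A \<times> ?B"
    by (auto simp: beta_def intro: generate.incl)
  then have "generate ((prod_aut K K')\<lparr>carrier := ?A \<times> ?B\<rparr>) (beta K \<Phi> K' \<Psi> ` {1..m-1}) =
      generate (prod_aut K K') (beta K \<Phi> K' \<Psi> ` {1..m-1})"
    by (rule generate_consistent[OF _ AB])
  also have "\<dots> = even_span {0..m-1}" unfolding beta by (rule generate_rot)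
  finally show ?thesis unfolding mix_group_def Let_def D by simp
qed

lemma polytope_mix_iff:
  assumes "string_group (prod_aut K K') (rho_pair K \<Phi> K' \<Psi>) m" "3 \<le> m"
  shows "polytope m (mix m K \<Phi> K' \<Psi>) \<longleftrightarrow>
    intersection_property (prod_aut K K') (rho_pair K \<Phi> K' \<Psi>) {0..m-1}"
proof -
  interpret string_group "prod_aut K K'" "rho_pair K \<Phi> K' \<Psi>" m by fact
  interpret string_group_ge3 "prod_aut K K'" "rho_pair K \<Phi> K' \<Psi>" m
    by unfold_locales (rule assms(2))
  have beta: "beta K \<Phi> K' \<Psi> = rot"
    by (rule ext) (simp add: beta_def sigma_def DirProd_def)
  have "mix m K \<Phi> K' \<Psi> = coset_poset m R rot"
    using assms(2) unfolding mix_def mix_group_eq[OF assms(1)] beta by simp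
  then show ?thesis using polytope_coset_poset_iff by simp
qed

text \<open>Each maximal subgroup contains one of the two words.\<close>
lemma (in string_group) disjoint_words:
  assumes "set u \<subseteq> N" "set v \<subseteq> N" "set u \<inter> set v = {}" "wd u = wd v"
  shows "wd u = \<one>"
proof (rule separated[OF assms(1)])
  fix j
  show "\<exists>w. set w \<subseteq> N - {j} \<and> wd w = wd u"
  proof (cases "j \<in> set u")
    case True
    then show ?thesis using assms by (intro exI[of _ v]) auto
  next
    case False
    then show ?thesis using assms(1) by (intro exI[of _ u]) auto
  qed
qed

lemma (in string_group) intersection_property_consecutive:
  assumes "{k, k + 1} \<subseteq> N"
  shows "intersection_property G r {k, k + 1}"
  unfolding intersection_property_def
proof (intro allI impI)
  fix u v assume uv: "set u \<subseteq> {k, k + 1} \<and> set v \<subseteq> {k, k + 1} \<and> wd u = wd v"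
  consider "set u \<subseteq> set v" | "set v \<subseteq> set u" | "set u \<inter> set v = {}" using uv by blast
  then show "\<exists>w. set w \<subseteq> set u \<inter> set v \<and> wd w = wd u"
  proof cases
    case 1 then show ?thesis by (intro exI[of _ u]) auto
  next
    case 2 then show ?thesis using uv by (intro exI[of _ v]) auto
  next
    case 3
    moreover have "set u \<subseteq> N" "set v \<subseteq> N" using uv assms by blast+
    ultimately have "wd u = \<one>" using disjoint_words[of u v] uv by blast
    then show ?thesis by (intro exI[of _ "[]"]) auto
  qed
qed

lemma section_pair:
  assumes "base_section n P \<Phi> a b" "base_section n Q \<Psi> a b"
    and K: "isomorphic (face_section P (face_at P \<Phi> a) (face_at P \<Phi> b)) K"
    and K': "isomorphic (face_section Q (face_at Q \<Psi> a) (face_at Q \<Psi> b)) K'"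
    and flags: "\<Phi>K \<in> flags K" "\<Psi>K \<in> flags K'"
  shows "string_group (prod_aut K K') (rho_pair K \<Phi>K K' \<Psi>K) (b - a - 1)"
    and "intersection_property (prod_aut K K') (rho_pair K \<Phi>K K' \<Psi>K) {0..b - a - 2} \<Longrightarrow>
      intersection_property (prod_aut P Q) (rho_pair P \<Phi> Q \<Psi>) {a + 1..b - 1}"
proof -
  interpret P: base_section n P \<Phi> a b by fact
  interpret Q: base_section n Q \<Psi> a b by fact
  interpret PQ: string_group "prod_aut P Q" "rho_pair P \<Phi> Q \<Psi>" n
    by (rule string_group_DirProd[OF P.string_group_axioms Q.string_group_axioms])
  have grp: "group (prod_aut K K')" by (rule DirProd_group[OF group_aut_group group_aut_group])
  have m: "b - a - 1 - 1 = b - a - 2" by simp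
  have c: "rho_pair K \<Phi>K K' \<Psi>K i \<in> carrier (prod_aut K K')" if "i \<in> {0..b - a - 1 - 1}" for i
    using P.section_words(1)[OF K flags(1), of i] Q.section_words(1)[OF K' flags(2), of i] that
    by (simp add: DirProd_def)
  have s: "0 \<le> a + 1" "(a + 1) + (b - a - 1) \<le> n" using P.ab by auto
  have kernel: "word (prod_aut K K') (rho_pair K \<Phi>K K' \<Psi>K) u = word (prod_aut K K') (rho_pair K \<Phi>K K' \<Psi>K) v \<longleftrightarrow>
      word (prod_aut P Q) (rho_pair P \<Phi> Q \<Psi>) (map ((+) (a + 1)) u) =
      word (prod_aut P Q) (rho_pair P \<Phi> Q \<Psi>) (map ((+) (a + 1)) v)"
    if "set u \<subseteq> {0..b - a - 1 - 1}" "set v \<subseteq> {0..b - a - 1 - 1}" for u v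
    using P.section_words(2)[OF K flags(1), of u v] Q.section_words(2)[OF K' flags(2), of u v] that
    unfolding word_DirProd m by simp
  note transfer = PQ.string_group_transfer[OF grp c s kernel]
  show "string_group (prod_aut K K') (rho_pair K \<Phi>K K' \<Psi>K) (b - a - 1)"
    by (rule transfer(1))
  assume ip: "intersection_property (prod_aut K K') (rho_pair K \<Phi>K K' \<Psi>K) {0..b - a - 2}"
  have "intersection_property (prod_aut P Q) (rho_pair P \<Phi> Q \<Psi>) ((+) (a + 1) ` {0..b - a - 2})"
    by (rule transfer(2)) (use ip in auto)
  moreover have "(+) (a + 1) ` {0..b - a - 2} = {a + 1..b - 1}" by (simp add: add.commute)
  ultimately show "intersection_property (prod_aut P Q) (rho_pair P \<Phi> Q \<Psi>) {a + 1..b - 1}" by simp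
qed

lemma (in base_section) section_rotations:
  assumes K: "isomorphic S K" and \<Phi>K: "\<Phi>K \<in> flags K"
  shows "carrier (rotation_group (b - a - 1) K \<Phi>K) =
    {word (aut_group K) (rho K \<Phi>K) w | w. set w \<subseteq> {0..b - a - 2} \<and> even (length w)}"
proof -
  have m: "b - a - 1 - 1 = b - a - 2" by simp
  have s: "0 \<le> a + 1" "(a + 1) + (b - a - 1) \<le> n" using ab by auto
  interpret K: string_group "aut_group K" "rho K \<Phi>K" "b - a - 1"
    by (rule string_group_transfer(1)[OF group_aut_group _ s], unfold m)
      (rule section_words[OF K \<Phi>K], assumption+)+
  show ?thesis using K.generate_rot unfolding K.even_span_def m
    by (simp add: rotation_group_def sigma_def)
qed

text \<open>From \<open>n = 4\<close> on the mix of the sections is a coset poset. For \<open>n = 3\<close> it is a polygon, which is not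
  built from cosets, but then the section only has two generators.\<close>
lemma intersection_property_pair_section:
  assumes sec: "base_section n P \<Phi> a b" "base_section n Q \<Psi> a b" and len: "b - a - 1 = n - 1" and n: "3 \<le> n"
    and K: "isomorphic (face_section P (face_at P \<Phi> a) (face_at P \<Phi> b)) K"
    and K': "isomorphic (face_section Q (face_at Q \<Psi> a) (face_at Q \<Psi> b)) K'"
    and flags: "\<Phi>K \<in> flags K" "\<Psi>K \<in> flags K'"
    and poly: "polytope (n - 1) (mix (n - 1) K \<Phi>K K' \<Psi>K)"
  shows "intersection_property (prod_aut P Q) (rho_pair P \<Phi> Q \<Psi>) {a + 1..b - 1}"
proof -
  note sp = section_pair[OF sec K K' flags]
  have sg: "string_group (prod_aut K K') (rho_pair K \<Phi>K K' \<Psi>K) (n - 1)" using sp(1) unfolding len .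
  have "intersection_property (prod_aut K K') (rho_pair K \<Phi>K K' \<Psi>K) {0..n - 1 - 1}"
  proof (cases "n = 3")
    case True
    then have "{0..n - 1 - 1} = {0, 0 + 1}" by auto
    then show ?thesis using string_group.intersection_property_consecutive[OF sg, of 0] by simp
  next
    case False
    then show ?thesis using polytope_mix_iff[OF sg] n poly by simp
  qed
  moreover have "n - 1 - 1 = b - a - 2" using len by simp
  ultimately show ?thesis using sp(2) by simp
qed

lemma directly_regular_polygon_vertices:
  assumes "directly_regular 2 P" "\<Phi> \<in> flags P"
  shows "card (faces P 0) \<noteq> 1"
proof -
  interpret directly_regular_polytope 2 P \<Phi> by unfold_locales fact+
  obtain H where H: "H \<noteq> at \<Phi> 0" "H \<in> faces P 0" using diamond[OF base_flag, of 0] by auto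
  have "at \<Phi> 0 \<in> faces P 0" using at_faces[OF base_flag] by simp
  then show ?thesis using H by (metis card_1_singletonE singletonD)
qed

text \<open>The hypothesis on the medial sections in terms of words: even words for the two
  components can be chosen independently of each other.\<close>
lemma middle_section_independent:
  assumes sec: "base_section n P \<Phi> 0 (n - 1)" "base_section n Q \<Psi> 0 (n - 1)"
    and M: "isomorphic (face_section P (face_at P \<Phi> 0) (face_at P \<Phi> (n - 1))) M"
    and M': "isomorphic (face_section Q (face_at Q \<Psi> 0) (face_at Q \<Psi> (n - 1))) M'"
    and flags: "\<Phi>M \<in> flags M" "\<Psi>M \<in> flags M'"
    and direct: "carrier (mix_group (n - 2) M \<Phi>M M' \<Psi>M) =
      carrier (rotation_group (n - 2) M \<Phi>M \<times>\<times> rotation_group (n - 2) M' \<Psi>M)"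
    and u: "set u \<subseteq> {1..n - 2}" "even (length u)" and v: "set v \<subseteq> {1..n - 2}" "even (length v)"
  shows "\<exists>w. set w \<subseteq> {1..n - 2} \<and> word (aut_group P) (rho P \<Phi>) w = word (aut_group P) (rho P \<Phi>) u \<and>
    word (aut_group Q) (rho Q \<Psi>) w = word (aut_group Q) (rho Q \<Psi>) v"
proof -
  interpret P: base_section n P \<Phi> 0 "n - 1" by fact
  interpret Q: base_section n Q \<Psi> 0 "n - 1" by fact
  have m: "n - 1 - 0 - 1 = n - 2" "n - 1 - 0 - 2 = n - 3" by simp_all
  have sg: "string_group (prod_aut M M') (rho_pair M \<Phi>M M' \<Psi>M) (n - 2)"
    using section_pair(1)[OF sec M M' flags] unfolding m .
  interpret MM: string_group "prod_aut M M'" "rho_pair M \<Phi>M M' \<Psi>M" "n - 2" by (rule sg)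
  let ?wM = "word (aut_group M) (rho M \<Phi>M)" and ?wM' = "word (aut_group M') (rho M' \<Psi>M)"
  let ?up = "map ((+) (0 + 1))" and ?down = "map (\<lambda>i. i - 1 :: int)"
  have up_down: "?up (?down w) = w" for w :: "int list" by (simp add: comp_def)
  have down: "set (?down w) \<subseteq> {0..n - 3}" if "set w \<subseteq> {1..n - 2}" for w using that by auto
  have "?wM (?down u) \<in> carrier (rotation_group (n - 2) M \<Phi>M)"
    using P.section_rotations[OF M flags(1)] down[OF u(1)] u(2) unfolding m
    by (simp del: set_map) (intro exI[of _ "?down u"], simp)
  moreover have "?wM' (?down v) \<in> carrier (rotation_group (n - 2) M' \<Psi>M)"
    using Q.section_rotations[OF M' flags(2)] down[OF v(1)] v(2) unfolding m
    by (simp del: set_map) (intro exI[of _ "?down v"], simp)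
  ultimately have "(?wM (?down u), ?wM' (?down v)) \<in> carrier (mix_group (n - 2) M \<Phi>M M' \<Psi>M)"
    unfolding direct by (simp add: DirProd_def)
  then have "(?wM (?down u), ?wM' (?down v)) \<in> MM.even_span {0..n - 2 - 1}"
    unfolding mix_group_eq[OF sg] by simp
  then obtain w where w: "set w \<subseteq> {0..n - 2 - 1}" "?wM w = ?wM (?down u)" "?wM' w = ?wM' (?down v)"
    unfolding MM.even_span_def word_DirProd by auto
  then have w0: "set w \<subseteq> {0..n - 3}" by auto
  have "P.wd (?up w) = P.wd u" "Q.wd (?up w) = Q.wd v"
    using P.section_words(2)[OF M flags(1), of w "?down u"] Q.section_words(2)[OF M' flags(2), of w "?down v"]
      w w0 down[OF u(1)] down[OF v(1)] unfolding m up_down by blast+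
  moreover have "set (?up w) \<subseteq> {1..n - 2}" using w0 by auto
  ultimately show ?thesis by blast
qed

text \<open>Each component fixes the base vertex and the base facet, so it is a word with indices in \<open>{1..n - 2}\<close>.
  The two words may differ, but their lengths have the same parity.\<close>
lemma end_sections_meet_in_middle:
  assumes sec: "base_section n P \<Phi> 0 (n - 1)" "base_section n Q \<Psi> 0 (n - 1)" and n: "3 \<le> n"
    and independent: "\<And>u v. \<lbrakk>set u \<subseteq> {1..n - 2}; even (length u); set v \<subseteq> {1..n - 2}; even (length v)\<rbrakk> \<Longrightarrow>
      \<exists>w. set w \<subseteq> {1..n - 2} \<and> word (aut_group P) (rho P \<Phi>) w = word (aut_group P) (rho P \<Phi>) u \<and>
        word (aut_group Q) (rho Q \<Psi>) w = word (aut_group Q) (rho Q \<Psi>) v"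
    and u: "set u \<subseteq> {0..n - 2}" and v: "set v \<subseteq> {1..n - 1}"
    and eq: "word (prod_aut P Q) (rho_pair P \<Phi> Q \<Psi>) u = word (prod_aut P Q) (rho_pair P \<Phi> Q \<Psi>) v"
  shows "\<exists>w. set w \<subseteq> {1..n - 2} \<and>
    word (prod_aut P Q) (rho_pair P \<Phi> Q \<Psi>) w = word (prod_aut P Q) (rho_pair P \<Phi> Q \<Psi>) u"
proof -
  interpret P: base_section n P \<Phi> 0 "n - 1" by fact
  interpret Q: base_section n Q \<Psi> 0 "n - 1" by fact
  have eqP: "P.wd u = P.wd v" and eqQ: "Q.wd u = Q.wd v" using eq unfolding word_DirProd by auto
  have uN: "set u \<subseteq> {0..n-1}" and vN: "set v \<subseteq> {0..n-1}" using u v by auto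
  have mid: "{1..n - 2} \<subseteq> {0..n-1}" by auto
  have away: "j \<notin> set u \<or> j \<notin> set v" if "j \<in> {-1..n} - {1..n-2}" for j
    using that u v by (cases "j \<le> 0") force+
  have "P.wd u (P.at \<Phi> j) = P.at \<Phi> j" if "j \<in> {-1..n} - {1..n-2}" for j
    using away[OF that] P.word_fixes[OF uN, of j] P.word_fixes[OF vN, of j] that eqP by auto
  then obtain u1 where u1: "set u1 \<subseteq> {1..n-2}" "P.wd u1 = P.wd u"
    using P.word_of_stabilizer[OF P.word_closed[OF uN] mid] by blast
  have "Q.wd u (Q.at \<Psi> j) = Q.at \<Psi> j" if "j \<in> {-1..n} - {1..n-2}" for j
    using away[OF that] Q.word_fixes[OF uN, of j] Q.word_fixes[OF vN, of j] that eqQ by auto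
  then obtain u2 where u2: "set u2 \<subseteq> {1..n-2}" "Q.wd u2 = Q.wd u"
    using Q.word_of_stabilizer[OF Q.word_closed[OF uN] mid] by blast
  have par: "even (length u1) \<longleftrightarrow> even (length u)" "even (length u2) \<longleftrightarrow> even (length u)"
    using P.word_parity[of u1 u] Q.word_parity[of u2 u] u1 u2 uN mid by blast+
  show ?thesis
  proof (cases "even (length u)")
    case True
    then obtain w where "set w \<subseteq> {1..n - 2}" "P.wd w = P.wd u1" "Q.wd w = Q.wd u2"
      using independent[of u1 u2] u1 u2 par by blast
    then show ?thesis using u1 u2 unfolding word_DirProd by (intro exI[of _ w]) simp
  next
    case False
    \<comment> \<open>Prefixing the letter 1 makes both words even; it is cancelled again afterwards.\<close>
    have one: "1 \<in> {1..n-2}" "1 \<in> {0..n-1}" using n by auto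
    obtain w where w: "set w \<subseteq> {1..n - 2}" "P.wd w = P.wd (1 # u1)" "Q.wd w = Q.wd (1 # u2)"
      using independent[of "1 # u1" "1 # u2"] u1 u2 par False one by auto
    have "P.wd (1 # w) = P.wd u1"
      using w(2) P.closed[OF one(2)] P.invol[OF one(2)] P.word_carrier[OF mid u1(1)]
      by (simp add: P.m_assoc[symmetric])
    moreover have "Q.wd (1 # w) = Q.wd u2"
      using w(3) Q.closed[OF one(2)] Q.invol[OF one(2)] Q.word_carrier[OF mid u2(1)]
      by (simp add: Q.m_assoc[symmetric])
    ultimately show ?thesis
      using u1 u2 w(1) one unfolding word_DirProd by (intro exI[of _ "1 # w"]) simp
  qed
qed

theorem proposition3p12:
  fixes n :: int
    and P :: "'p rel" and K :: "'k rel" and L :: "'l rel" and M :: "'m rel"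
    and Q :: "'q rel" and K' :: "'k1 rel" and L' :: "'l1 rel" and M' :: "'m1 rel"
    and \<Phi> :: "'p set" and \<Phi>K :: "'k set" and \<Phi>L :: "'l set" and \<Phi>M :: "'m set"
    and \<Psi> :: "'q set" and \<Psi>K :: "'k1 set" and \<Psi>L :: "'l1 set" and \<Psi>M :: "'m1 set"
  assumes "directly_regular n P"
    and "\<forall>F \<in> faces P (n - 1). isomorphic (face_section P (least_face P) F) K"
    and "\<forall>V \<in> faces P 0. isomorphic (face_section P V (greatest_face P)) L"
    and "\<forall>V \<in> faces P 0. \<forall>F \<in> faces P (n - 1). (V, F) \<in> P \<longrightarrow> isomorphic (face_section P V F) M"
    and "directly_regular n Q"
    and "\<forall>F \<in> faces Q (n - 1). isomorphic (face_section Q (least_face Q) F) K'"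
    and "\<forall>V \<in> faces Q 0. isomorphic (face_section Q V (greatest_face Q)) L'"
    and "\<forall>V \<in> faces Q 0. \<forall>F \<in> faces Q (n - 1). (V, F) \<in> Q \<longrightarrow> isomorphic (face_section Q V F) M'"
    and "\<Phi> \<in> flags P" and "\<Phi>K \<in> flags K" and "\<Phi>L \<in> flags L" and "\<Phi>M \<in> flags M"
    and "\<Psi> \<in> flags Q" and "\<Psi>K \<in> flags K'" and "\<Psi>L \<in> flags L'" and "\<Psi>M \<in> flags M'"
    and "polytope (n - 1) (mix (n - 1) K \<Phi>K K' \<Psi>K)"
    and "polytope (n - 1) (mix (n - 1) L \<Phi>L L' \<Psi>L)"
    and "carrier (mix_group (n - 2) M \<Phi>M M' \<Psi>M) =
           carrier (rotation_group (n - 2) M \<Phi>M \<times>\<times> rotation_group (n - 2) M' \<Psi>M)"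
  shows "polytope n (mix n P \<Phi> Q \<Psi>)"
proof -
  interpret P: directly_regular_polytope n P \<Phi> by unfold_locales fact+
  interpret Q: directly_regular_polytope n Q \<Psi> by unfold_locales fact+
  consider "n = 1" | "n = 2" | "3 \<le> n" using P.rank_positive by linarith
  then show ?thesis
  proof cases
    case 1
    then show ?thesis using polytope_segment by (simp add: mix_def)
  next
    case 2
    have "lcm (card (faces P 0)) (card (faces Q 0)) \<noteq> 1"
      using directly_regular_polygon_vertices[of P \<Phi>] assms(1,9) 2 by auto
    then show ?thesis using 2 polytope_polygon[of "lcm (card (faces P 0)) (card (faces Q 0))"]
      by (simp add: mix_def)
  next
    case n: 3
    have base: "base_section n P \<Phi> a b" "base_section n Q \<Psi> a b" if "-1 \<le> a" "a < b" "b \<le> n" for a b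
      using that by unfold_locales auto
    have ends: "P.at \<Phi> (-1) = least_face P" "Q.at \<Psi> (-1) = least_face Q"
      "P.at \<Phi> n = greatest_face P" "Q.at \<Psi> n = greatest_face Q"
      using P.least_face_at[OF assms(9)] Q.least_face_at[OF assms(13)]
        P.greatest_face_at[OF assms(9)] Q.greatest_face_at[OF assms(13)] n by auto
    have faces: "P.at \<Phi> 0 \<in> faces P 0" "P.at \<Phi> (n - 1) \<in> faces P (n - 1)"
      "Q.at \<Psi> 0 \<in> faces Q 0" "Q.at \<Psi> (n - 1) \<in> faces Q (n - 1)"
      using P.at_faces[OF assms(9)] Q.at_faces[OF assms(13)] n by auto
    have le: "(P.at \<Phi> 0, P.at \<Phi> (n - 1)) \<in> P" "(Q.at \<Psi> 0, Q.at \<Psi> (n - 1)) \<in> Q"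
      using P.at_le[OF assms(9)] Q.at_le[OF assms(13)] n by auto
    let ?G = "prod_aut P Q" and ?r = "rho_pair P \<Phi> Q \<Psi>"
    have sg: "string_group ?G ?r n"
      by (rule string_group_DirProd[OF P.string_group_axioms Q.string_group_axioms])
    interpret PQ: string_group ?G ?r n by (rule sg)
    have "intersection_property ?G ?r {-1 + 1..n - 1 - 1}"
      by (rule intersection_property_pair_section[OF base _ n, of "-1" "n - 1" K K' \<Phi>K \<Psi>K])
        (use n assms(2,6,10,14,17) ends faces in auto)
    then have ipK: "intersection_property ?G ?r {0..n - 2}" by simp
    have "intersection_property ?G ?r {0 + 1..n - 1}"
      by (rule intersection_property_pair_section[OF base _ n, of 0 n L L' \<Phi>L \<Psi>L])
        (use n assms(3,7,11,15,18) ends faces in auto)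
    then have ipL: "intersection_property ?G ?r {1..n - 1}" by simp
    have sec: "base_section n P \<Phi> 0 (n - 1)" "base_section n Q \<Psi> 0 (n - 1)" using base n by auto
    have M: "isomorphic (face_section P (P.at \<Phi> 0) (P.at \<Phi> (n - 1))) M"
      "isomorphic (face_section Q (Q.at \<Psi> 0) (Q.at \<Psi> (n - 1))) M'"
      using assms(4,8) faces le by blast+
    have "PQ.span {0..n - 2} \<inter> PQ.span {1..n - 1} \<subseteq> PQ.span {1..n - 2}"
    proof
      fix g assume g: "g \<in> PQ.span {0..n - 2} \<inter> PQ.span {1..n - 1}"
      obtain u where u: "set u \<subseteq> {0..n - 2}" "g = PQ.wd u" using g by (auto simp: PQ.span_def)
      obtain v where v: "set v \<subseteq> {1..n - 1}" "g = PQ.wd v" using g by (auto simp: PQ.span_def)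
      obtain w where w: "set w \<subseteq> {1..n - 2}" "PQ.wd w = PQ.wd u"
        using end_sections_meet_in_middle[OF sec n
            middle_section_independent[OF sec M assms(12,16,19)] u(1) v(1)] u(2) v(2) by blast
      have "PQ.wd w \<in> PQ.span {1..n - 2}" by (rule PQ.span_wordI[OF w(1)])
      then show "g \<in> PQ.span {1..n - 2}" unfolding u(2) w(2) .
    qed
    then have "intersection_property ?G ?r {0..n - 1}"
      by (rule PQ.intersection_property_from_ends[OF ipK ipL])
    then show ?thesis using polytope_mix_iff[OF sg n] by simp
  qed
qed

end
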